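(* There exists a pair $(\rho,\mathbf A)$ of a density and a vector potential for which Diener's current density functional $F_{\mathrm D}$ fails to reconstruct the external vector potential, in the following sense. Let $\mathbf j=\mathbf j^{\mathrm p}_0+\rho\mathbf A$ be the total current density of $(\rho,\mathbf A)$, where $\mathbf j^{\mathrm p}_0$ is a paramagnetic current density attaining the infimum in the Grayce--Harris functional $G(\rho,\mathbf A)$. Then for any minimizer $\mathbf j^{\mathrm p}_{\mathrm m}$ in $$F_{\mathrm D}(\rho,\mathbf j)=\inf_{\mathbf j^{\mathrm p}}\Big\{F_{\mathrm{VR}}(\rho,\mathbf j^{\mathrm p})-\int\frac{|\mathbf j^{\mathrm p}-\mathbf j|^2}{2\rho}\,\mathrm d\mathbf r\Big\}$$ we have $$\frac{\mathbf j-\mathbf j^{\mathrm p}_{\mathrm m}}{\rho}\neq\mathbf A .$$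
   Context: Setting: $N$ electrons in $\mathbb R^3$ (spin is ignored), atomic units. For a scalar potential $v:\mathbb R^3\to\mathbb R$ and a vector potential $\mathbf A:\mathbb R^3\to\mathbb R^3$, the Hamiltonian is $H(v,\mathbf A)=\frac12\sum_j(-\mathrm i\nabla_j+\mathbf A(\mathbf r_j))^2+\sum_j v(\mathbf r_j)+W$, with $W=\sum_{i<j}|\mathbf r_i-\mathbf r_j|^{-1}$, and $H_0=H(0,\mathbf 0)$. States $\Gamma$ are mixed $N$-electron states (density matrices). For a pure state $\psi$, the density is $\rho_\psi(\mathbf r_1)=N\int|\psi|^2\,\mathrm d\mathbf r_2\cdots\mathrm d\mathbf r_N$ and the paramagnetic current density is $\mathbf j^{\mathrm p}_\psi(\mathbf r_1)=N\,\mathrm{Im}\int\bar\psi\nabla_1\psi\,\mathrm d\mathbf r_2\cdots\mathrm d\mathbf r_N$; these are extended to mixed states by convex combination. $\Gamma\mapsto\rho$ (resp. $\Gamma\mapsto(\rho,\mathbf j^{\mathrm p})$) means that $\Gamma$ has density $\rho$ (resp. density $\rho$ and paramagnetic current density $\mathbf j^{\mathrm p}$). Here $\rho$ denotes an $N$-electron density, $N=\int\rho\,\mathrm d\mathbf r$. Vignale--Rasolt functional: $F_{\mathrm{VR}}(\rho,\mathbf j^{\mathrm p})=\inf_{\Gamma\mapsto(\rho,\mathbf j^{\mathrm p})}\mathrm{tr}(H_0\Gamma)$. Grayce--Harris functional: $G(\rho,\mathbf A)=\inf_{\Gamma\mapsto\rho}\mathrm{tr}(H(0,\mathbf A)\Gamma)=\int\frac12\rho|\mathbf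 A|^2\,\mathrm d\mathbf r+\inf_{\mathbf j^{\mathrm p}}\{F_{\mathrm{VR}}(\rho,\mathbf j^{\mathrm p})+\int\mathbf j^{\mathrm p}\cdot\mathbf A\,\mathrm d\mathbf r\}$. Equivalently, $G(\rho,\mathbf A)=\inf_{\mathbf j^{\mathrm p}}\sup_{\mathbf k}\{F_{\mathrm{VR}}(\rho,\mathbf j^{\mathrm p})+\int\mathbf k\cdot\mathbf A\,\mathrm d\mathbf r-\int\frac{|\mathbf j^{\mathrm p}-\mathbf k|^2}{2\rho}\,\mathrm d\mathbf r\}$, and at a solution of this minimax problem $\mathbf k=\mathbf j^{\mathrm p}+\rho\mathbf A$ is the total current density. *)

theory Defs
  imports "HOL-Analysis.Analysis" "HOL-Combinatorics.Permutations"
begin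

section \<open>Configuration space and weak gradients\<close>

type_synonym config = "nat \<Rightarrow> real^3"
type_synonym field = "real^3 \<Rightarrow> real^3"

text \<open>
  The particle number \<open>N\<close> is a term, so \<open>(\<real>\<^sup>3)\<^sup>N\<close> is the extensional product over \<open>{..<N}\<close>;
  particle \<open>0\<close> plays the role of \<open>\<^bold>r\<^sub>1\<close>.
\<close>

abbreviation configs :: "nat \<Rightarrow> config measure" where
  "configs N \<equiv> Pi\<^sub>M {..<N} (\<lambda>_. lborel)"

definition partial :: "nat \<Rightarrow> 3 \<Rightarrow> (config \<Rightarrow> real) \<Rightarrow> config \<Rightarrow> real" where
  "partial j a \<phi> x = deriv (\<lambda>t. \<phi> (x(j := x j + t *\<^sub>R axis a 1))) 0"

text \<open>
  Real-valued \<open>C\<^sup>1\<close> functions with compact support on \<open>(\<real>\<^sup>3)\<^sup>N\<close>. For square-integrable functions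
  these define the same weak derivatives as smooth test functions do.
\<close>

definition test_function :: "nat \<Rightarrow> (config \<Rightarrow> real) \<Rightarrow> bool" where
  "test_function N \<phi> \<longleftrightarrow>
     continuous_on (space (configs N)) \<phi> \<and>
     (\<forall>j<N. \<forall>a. (\<forall>x\<in>space (configs N).
          (\<lambda>t::real. \<phi> (x(j := x j + t *\<^sub>R axis a 1))) differentiable (at 0)) \<and>
        continuous_on (space (configs N)) (partial j a \<phi>)) \<and>
     (\<exists>R. \<forall>x\<in>space (configs N). (\<exists>j<N. R < norm (x j)) \<longrightarrow> \<phi> x = 0)"

definition weak_gradient :: "nat \<Rightarrow> (config \<Rightarrow> complex) \<Rightarrow> (nat \<Rightarrow> config \<Rightarrow> complex^3) \<Rightarrow> bool" where
  "weak_gradient N \<psi> g \<longleftrightarrow>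
     (\<forall>j<N. g j \<in> borel_measurable (configs N) \<and>
        (\<integral>\<^sup>+x. ennreal ((norm (g j x))\<^sup>2) \<partial>configs N) < \<infinity> \<and>
        (\<forall>a \<phi>. test_function N \<phi> \<longrightarrow>
           (\<integral>x. \<psi> x * of_real (partial j a \<phi> x) \<partial>configs N)
             = - (\<integral>x. (g j x $ a) * of_real (\<phi> x) \<partial>configs N)))"

text \<open>\<open>wgrad N \<psi> j\<close> is \<open>\<nabla>\<^sub>j \<psi>\<close>; it is determined up to null sets when \<open>\<psi>\<close> is in \<open>H\<^sup>1\<close>.\<close>

definition wgrad :: "nat \<Rightarrow> (config \<Rightarrow> complex) \<Rightarrow> nat \<Rightarrow> config \<Rightarrow> complex^3" where
  "wgrad N \<psi> = (SOME g. weak_gradient N \<psi> g)"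

section \<open>Pure states\<close>

text \<open>
  The \<open>H\<^sup>1\<close> condition makes the current density meaningful. Dropping it would only add states
  of infinite energy, which do not affect any of the infima below.
\<close>

definition pure_state :: "nat \<Rightarrow> (config \<Rightarrow> complex) \<Rightarrow> bool" where
  "pure_state N \<psi> \<longleftrightarrow>
     \<psi> \<in> borel_measurable (configs N) \<and>
     (\<integral>\<^sup>+x. ennreal ((norm (\<psi> x))\<^sup>2) \<partial>configs N) = 1 \<and>
     (\<forall>\<pi>. \<pi> permutes {..<N} \<longrightarrow>
        (AE x in configs N. \<psi> (\<lambda>i. x (\<pi> i)) = of_int (sign \<pi>) * \<psi> x)) \<and>
     (\<exists>g. weak_gradient N \<psi> g)"

definition density :: "nat \<Rightarrow> (config \<Rightarrow> complex) \<Rightarrow> real^3 \<Rightarrow> real" where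
  "density N \<psi> r =
     real N * (\<integral>x. (norm (\<psi> (x(0 := r))))\<^sup>2 \<partial>Pi\<^sub>M {1..<N} (\<lambda>_. lborel))"

definition para_current :: "nat \<Rightarrow> (config \<Rightarrow> complex) \<Rightarrow> field" where
  "para_current N \<psi> r =
     (\<chi> a. real N * Im (\<integral>x. cnj (\<psi> (x(0 := r))) * (wgrad N \<psi> 0 (x(0 := r)) $ a)
                          \<partial>Pi\<^sub>M {1..<N} (\<lambda>_. lborel)))"

text \<open>
  The quadratic form \<open>\<langle>\<psi>, H(0,A) \<psi>\<rangle>\<close> of
  \<open>H(0,A) = (1/2) \<Sum>\<^sub>j (-i \<nabla>\<^sub>j + A(r\<^sub>j))\<^sup>2 + \<Sum>\<^sub>i\<^sub><\<^sub>j 1/|r\<^sub>i - r\<^sub>j|\<close>, with values in \<open>[0,\<infinity>]\<close>.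
\<close>

definition pure_energy :: "nat \<Rightarrow> field \<Rightarrow> (config \<Rightarrow> complex) \<Rightarrow> ennreal" where
  "pure_energy N A \<psi> =
     (\<Sum>j<N. \<integral>\<^sup>+x. ennreal (1/2 * (norm (\<chi> a. - \<i> * (wgrad N \<psi> j x $ a)
                                        + of_real (A (x j) $ a) * \<psi> x))\<^sup>2) \<partial>configs N)
     + (\<integral>\<^sup>+x. ennreal ((\<Sum>j<N. \<Sum>i<j. 1 / norm (x i - x j)) * (norm (\<psi> x))\<^sup>2) \<partial>configs N)"

section \<open>Mixed states\<close>

text \<open>
  \<open>(w, \<psi>)\<close> represents the density matrix \<open>\<Gamma> = \<Sum>\<^sub>k w\<^sub>k |\<psi>\<^sub>k\<rangle>\<langle>\<psi>\<^sub>k|\<close>. The \<open>\<psi>\<^sub>k\<close> need not be orthogonal: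
  every density matrix of finite energy arises (spectral decomposition), and density, current
  and energy depend only on \<open>\<Gamma>\<close>.
\<close>

type_synonym mixture = "(nat \<Rightarrow> real) \<times> (nat \<Rightarrow> config \<Rightarrow> complex)"

definition mixed_state :: "nat \<Rightarrow> mixture \<Rightarrow> bool" where
  "mixed_state N = (\<lambda>(w, \<psi>). (\<forall>k. 0 \<le> w k \<and> pure_state N (\<psi> k)) \<and> w sums 1)"

definition has_density :: "nat \<Rightarrow> mixture \<Rightarrow> (real^3 \<Rightarrow> real) \<Rightarrow> bool" where
  "has_density N = (\<lambda>(w, \<psi>) \<rho>. AE r in lborel. (\<Sum>k. w k * density N (\<psi> k) r) = \<rho> r)"

definition has_para_current :: "nat \<Rightarrow> mixture \<Rightarrow> field \<Rightarrow> bool" where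
  "has_para_current N = (\<lambda>(w, \<psi>) jp.
     AE r in lborel. (\<Sum>k. w k *\<^sub>R para_current N (\<psi> k) r) = jp r)"

text \<open>\<open>tr (H(0,A) \<Gamma>)\<close>\<close>

definition energy :: "nat \<Rightarrow> field \<Rightarrow> mixture \<Rightarrow> ennreal" where
  "energy N A = (\<lambda>(w, \<psi>). \<Sum>k. ennreal (w k) * pure_energy N A (\<psi> k))"

section \<open>Density functionals\<close>

definition electron_density :: "nat \<Rightarrow> (real^3 \<Rightarrow> real) \<Rightarrow> bool" where
  "electron_density N \<rho> \<longleftrightarrow>
     \<rho> \<in> borel_measurable lborel \<and> (\<forall>r. 0 \<le> \<rho> r) \<and>
     (\<integral>\<^sup>+r. ennreal (\<rho> r) \<partial>lborel) = of_nat N"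

definition F_VR :: "nat \<Rightarrow> (real^3 \<Rightarrow> real) \<Rightarrow> field \<Rightarrow> ennreal" where
  "F_VR N \<rho> jp =
     (INF \<Gamma> \<in> {\<Gamma>. mixed_state N \<Gamma> \<and> has_density N \<Gamma> \<rho> \<and> has_para_current N \<Gamma> jp}.
        energy N (\<lambda>_. 0) \<Gamma>)"

definition grayce_harris :: "nat \<Rightarrow> (real^3 \<Rightarrow> real) \<Rightarrow> field \<Rightarrow> ennreal" where
  "grayce_harris N \<rho> A =
     (INF \<Gamma> \<in> {\<Gamma>. mixed_state N \<Gamma> \<and> has_density N \<Gamma> \<rho>}. energy N A \<Gamma>)"

text \<open>
  \<open>jp\<close> attains the infimum in
  \<open>G(\<rho>,A) = \<integral> \<rho>|A|\<^sup>2/2 + inf\<^sub>j\<^sub>p (F\<^sub>V\<^sub>R(\<rho>,jp) + \<integral> jp \<bullet> A)\<close>. This is meant for \<open>\<integral> \<rho>|A|\<^sup>2 < \<infinity>\<close>; then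
  \<open>jp \<bullet> A\<close> is integrable whenever \<open>F\<^sub>V\<^sub>R(\<rho>,jp)\<close> is finite, because \<open>\<integral> |jp|\<^sup>2/(2\<rho>) \<le> F\<^sub>V\<^sub>R(\<rho>,jp)\<close>.
\<close>

definition attains_GH :: "nat \<Rightarrow> (real^3 \<Rightarrow> real) \<Rightarrow> field \<Rightarrow> field \<Rightarrow> bool" where
  "attains_GH N \<rho> A jp \<longleftrightarrow>
     jp \<in> borel_measurable lborel \<and>
     ereal (\<integral>r. 1/2 * \<rho> r * (norm (A r))\<^sup>2 \<partial>lborel)
       + (enn2ereal (F_VR N \<rho> jp) + ereal (\<integral>r. jp r \<bullet> A r \<partial>lborel))
     = enn2ereal (grayce_harris N \<rho> A)"

definition total_current :: "(real^3 \<Rightarrow> real) \<Rightarrow> field \<Rightarrow> field \<Rightarrow> field" where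
  "total_current \<rho> A jp r = jp r + \<rho> r *\<^sub>R A r"

text \<open>
  The quotient is taken in \<open>ennreal\<close>, where \<open>c/0 = \<infinity>\<close> for \<open>c > 0\<close> and \<open>0/0 = 0\<close>. In \<open>ereal\<close>,
  \<open>\<infinity> - \<infinity> = \<infinity>\<close>, so fields \<open>jp\<close> with \<open>F\<^sub>V\<^sub>R(\<rho>,jp) = \<infinity>\<close> never lower the infimum.
\<close>

definition diener_objective ::
    "nat \<Rightarrow> (real^3 \<Rightarrow> real) \<Rightarrow> field \<Rightarrow> field \<Rightarrow> ereal" where
  "diener_objective N \<rho> j jp =
     enn2ereal (F_VR N \<rho> jp)
     - enn2ereal (\<integral>\<^sup>+r. ennreal ((norm (jp r - j r))\<^sup>2) / ennreal (2 * \<rho> r) \<partial>lborel)"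

definition F_D :: "nat \<Rightarrow> (real^3 \<Rightarrow> real) \<Rightarrow> field \<Rightarrow> ereal" where
  "F_D N \<rho> j = (INF jp \<in> borel_measurable lborel. diener_objective N \<rho> j jp)"

definition diener_minimizer :: "nat \<Rightarrow> (real^3 \<Rightarrow> real) \<Rightarrow> field \<Rightarrow> field \<Rightarrow> bool" where
  "diener_minimizer N \<rho> j jp \<longleftrightarrow>
     jp \<in> borel_measurable lborel \<and> diener_objective N \<rho> j jp = F_D N \<rho> j"

end

theory Submission imports Defs begin

text \<open>
  One electron suffices. Let \<open>\<rho>\<close> be a multiple of \<open>r\<^sup>2 exp (- |x|\<^sup>2)\<close>, with \<open>r\<close> the distance to the third
  axis, and let \<open>A = - \<nabla>\<phi> / 2\<close> carry half a flux quantum along that axis. The states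
  \<open>sqrt \<rho>\<close> and \<open>sqrt \<rho> exp (\<i> \<phi>)\<close> have paramagnetic currents \<open>0\<close> and \<open>- 2 \<rho> A\<close>, and both
  are ground states of \<open>H(v, A)\<close> for one and the same \<open>v\<close>: angular momenta 0 and 1 are degenerate at
  half flux. So both attain \<open>G(\<rho>, A)\<close>. If \<open>jp0\<close> attains \<open>G(\<rho>, A)\<close>, then reconstructing \<open>A\<close> means that
  \<open>jp0\<close> itself minimizes in \<open>F\<^sub>D\<close>, i.e. that no \<open>jp\<close> exceeds the Grayce--Harris minimum by less than
  \<open>\<integral> |jp - jp0|\<^sup>2 / (2 \<rho>)\<close>. One of the two currents differs from \<open>jp0\<close> and has excess 0.

  The ground state property reduces, by completing squares in the radial and axial directions, to
  \<open>\<integral> Im (p* p') \<le> \<integral> |p'|\<^sup>2\<close> for periodic functions \<open>p\<close> on the circle.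
\<close>

section \<open>Square-integrable functions and translations\<close>

text \<open>Why reconstruction makes \<open>jp0\<close> a minimizer: with j = jp0 + rho A, expanding
  the square gives F_VR(jp) - int |jp - j|^2/(2 rho) = (F_VR(jp) + int jp.A) - int |jp - jp0|^2/(2
  rho) - int jp0.A - int rho |A|^2/2. The bracket is the Grayce--Harris objective, and the remaining
  dependence on jp is a strict reward for leaving jp0; a second Grayce--Harris minimizer collects it
  at no cost. The factor r^2 in rho keeps int rho |A|^2 finite although A is singular on the axis,
  and turns the twisted state into the smooth function (x1 + i x2) exp(-|x|^2/2). The obstacle is
  the lower bound: the infima range over all mixtures of H^1 states, while A and v are unbounded. A
  cutoff makes both sides continuous in the state and its weak gradient, so smooth functions suffice
  at each fixed cutoff. Every energy is computed for s A with 0 <= s <= 1, since two cases are used: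
  s = 1 yields G(rho, A), and s = 0 yields F_VR(rho, 0). The integral of rho/r^2 stays a symbol,
  because the contradiction compares only multiples of it.\<close>

abbreviation (input) sq :: "'a::real_normed_vector \<Rightarrow> real" where "sq x \<equiv> (norm x)\<^sup>2"

lemma norm_add_square_le: "sq (a + b) \<le> 2 * sq a + 2 * sq b" for a b :: "'a::real_normed_vector"
proof -
  have "sq (a + b) \<le> (norm a + norm b)\<^sup>2" by (intro power_mono norm_triangle_ineq) auto
  also have "\<dots> \<le> 2 * sq a + 2 * sq b"
    using zero_le_power2[of "norm a - norm b"] unfolding power2_sum power2_diff by linarith
  finally show ?thesis .
qed

lemma norm_diff_square_le: "sq (a - b) \<le> 2 * sq a + 2 * sq b" for a b :: "'a::real_normed_vector"
  using norm_add_square_le[of a "- b"] by simp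

definition l2 :: "('a::euclidean_space \<Rightarrow> 'b::euclidean_space) \<Rightarrow> bool" where
  "l2 f \<longleftrightarrow> f \<in> borel_measurable borel \<and> integrable lborel (\<lambda>x. sq (f x))"

lemma l2_measurable: "l2 f \<Longrightarrow> f \<in> borel_measurable borel"
  and l2_integrable: "l2 f \<Longrightarrow> integrable lborel (\<lambda>x. sq (f x))"
  by (auto simp: l2_def)

lemma l2_iff_nn:
  assumes "f \<in> borel_measurable borel"
  shows "l2 f \<longleftrightarrow> (\<integral>\<^sup>+x. ennreal (sq (f x)) \<partial>lborel) < \<infinity>"
  using assms by (auto simp: l2_def integrable_iff_bounded)

lemma l2_bound:
  assumes "f \<in> borel_measurable borel" "l2 g" "\<And>x. norm (f x) \<le> C * norm (g x)"
  shows "l2 f"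
proof -
  have "integrable lborel (\<lambda>x. sq (f x))"
  proof (rule Bochner_Integration.integrable_bound)
    show "integrable lborel (\<lambda>x. C\<^sup>2 * sq (g x))"
      using l2_integrable[OF assms(2)] by simp
    show "AE x in lborel. norm (sq (f x)) \<le> norm (C\<^sup>2 * sq (g x))"
      using power_mono[OF assms(3), where n=2] by (simp add: power_mult_distrib)
  qed (use assms(1) in measurable)
  with assms show ?thesis by (auto simp: l2_def)
qed

lemma l2_add:
  assumes "l2 f" "l2 g"
  shows "l2 (\<lambda>x. f x + g x)"
proof -
  note [measurable] = l2_measurable[OF assms(1)] l2_measurable[OF assms(2)]
  have "integrable lborel (\<lambda>x. sq (f x + g x))"
  proof (rule Bochner_Integration.integrable_bound)
    show "integrable lborel (\<lambda>x. 2 * sq (f x) + 2 * sq (g x))"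
      using assms[THEN l2_integrable] by simp
    show "AE x in lborel. norm (sq (f x + g x))
        \<le> norm (2 * sq (f x) + 2 * sq (g x))"
      by (simp add: norm_add_square_le)
  qed measurable
  then show ?thesis by (simp add: l2_def)
qed

lemma l2_norm: "l2 f \<Longrightarrow> l2 (\<lambda>x. norm (f x))"
  by (auto simp: l2_def)

lemma l2_minus:
  assumes "l2 f" "l2 g" shows "l2 (\<lambda>x. f x - g x)"
proof -
  have "l2 (\<lambda>x. - g x)" using assms(2) by (auto simp: l2_def)
  from l2_add[OF assms(1) this] show ?thesis by simp
qed

lemma l2_mult_integrable:
  fixes f g :: "'a::euclidean_space \<Rightarrow> 'b::{euclidean_space, real_normed_algebra}"
  assumes "l2 f" "l2 g"
  shows "integrable lborel (\<lambda>x. f x * g x)"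
proof (rule Bochner_Integration.integrable_bound)
  note [measurable] = l2_measurable[OF assms(1)] l2_measurable[OF assms(2)]
  show "integrable lborel (\<lambda>x. sq (f x) + sq (g x))"
    using assms[THEN l2_integrable] by simp
  have "norm (a * b) \<le> sq a + sq b" for a b :: 'b
  proof -
    have "norm (a * b) \<le> norm a * norm b" by (rule norm_mult_ineq)
    also have "\<dots> \<le> sq a + sq b"
    proof -
      have "0 \<le> (norm a - norm b)\<^sup>2 + (sq a + sq b)" by simp
      then show ?thesis by (simp add: power2_eq_square algebra_simps)
    qed
    finally show ?thesis .
  qed
  then show "AE x in lborel. norm (f x * g x) \<le> norm (sq (f x) + sq (g x))"
    by simp
  show "(\<lambda>x. f x * g x) \<in> borel_measurable lborel" by measurable
qed

section \<open>Translation invariance of Lebesgue measure and continuity of translations\<close>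

lemma nn_integral_lborel_shift:
  fixes f :: "'a::euclidean_space \<Rightarrow> ennreal"
  assumes [measurable]: "f \<in> borel_measurable borel"
  shows "(\<integral>\<^sup>+x. f (x + y) \<partial>lborel) = (\<integral>\<^sup>+x. f x \<partial>lborel)"
proof -
  have "(\<integral>\<^sup>+x. f x \<partial>lborel) = (\<integral>\<^sup>+x. f x \<partial>distr lborel borel ((+) y))"
    by (simp add: lborel_distr_plus)
  also have "\<dots> = (\<integral>\<^sup>+x. f (y + x) \<partial>lborel)"
    by (subst nn_integral_distr) auto
  finally show ?thesis by (simp add: add.commute)
qed

lemma integrable_lborel_shift:
  fixes f :: "'a::euclidean_space \<Rightarrow> 'b::euclidean_space"
  assumes "integrable lborel f"
  shows "integrable lborel (\<lambda>x. f (x + y))"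
proof -
  note [measurable] = borel_measurable_integrable[OF assms]
  have "integrable (distr lborel borel ((+) y)) f" using assms by (simp add: lborel_distr_plus)
  then have "integrable lborel (\<lambda>x. f (y + x))"
    by (subst (asm) integrable_distr_eq) auto
  then show ?thesis by (simp add: add.commute)
qed

lemma integral_lborel_shift:
  fixes f :: "'a::euclidean_space \<Rightarrow> 'b::euclidean_space"
  assumes [measurable]: "f \<in> borel_measurable borel"
  shows "(LBINT x. f (x + y)) = (LBINT x. f x)"
proof -
  have "(LBINT x. f x) = (\<integral>x. f x \<partial>distr lborel borel ((+) y))"
    by (simp add: lborel_distr_plus)
  also have "\<dots> = (LBINT x. f (y + x))"
    by (subst integral_distr) auto
  finally show ?thesis by (simp add: add.commute)
qed

text \<open>Outer regularity encloses \<open>A\<close> in an open \<open>U\<close> with little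
  excess. A short translation can move a point out of \<open>U\<close> only from near the
  complement, that is from a set \<open>V n\<close> of small measure; the rest of the error lies in
  \<open>U - A\<close>.\<close>

lemma indicator_translation_continuous:
  fixes A :: "'a::euclidean_space set"
  assumes A[measurable]: "A \<in> sets borel" and fin: "emeasure lborel A < \<infinity>" and e: "0 < (e::real)"
  shows "\<exists>d>0. \<forall>y. norm y < d \<longrightarrow>
    (LBINT x. \<bar>indicator A (x + y) - indicator A x\<bar>) \<le> (e::real)"
proof -
  \<comment> \<open>The pointwise bound below has four terms, two for each direction in which the
    boundary of \<open>A\<close> can be crossed.\<close>
  obtain U where U: "open U" "A \<subseteq> U" "emeasure lborel (U - A) < ennreal (e/4)"
    using outer_regular_lborel[OF A, of "e/4"] e by auto
  note [measurable] = borel_open[OF U(1)]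
  have finU: "emeasure lborel U < \<infinity>"
  proof -
    have "emeasure lborel U = emeasure lborel (A \<union> (U - A))" using U by (auto intro!: arg_cong2[where f=emeasure])
    also have "\<dots> \<le> emeasure lborel A + emeasure lborel (U - A)" by (intro emeasure_subadditive) auto
    also have "\<dots> < \<infinity>" using fin U(3) by (auto simp: ennreal_add_less_top less_top[symmetric] top_unique dest: order.strict_trans2)
    finally show ?thesis .
  qed
  \<comment> \<open>\<open>infdist\<close> to the empty set is 0, so for \<open>U = UNIV\<close> it
    is the last conjunct that makes \<open>V n\<close> empty.\<close>
  define V where "V n = {x\<in>U. infdist x (- U) < inverse (Suc n) \<and> - U \<noteq> {}}" for n
  have V[measurable]: "V n \<in> sets borel" for n
  proof -
    have [measurable]: "(\<lambda>x. infdist x (- U)) \<in> borel_measurable borel"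
      by (intro borel_measurable_continuous_onI continuous_intros)
    show ?thesis unfolding V_def by measurable
  qed
  have "(\<lambda>n. emeasure lborel (V n)) \<longlonglongrightarrow> emeasure lborel (\<Inter>n. V n)"
  proof (rule Lim_emeasure_decseq)
    show "decseq V"
    proof (rule decseq_SucI)
      fix n show "V (Suc n) \<subseteq> V n"
      proof -
        have "inverse (real (Suc (Suc n))) \<le> inverse (real (Suc n))"
          by (rule le_imp_inverse_le) auto
        then show ?thesis unfolding V_def
          by (auto simp del: of_nat_Suc intro: less_le_trans)
      qed
    qed
    have "emeasure lborel (V n) \<le> emeasure lborel U" for n
      by (intro emeasure_mono) (auto simp: V_def)
    then show "emeasure lborel (V n) \<noteq> \<infinity>" for n
      using finU by (metis infinity_ennreal_def less_le_not_le top.extremum)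
  qed auto
  moreover have "(\<Inter>n. V n) = {}"
  proof (rule ccontr)
    assume "(\<Inter>n. V n) \<noteq> {}"
    then obtain x where x: "\<And>n. x \<in> V n" by auto
    have ne: "- U \<noteq> {}" and xU: "x \<in> U" using x[of 0] by (auto simp: V_def)
    have "infdist x (- U) > 0"
      using in_closed_iff_infdist_zero[of "- U" x] U(1) ne xU infdist_nonneg[of x "-U"]
      by (auto simp: closed_Compl less_le)
    then obtain n where "inverse (real (Suc n)) < infdist x (- U)"
      using reals_Archimedean by blast
    with x[of n] show False by (auto simp: V_def)
  qed
  ultimately have "(\<lambda>n. emeasure lborel (V n)) \<longlonglongrightarrow> 0" by simp
  from order_tendstoD(2)[OF this, of "ennreal (e/4)"] e
  obtain n where n: "emeasure lborel (V n) < ennreal (e/4)"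
    by (auto simp: eventually_sequentially)
  have near: "x \<in> V n" if "x \<in> U" "z \<notin> U" "dist x z < inverse (Suc n)" for x z
    using that infdist_le[of z "- U" x] by (auto simp: V_def)
  show ?thesis
  proof (intro exI[of _ "inverse (real (Suc n))"] conjI allI impI)
    fix y :: 'a assume y: "norm y < inverse (real (Suc n))"
    let ?B = "V n" and ?D = "U - A"
    have d: "dist x (x + y) < inverse (Suc n)" "dist (x + y) x < inverse (Suc n)" for x
      using y by (auto simp: dist_norm)
    have pw: "ennreal \<bar>indicator A (x + y) - indicator A x\<bar> \<le>
       (indicator ?B x + indicator ?D (x + y)) + (indicator ?B (x + y) + indicator ?D x)" for x
    proof -
      consider "x \<in> A" "x + y \<notin> A" | "x \<notin> A" "x + y \<in> A" | "indicator A (x + y) = (indicator A x :: real)"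
        by (cases "x \<in> A"; cases "x + y \<in> A") auto
      then show ?thesis
      proof cases
        case 1
        then have "x \<in> ?B \<or> x + y \<in> ?D" using U(2) near[of x "x + y"] d by auto
        with 1 show ?thesis by (auto simp: indicator_def)
      next
        case 2
        then have "x + y \<in> ?B \<or> x \<in> ?D" using U(2) near[of "x + y" x] d by auto
        with 2 show ?thesis by (auto simp: indicator_def)
      qed simp
    qed
    have "(\<integral>\<^sup>+x. ennreal \<bar>indicator A (x + y) - indicator A x\<bar> \<partial>lborel) \<le>
      (\<integral>\<^sup>+x. (indicator ?B x + indicator ?D (x + y)) + (indicator ?B (x + y) + indicator ?D x) \<partial>lborel)"
      by (intro nn_integral_mono pw)
    also have "\<dots> = (emeasure lborel ?B + emeasure lborel ?D) + (emeasure lborel ?B + emeasure lborel ?D)"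
      by (simp add: nn_integral_add nn_integral_lborel_shift[of "indicator ?B"] nn_integral_lborel_shift[of "indicator ?D"])
    also have "\<dots> \<le> (ennreal (e/4) + ennreal (e/4)) + (ennreal (e/4) + ennreal (e/4))"
      using n U(3) by (intro add_mono) auto
    also have "\<dots> = ennreal e" using e by (simp flip: ennreal_plus)
    finally show "(LBINT x. \<bar>indicator A (x + y) - indicator A x\<bar>) \<le> (e::real)"
      using e by (subst integral_eq_nn_integral) (auto intro!: enn2real_leI)
  qed simp
qed

text \<open>Induction over integrable functions: the previous lemma handles indicators, and a
  dominated limit is handled by splitting the error into three parts, two of which agree by
  translation invariance.\<close>

lemma L1_translation_continuous:
  fixes f :: "'a::euclidean_space \<Rightarrow> real"
  assumes "integrable lborel f" "0 < e"
  shows "\<exists>d>0. \<forall>y. norm y < d \<longrightarrow> (LBINT x. \<bar>f (x + y) - f x\<bar>) \<le> e"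
  using assms
proof (induction f arbitrary: e rule: integrable_induct)
  case (base A c)
  \<comment> \<open>The added 1 covers \<open>c = 0\<close>.\<close>
  have "0 < e / (\<bar>c\<bar> + 1)" using base by simp
  from indicator_translation_continuous[OF _ base(2) this] base(1)
  obtain d where d: "d > 0"
    "\<And>y. norm y < d \<Longrightarrow> (LBINT x. \<bar>indicator A (x + y) - indicator A x\<bar>) \<le> e / (\<bar>c\<bar> + 1)"
    by auto
  show ?case
  proof (intro exI[of _ d] conjI allI impI d(1))
    fix y :: 'a assume y: "norm y < d"
    have "(LBINT x. \<bar>indicator A (x + y) *\<^sub>R c - indicator A x *\<^sub>R c\<bar>)
      = (LBINT x. \<bar>indicator A (x + y) - indicator A x\<bar> * \<bar>c\<bar>)"
      by (simp flip: abs_mult left_diff_distrib)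
    also have "\<dots> = (LBINT x. \<bar>indicator A (x + y) - indicator A x\<bar>) * \<bar>c\<bar>"
      by simp
    also have "\<dots> \<le> e / (\<bar>c\<bar> + 1) * (\<bar>c\<bar> + 1)"
      using base by (intro mult_mono d(2) y) auto
    also have "\<dots> = e" by (simp add: add_nonneg_eq_0_iff)
    finally show "(LBINT x. \<bar>indicator A (x + y) *\<^sub>R c - indicator A x *\<^sub>R c\<bar>) \<le> e" .
  qed
next
  case (add f g)
  from add.IH(1)[of "e/2"] add.prems obtain d1 where d1: "d1 > 0"
    "\<And>y. norm y < d1 \<Longrightarrow> (LBINT x. \<bar>f (x + y) - f x\<bar>) \<le> e/2" by auto
  from add.IH(2)[of "e/2"] add.prems obtain d2 where d2: "d2 > 0"
    "\<And>y. norm y < d2 \<Longrightarrow> (LBINT x. \<bar>g (x + y) - g x\<bar>) \<le> e/2" by auto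
  show ?case
  proof (intro exI[of _ "min d1 d2"] conjI allI impI)
    fix y :: 'a assume y: "norm y < min d1 d2"
    note i = integrable_lborel_shift[OF add.hyps(1), of y] integrable_lborel_shift[OF add.hyps(2), of y]
    have "(LBINT x. \<bar>f (x + y) + g (x + y) - (f x + g x)\<bar>)
      \<le> (LBINT x. \<bar>f (x + y) - f x\<bar> + \<bar>g (x + y) - g x\<bar>)"
      using i add.hyps by (intro integral_mono) auto
    also have "\<dots> = (LBINT x. \<bar>f (x + y) - f x\<bar>) + (LBINT x. \<bar>g (x + y) - g x\<bar>)"
      using i add.hyps by simp
    also have "\<dots> \<le> e/2 + e/2" using y by (intro add_mono d1 d2) auto
    finally show "(LBINT x. \<bar>f (x + y) + g (x + y) - (f x + g x)\<bar>) \<le> e" by simp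
  qed (use d1 d2 in auto)
next
  case (lim f s)
  have "(\<lambda>i. \<integral>x. \<bar>s i x - f x\<bar> \<partial>lborel) \<longlonglongrightarrow> (\<integral>x. 0 \<partial>(lborel::'a measure))"
  proof (rule integral_dominated_convergence[where w="\<lambda>x. 3 * \<bar>f x\<bar>"])
    \<comment> \<open>The induction principle bounds the approximants by twice the limit.\<close>
    have "\<bar>s i x - f x\<bar> \<le> 3 * \<bar>f x\<bar>" for i x
      using lim(3)[of x i] by (auto simp: abs_if split: if_splits)
    then show "AE x in lborel. norm \<bar>s i x - f x\<bar> \<le> 3 * \<bar>f x\<bar>" for i by auto
    have "(\<lambda>i. \<bar>s i x - f x\<bar>) \<longlonglongrightarrow> 0" for x
      using lim(2)[of x] by (simp add: LIM_zero_iff tendsto_rabs_zero_iff)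
    then show "AE x in lborel. (\<lambda>i. \<bar>s i x - f x\<bar>) \<longlonglongrightarrow> 0" by simp
  qed (use lim(1,4) in \<open>auto simp: borel_measurable_integrable\<close>)
  from order_tendstoD(2)[OF this, of "e/3"] lim.prems
  obtain i where i: "(LBINT x. \<bar>s i x - f x\<bar>) < e/3"
    by (auto simp: eventually_sequentially)
  from lim.IH[of "e/3" i] lim.prems obtain d where d: "d > 0"
    "\<And>y. norm y < d \<Longrightarrow> (LBINT x. \<bar>s i (x + y) - s i x\<bar>) \<le> e/3" by auto
  show ?case
  proof (intro exI[of _ d] conjI allI impI d(1))
    fix y :: 'a assume y: "norm y < d"
    note I = integrable_lborel_shift[OF lim(1)[of i], of y] integrable_lborel_shift[OF lim(4), of y] lim(1)[of i] lim(4)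
    have "(LBINT x. \<bar>s i (x + y) - f (x + y)\<bar>) = (LBINT x. \<bar>s i x - f x\<bar>)"
      by (rule integral_lborel_shift) (use I in \<open>auto simp: borel_measurable_integrable\<close>)
    moreover have "(LBINT x. \<bar>f (x + y) - f x\<bar>)
      \<le> (LBINT x. \<bar>s i (x + y) - f (x + y)\<bar> + \<bar>s i (x + y) - s i x\<bar> + \<bar>s i x - f x\<bar>)"
      using I by (intro integral_mono) auto
    moreover have "\<dots> = (LBINT x. \<bar>s i (x + y) - f (x + y)\<bar>) + (LBINT x. \<bar>s i (x + y) - s i x\<bar>) + (LBINT x. \<bar>s i x - f x\<bar>)"
      using I by simp
    ultimately show "(LBINT x. \<bar>f (x + y) - f x\<bar>) \<le> e" using i d(2)[OF y] by simp
  qed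
qed

text \<open>Reduces the continuity of translations in \<open>L\<^sup>2\<close> to that in \<open>L\<^sup>1\<close>.\<close>

lemma square_diff_le_signed_squares: "(a - b)\<^sup>2 \<le> 2 * \<bar>a * \<bar>a\<bar> - b * \<bar>b\<bar>\<bar>" for a b :: real
proof -
  have *: "(a - b)\<^sup>2 \<le> \<bar>a * a - b * b\<bar>" if "0 \<le> a" "0 \<le> b" for a b :: real
  proof -
    have "(a - b)\<^sup>2 = \<bar>a - b\<bar> * \<bar>a - b\<bar>" by (simp add: power2_eq_square)
    also have "\<dots> \<le> \<bar>a - b\<bar> * \<bar>a + b\<bar>" using that by (intro mult_left_mono) auto
    also have "\<dots> = \<bar>a * a - b * b\<bar>" by (simp add: abs_mult[symmetric] algebra_simps)
    finally show ?thesis .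
  qed
  \<comment> \<open>Used for opposite signs, where the right-hand side of the claim is 2 (a^2 +
    b^2).\<close>
  have **: "(a - b)\<^sup>2 \<le> 2 * (a * a + b * b)" for a b :: real
    using zero_le_power2[of "a + b"] by (simp add: power2_eq_square algebra_simps)
  consider "0 \<le> a" "0 \<le> b" | "a \<le> 0" "b \<le> 0" | "0 \<le> a" "b \<le> 0" | "a \<le> 0" "0 \<le> b" by linarith
  then show ?thesis
  proof cases
    case 1
    then show ?thesis using *[of a b] abs_ge_zero[of "a * a - b * b"] by (simp del: abs_ge_zero)
  next
    case 2
    have "(a - b)\<^sup>2 = (-a - -b)\<^sup>2" by (simp add: power2_eq_square algebra_simps)
    with 2 show ?thesis using *[of "-a" "-b"] abs_ge_zero[of "a * a - b * b"]
      by (simp del: abs_ge_zero add: abs_minus_commute)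
  next
    case 3 then show ?thesis using **[of a b] zero_le_square[of a] zero_le_square[of b] by simp
  next
    case 4 then show ?thesis using **[of a b] zero_le_square[of a] zero_le_square[of b] by simp
  qed
qed

lemma l2_shift:
  fixes f :: "'a::euclidean_space \<Rightarrow> 'b::euclidean_space"
  assumes "l2 f" shows "l2 (\<lambda>x. f (x + y))"
proof -
  note [measurable] = l2_measurable[OF assms]
  from integrable_lborel_shift[OF l2_integrable[OF assms], of y] show ?thesis
    by (simp add: l2_def)
qed

text \<open>The L^1 case applies to the signed square \<open>f x * \<bar>f x\<bar>\<close>, which
  keeps the sign that the plain square would lose.\<close>

lemma L2_translation_continuous_real:
  fixes f :: "'a::euclidean_space \<Rightarrow> real"
  assumes f: "l2 f" and e: "0 < e"
  shows "\<exists>d>0. \<forall>y. norm y < d \<longrightarrow> (LBINT x. (f (x + y) - f x)\<^sup>2) \<le> e"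
proof -
  note [measurable] = l2_measurable[OF f]
  have i: "integrable lborel (\<lambda>x. f x * \<bar>f x\<bar>)"
    using l2_mult_integrable[OF f l2_norm[OF f]] by simp
  from L1_translation_continuous[OF this, of "e/2"] e obtain d where d: "d > 0"
    "\<And>y. norm y < d \<Longrightarrow> (LBINT x. \<bar>f (x + y) * \<bar>f (x + y)\<bar> - f x * \<bar>f x\<bar>\<bar>) \<le> e/2"
    by auto
  show ?thesis
  proof (intro exI[of _ d] conjI allI impI d(1))
    fix y :: 'a assume y: "norm y < d"
    have "(LBINT x. (f (x + y) - f x)\<^sup>2) \<le> (LBINT x. 2 * \<bar>f (x + y) * \<bar>f (x + y)\<bar> - f x * \<bar>f x\<bar>\<bar>)"
    proof (intro integral_mono square_diff_le_signed_squares)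
      show "integrable lborel (\<lambda>x. (f (x + y) - f x)\<^sup>2)"
        using l2_integrable[OF l2_minus[OF l2_shift[OF f, of y] f]] by simp
      show "integrable lborel (\<lambda>x. 2 * \<bar>f (x + y) * \<bar>f (x + y)\<bar> - f x * \<bar>f x\<bar>\<bar>)"
        using i integrable_lborel_shift[OF i, of y] by simp
    qed
    also have "\<dots> = 2 * (LBINT x. \<bar>f (x + y) * \<bar>f (x + y)\<bar> - f x * \<bar>f x\<bar>\<bar>)" by simp
    also have "\<dots> \<le> e" using d(2)[OF y] by simp
    finally show "(LBINT x. (f (x + y) - f x)\<^sup>2) \<le> e" .
  qed
qed

lemma L2_translation_continuous:
  fixes f :: "'a::euclidean_space \<Rightarrow> complex"
  assumes f: "l2 f" and e: "0 < e"
  shows "\<exists>d>0. \<forall>y. norm y < d \<longrightarrow> (LBINT x. sq (f (x + y) - f x)) \<le> e"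
proof -
  note [measurable] = l2_measurable[OF f]
  have re: "l2 (\<lambda>x. Re (f x))" and im: "l2 (\<lambda>x. Im (f x))"
    using abs_Re_le_cmod abs_Im_le_cmod by (auto intro!: l2_bound[OF _ f, of _ 1])
  from L2_translation_continuous_real[OF re, of "e/2"] e obtain d1 where d1: "d1 > 0"
    "\<And>y. norm y < d1 \<Longrightarrow> (LBINT x. (Re (f (x + y)) - Re (f x))\<^sup>2) \<le> e/2" by auto
  from L2_translation_continuous_real[OF im, of "e/2"] e obtain d2 where d2: "d2 > 0"
    "\<And>y. norm y < d2 \<Longrightarrow> (LBINT x. (Im (f (x + y)) - Im (f x))\<^sup>2) \<le> e/2" by auto
  show ?thesis
  proof (intro exI[of _ "min d1 d2"] conjI allI impI)
    fix y :: 'a assume y: "norm y < min d1 d2"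
    have i: "integrable lborel (\<lambda>x. (Re (f (x + y)) - Re (f x))\<^sup>2)" "integrable lborel (\<lambda>x. (Im (f (x + y)) - Im (f x))\<^sup>2)"
      using l2_integrable[OF l2_minus[OF l2_shift[OF re, of y] re]] l2_integrable[OF l2_minus[OF l2_shift[OF im, of y] im]] by simp_all
    have "(LBINT x. sq (f (x + y) - f x)) = (LBINT x. (Re (f (x + y)) - Re (f x))\<^sup>2 + (Im (f (x + y)) - Im (f x))\<^sup>2)"
      by (simp add: cmod_power2)
    also have "\<dots> \<le> e/2 + e/2" using y by (simp add: i) (use d1 d2 y in force)
    finally show "(LBINT x. sq (f (x + y) - f x)) \<le> e" by simp
  qed (use d1 d2 in auto)
qed

section \<open>Mollification\<close>

lemma l2_bounded_support:
  fixes k :: "'a::euclidean_space \<Rightarrow> 'b::euclidean_space"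
  assumes [measurable]: "k \<in> borel_measurable borel" and C: "\<And>y. norm (k y) \<le> C"
    and z: "\<And>y. y \<notin> cball x r \<Longrightarrow> k y = 0"
  shows "l2 k"
proof -
  have "integrable lborel (\<lambda>y. sq (k y))"
  proof (rule Bochner_Integration.integrable_bound)
    show "integrable lborel (\<lambda>y. indicator (cball x r) y * C\<^sup>2)"
      using emeasure_lborel_cball_finite[of x r] by (intro integrable_mult_left) auto
    have "sq (k y) \<le> C\<^sup>2" for y using C[of y] by (intro power_mono) auto
    then show "AE y in lborel. norm (sq (k y)) \<le> norm (indicator (cball x r) y * C\<^sup>2)"
      using z by (auto simp: indicator_def)
  qed measurable
  then show ?thesis by (simp add: l2_def)
qed

lemma l2_scaleR_integrable:
  fixes f :: "'a::euclidean_space \<Rightarrow> 'b::euclidean_space"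
  assumes "l2 k" "l2 f"
  shows "integrable lborel (\<lambda>x. k x *\<^sub>R f x)"
proof (rule Bochner_Integration.integrable_bound)
  note [measurable] = l2_measurable[OF assms(1)] l2_measurable[OF assms(2)]
  show "integrable lborel (\<lambda>x. norm (k x) * norm (f x))"
    using l2_mult_integrable[OF assms[THEN l2_norm]] .
  show "(\<lambda>x. k x *\<^sub>R f x) \<in> borel_measurable lborel" by measurable
qed auto

text \<open>A piecewise polynomial kernel that is only C^1. This is as much smoothness as
  \<open>test_function\<close> asks for, and the second-order remainder has an explicit
  bound.\<close>

definition bump :: "real \<Rightarrow> 'a::euclidean_space \<Rightarrow> real" where
  "bump e y = (max 0 (e\<^sup>2 - sq y))\<^sup>2"

definition bump_deriv :: "real \<Rightarrow> 'a::euclidean_space \<Rightarrow> 'a \<Rightarrow> real" where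
  "bump_deriv e y v = - 4 * max 0 (e\<^sup>2 - sq y) * (y \<bullet> v)"

definition mollifier :: "real \<Rightarrow> 'a::euclidean_space \<Rightarrow> real" where
  "mollifier e y = bump e y / (LBINT y. bump e (y::'a))"

text \<open>The kernel is even, so this is the usual convolution. With the argument
  \<open>y - x\<close> the kernel is literally a test function in \<open>y\<close>, to which the
  definition of a weak gradient applies.\<close>

definition mollify :: "real \<Rightarrow> ('a::euclidean_space \<Rightarrow> 'b::euclidean_space) \<Rightarrow> 'a \<Rightarrow> 'b" where
  "mollify e f x = (LBINT y. mollifier e (y - x) *\<^sub>R f y)"

lemma continuous_bump: "continuous_on UNIV (bump e)"
  unfolding bump_def by (intro continuous_intros)

lemma bump_measurable[measurable]: "bump e \<in> borel_measurable borel"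
  by (intro borel_measurable_continuous_onI continuous_bump)

lemma bump_deriv_measurable[measurable]: "(\<lambda>y. bump_deriv e y v) \<in> borel_measurable borel"
  unfolding bump_deriv_def by (intro borel_measurable_continuous_onI continuous_intros)

lemma mollifier_measurable[measurable]: "mollifier e \<in> borel_measurable borel"
  unfolding mollifier_def by measurable

lemma bump_nonneg: "0 \<le> bump e y" by (simp add: bump_def)

lemma bump_bounded: "bump e y \<le> e ^ 4"
proof -
  have "bump e y \<le> (e\<^sup>2)\<^sup>2" unfolding bump_def by (intro power_mono) auto
  then show ?thesis by simp
qed

lemma bump_zero: "0 < e \<Longrightarrow> e \<le> norm y \<Longrightarrow> bump e y = 0"
  by (simp add: bump_def power_mono)

lemma bump_deriv_zero: "0 < e \<Longrightarrow> e \<le> norm y \<Longrightarrow> bump_deriv e y v = 0"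
  by (simp add: bump_deriv_def power_mono)

lemma bump_deriv_bounded:
  assumes "0 < e" "e \<le> 1" shows "\<bar>bump_deriv e y v\<bar> \<le> 4 * norm v"
proof (cases "e \<le> norm y")
  case False
  have "\<bar>bump_deriv e y v\<bar> = 4 * \<bar>max 0 (e\<^sup>2 - sq y)\<bar> * \<bar>y \<bullet> v\<bar>"
    by (simp add: bump_deriv_def abs_mult)
  also have "\<dots> \<le> 4 * 1 * (1 * norm v)"
  proof (intro mult_mono)
    show "\<bar>max 0 (e\<^sup>2 - sq y)\<bar> \<le> 1"
    proof -
      have "e\<^sup>2 \<le> 1" "0 \<le> sq y" using power_mono[of e 1 2] assms by auto
      then have "e\<^sup>2 - sq y \<le> 1" by linarith
      then show ?thesis by simp
    qed
    have "\<bar>y \<bullet> v\<bar> \<le> norm y * norm v" by (rule Cauchy_Schwarz_ineq2)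
    also have "\<dots> \<le> 1 * norm v" using False assms by (intro mult_right_mono) auto
    finally show "\<bar>y \<bullet> v\<bar> \<le> 1 * norm v" .
  qed auto
  finally show ?thesis by simp
qed (simp add: bump_deriv_zero assms(1))

lemma integrable_bump:
  assumes "0 < e" shows "integrable lborel (bump e :: 'a::euclidean_space \<Rightarrow> real)"
proof (rule Bochner_Integration.integrable_bound)
  show "integrable lborel (\<lambda>y::'a. indicator (cball 0 e) y * e ^ 4)"
    using emeasure_lborel_cball_finite[of "0::'a" e] by (intro integrable_mult_left) auto
  show "AE y in lborel. norm (bump e y) \<le> norm (indicator (cball 0 e) (y::'a) * e ^ 4)"
    using assms by (intro AE_I2) (auto simp: indicator_def bump_nonneg bump_bounded bump_zero)
qed measurable

lemma integral_bump_pos: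
  assumes e: "0 < e" shows "0 < (LBINT y. bump e (y::'a::euclidean_space))"
proof -
  have "0 < (e\<^sup>2 - (e/2)\<^sup>2)\<^sup>2 * measure lborel (ball (0::'a) (e/2))"
  proof (intro mult_pos_pos)
    show "0 < measure lborel (ball (0::'a) (e/2))"
      using e by (simp add: content_ball_pos)
    show "0 < (e\<^sup>2 - (e/2)\<^sup>2)\<^sup>2"
      using e by (simp add: power2_eq_square field_simps)
  qed
  also have "\<dots> = (LBINT y. indicator (ball (0::'a) (e/2)) y * (e\<^sup>2 - (e/2)\<^sup>2)\<^sup>2)"
    by simp
  also have "\<dots> \<le> (LBINT y. bump e (y::'a))"
  proof (intro integral_mono integrable_bump e integrable_mult_left)
    show "integrable lborel (indicator (ball (0::'a) (e/2)) :: _ \<Rightarrow> real)"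
      using emeasure_lborel_ball_finite[of "0::'a" "e/2"] by auto
    show "indicator (ball 0 (e/2)) y * (e\<^sup>2 - (e/2)\<^sup>2)\<^sup>2 \<le> bump e y" for y :: 'a
    proof (cases "y \<in> ball 0 (e/2)")
      case True
      then have "sq y \<le> (e/2)\<^sup>2" by (intro power_mono) auto
      moreover have "(e/2)\<^sup>2 \<le> e\<^sup>2" using e by (intro power_mono) auto
      ultimately have "(e\<^sup>2 - (e/2)\<^sup>2)\<^sup>2 \<le> bump e y"
        unfolding bump_def by (intro power_mono) auto
      with True show ?thesis by simp
    qed (simp add: bump_nonneg)
  qed
  finally show ?thesis .
qed

text \<open>A remainder that is quadratic in \<open>v\<close>, uniformly in \<open>y\<close>, and of
  bounded support in \<open>y\<close>; it can therefore be integrated against an L^2 function when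
  differentiating a mollification.\<close>

lemma bump_second_order:
  fixes y v :: "'a::euclidean_space"
  assumes e: "0 < e" "e \<le> 1" and v: "norm v \<le> 1"
  shows "\<bar>bump e (y + v) - bump e y - bump_deriv e y v\<bar> \<le> 27 * sq v * indicator (cball 0 2) y"
proof (cases "norm y \<le> 2")
  case False
  have "norm y \<le> norm (y + v) + norm v" using norm_triangle_ineq4[of "y + v" v] by simp
  with False v e have "e \<le> norm y" "e \<le> norm (y + v)" by auto
  with e False show ?thesis by (simp add: bump_zero bump_deriv_zero)
next
  case True
  \<comment> \<open>Taylor remainder of t -> (max 0 t)^2, whose derivative 2 max 0 t has Lipschitz
    constant 2.\<close>
  have q: "\<bar>(max 0 t)\<^sup>2 - (max 0 s)\<^sup>2 - 2 * max 0 s * (t - s)\<bar> \<le> (t - s)\<^sup>2" for s t :: real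
  proof -
    consider "0 \<le> s" "0 \<le> t" | "s \<le> 0" "t \<le> 0" | "0 \<le> s" "t \<le> 0" | "s \<le> 0" "0 \<le> t" by linarith
    then show ?thesis
    proof cases
      case 1
      have "t\<^sup>2 - s\<^sup>2 - 2 * s * (t - s) = (t - s)\<^sup>2" by (simp add: power2_eq_square algebra_simps)
      with 1 show ?thesis by (simp add: max_def)
    next
      case 3
      have "s * t \<le> 0" using 3 by (simp add: mult_nonneg_nonpos)
      have E: "(max 0 t)\<^sup>2 - (max 0 s)\<^sup>2 - 2 * max 0 s * (t - s) = s\<^sup>2 - 2 * (s * t)"
        using 3 by (simp add: max_def power2_eq_square algebra_simps)
      moreover have "0 \<le> s\<^sup>2" "0 \<le> t\<^sup>2" by auto
      moreover have "(t - s)\<^sup>2 = t\<^sup>2 - 2 * (s * t) + s\<^sup>2" by (simp add: power2_eq_square algebra_simps)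
      ultimately show ?thesis unfolding E using \<open>s * t \<le> 0\<close> by linarith
    next
      case 4
      have "s * t \<le> 0" using 4 by (simp add: mult_nonpos_nonneg)
      moreover have "(t - s)\<^sup>2 = t\<^sup>2 - 2 * (s * t) + s\<^sup>2" by (simp add: power2_eq_square algebra_simps)
      moreover have "0 \<le> s\<^sup>2" "0 \<le> t\<^sup>2" by auto
      ultimately have "t\<^sup>2 \<le> (t - s)\<^sup>2" by linarith
      with 4 show ?thesis by (simp add: max_def)
    qed (simp add: max_def)
  qed
  define s where "s = e\<^sup>2 - sq y"
  define t where "t = e\<^sup>2 - sq (y + v)"
  have ts: "t - s = - 2 * (y \<bullet> v) - sq v"
    unfolding s_def t_def power2_norm_eq_inner by (simp add: inner_add inner_commute)
  have yv: "\<bar>y \<bullet> v\<bar> \<le> 2 * norm v"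
    using Cauchy_Schwarz_ineq2[of y v] mult_right_mono[OF True, of "norm v"] by simp
  have vv: "sq v \<le> norm v"
    using mult_right_mono[OF v, of "norm v"] by (simp add: power2_eq_square)
  \<comment> \<open>5 = 2 * 2 + 1 from |y| <= 2 and |v|^2 <= |v|. The term 2 max 0 s |v|^2 adds 2,
    so the final constant is 5^2 + 2 = 27.\<close>
  have "\<bar>t - s\<bar> \<le> 5 * norm v" using ts yv vv zero_le_power2[of "norm v"] norm_ge_zero[of v] by linarith
  then have ts2: "(t - s)\<^sup>2 \<le> 25 * sq v"
    using power_mono[of "\<bar>t - s\<bar>" "5 * norm v" 2] by (simp add: power_mult_distrib)
  have m: "0 \<le> max 0 s" "max 0 s \<le> 1"
    using power_mono[of e 1 2] e by (auto simp: s_def intro: order_trans[rotated])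
  have "bump e (y + v) - bump e y - bump_deriv e y v
    = ((max 0 t)\<^sup>2 - (max 0 s)\<^sup>2 - 2 * max 0 s * (t - s)) - 2 * max 0 s * sq v"
  proof -
    have "bump e (y + v) = (max 0 t)\<^sup>2" "bump e y = (max 0 s)\<^sup>2" "bump_deriv e y v = - 4 * max 0 s * (y \<bullet> v)"
      by (simp_all add: bump_def bump_deriv_def s_def t_def)
    then show ?thesis unfolding ts by (simp add: algebra_simps)
  qed
  also have "\<bar>\<dots>\<bar> \<le> (t - s)\<^sup>2 + 2 * 1 * sq v"
    using m by (intro order_trans[OF abs_triangle_ineq4] add_mono q) (simp add: abs_mult mult_left_le_one_le)
  also have "\<dots> \<le> 27 * sq v" using ts2 by simp
  finally show ?thesis using True by simp
qed

lemma mollifier_nonneg: "0 < e \<Longrightarrow> 0 \<le> mollifier e y"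
  using integral_bump_pos[of e] by (auto simp: mollifier_def bump_nonneg intro!: divide_nonneg_pos)

lemma integrable_mollifier: "0 < e \<Longrightarrow> integrable lborel (mollifier e :: 'a::euclidean_space \<Rightarrow> real)"
  unfolding mollifier_def using integrable_bump[of e] by auto

lemma integral_mollifier: "0 < e \<Longrightarrow> (LBINT y. mollifier e (y::'a::euclidean_space)) = 1"
  using integral_bump_pos[of e, where 'a='a] by (simp add: mollifier_def)

lemma l2_mollifier_shift:
  fixes x :: "'a::euclidean_space"
  assumes "0 < e" shows "l2 (\<lambda>y. mollifier e (y - x))"
proof (rule l2_bounded_support[where C="e ^ 4 / (LBINT y. bump e (y::'a))" and x=x and r=e])
  show "norm (mollifier e (y - x)) \<le> e ^ 4 / (LBINT y. bump e (y::'a))" for y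
    using integral_bump_pos[OF assms, where 'a='a] bump_nonneg[of e "y - x"] bump_bounded[of e "y - x"]
    by (simp add: mollifier_def divide_right_mono)
  show "mollifier e (y - x) = 0" if "y \<notin> cball x e" for y
    using that bump_zero[OF assms, of "y - x"] by (simp add: mollifier_def dist_norm norm_minus_commute)
qed measurable

lemma mollify_measurable[measurable]:
  fixes f :: "'a::euclidean_space \<Rightarrow> 'b::euclidean_space"
  assumes [measurable]: "f \<in> borel_measurable borel"
  shows "mollify e f \<in> borel_measurable borel"
  unfolding mollify_def[abs_def] by measurable

lemma mollify_shift_eq:
  fixes f :: "'a::euclidean_space \<Rightarrow> 'b::euclidean_space"
  assumes [measurable]: "f \<in> borel_measurable borel"
  shows "mollify e f x = (LBINT y. mollifier e y *\<^sub>R f (x + y))"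
  using integral_lborel_shift[of "\<lambda>y. mollifier e (y - x) *\<^sub>R f y" x]
  by (simp add: mollify_def add.commute)

text \<open>Jensen's inequality for the probability density \<open>k\<close>, from the nonnegativity
  of the variance of \<open>h\<close>.\<close>

lemma square_integral_le:
  fixes k h :: "'a \<Rightarrow> real"
  assumes k: "\<And>y. 0 \<le> k y" "integrable M k" "(\<integral>y. k y \<partial>M) = 1"
    and h: "integrable M (\<lambda>y. k y * h y)" "integrable M (\<lambda>y. k y * (h y)\<^sup>2)"
  shows "(\<integral>y. k y * h y \<partial>M)\<^sup>2 \<le> (\<integral>y. k y * (h y)\<^sup>2 \<partial>M)"
proof -
  define m where "m = (\<integral>y. k y * h y \<partial>M)"
  have "0 \<le> (\<integral>y. k y * (h y - m)\<^sup>2 \<partial>M)" using k by (intro integral_nonneg_AE) auto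
  also have "\<dots> = (\<integral>y. k y * (h y)\<^sup>2 - 2 * m * (k y * h y) + m\<^sup>2 * k y \<partial>M)"
    by (intro arg_cong2[where f=lebesgue_integral] ext refl) (simp add: power2_eq_square algebra_simps)
  also have "\<dots> = (\<integral>y. k y * (h y)\<^sup>2 \<partial>M) - 2 * m * m + m\<^sup>2"
    using k h by (simp add: m_def)
  finally show ?thesis by (simp add: m_def power2_eq_square)
qed

text \<open>By Jensen the squared error at x is at most the kernel average over y of |f(x + y) -
  f(x)|^2. After exchanging the integrals only translations with |y| <= e contribute, since the
  kernel vanishes beyond.\<close>

lemma mollify_L2_bound:
  fixes f :: "'a::euclidean_space \<Rightarrow> complex"
  assumes f: "l2 f" and e: "0 < e"
    and d: "\<And>y. norm y \<le> e \<Longrightarrow> (LBINT x. sq (f (x + y) - f x)) \<le> d"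
  shows "(\<integral>\<^sup>+x. ennreal (sq (mollify e f x - f x)) \<partial>lborel) \<le> ennreal d"
proof -
  note [measurable] = l2_measurable[OF f]
  have k: "l2 (mollifier e :: 'a \<Rightarrow> real)" using l2_mollifier_shift[OF e, of 0] by simp
  have kb: "mollifier e y \<le> e ^ 4 / (LBINT y. bump e (y::'a))" for y :: 'a
    using integral_bump_pos[OF e, where 'a='a] bump_bounded[of e y]
    by (simp add: mollifier_def divide_right_mono)
  have fs: "l2 (\<lambda>y. f (x + y))" for x using l2_shift[OF f, of x] by (simp add: add.commute)
  have pw: "ennreal (sq (mollify e f x - f x))
      \<le> (\<integral>\<^sup>+y. ennreal (mollifier e y) * ennreal (sq (f (x + y) - f x)) \<partial>lborel)" for x
  proof -
    have i0: "integrable lborel (\<lambda>y. mollifier e y *\<^sub>R f (x + y))"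
      by (rule l2_scaleR_integrable[OF k fs])
    have i1: "integrable lborel (\<lambda>y::'a. mollifier e y *\<^sub>R f x)"
      by (rule integrable_scaleR_left) (rule integrable_mollifier[OF e])
    have i2: "integrable lborel (\<lambda>y. mollifier e y *\<^sub>R (f (x + y) - f x))"
      using Bochner_Integration.integrable_diff[OF i0 i1] by (simp add: scaleR_diff_right)
    have i3: "integrable lborel (\<lambda>y. mollifier e y * norm (f (x + y) - f x))"
      using integrable_norm[OF i2] by (simp add: abs_of_nonneg[OF mollifier_nonneg[OF e]])
    have i4: "integrable lborel (\<lambda>y. mollifier e y * sq (f (x + y) - f x))"
    proof (rule Bochner_Integration.integrable_bound)
      let ?B = "e ^ 4 / (LBINT y. bump e (y::'a))"
      show "integrable lborel (\<lambda>y. 2 * ?B * sq (f (x + y)) + 2 * sq (f x) * mollifier e y)"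
        using l2_integrable[OF fs, of x] integrable_mollifier[OF e, where 'a='a] by simp
      have "mollifier e y * sq (f (x + y) - f x) \<le> mollifier e y * (2 * sq (f (x + y)) + 2 * sq (f x))" for y
        by (intro mult_left_mono norm_diff_square_le mollifier_nonneg e)
      also have "\<dots> y \<le> 2 * ?B * sq (f (x + y)) + 2 * sq (f x) * mollifier e y" for y
        using mult_right_mono[OF kb[of y], of "2 * sq (f (x + y))"] by (simp add: algebra_simps)
      finally show "AE y in lborel. norm (mollifier e y * sq (f (x + y) - f x))
        \<le> norm (2 * ?B * sq (f (x + y)) + 2 * sq (f x) * mollifier e y)"
        using mollifier_nonneg[OF e, where 'a='a]
        by (intro AE_I2) (auto simp: abs_of_nonneg intro!: order_trans[OF _ abs_ge_self])
    qed measurable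
    have "mollify e f x - f x = (LBINT y. mollifier e y *\<^sub>R f (x + y)) - (LBINT y. mollifier e (y::'a) *\<^sub>R f x)"
      using integral_mollifier[OF e, where 'a='a] by (simp add: mollify_shift_eq integrable_mollifier[OF e])
    also have "\<dots> = (LBINT y. mollifier e y *\<^sub>R (f (x + y) - f x))"
      using i0 i1 by (simp add: scaleR_diff_right)
    finally have "norm (mollify e f x - f x) \<le> (LBINT y. mollifier e y * norm (f (x + y) - f x))"
      using integral_norm_bound[of lborel "\<lambda>y. mollifier e y *\<^sub>R (f (x + y) - f x)"] mollifier_nonneg[OF e, where 'a='a] by simp
    then have "sq (mollify e f x - f x) \<le> (LBINT y. mollifier e y * norm (f (x + y) - f x))\<^sup>2"
      by (intro power_mono) auto
    also have "\<dots> \<le> (LBINT y. mollifier e y * sq (f (x + y) - f x))"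
      by (intro square_integral_le mollifier_nonneg integrable_mollifier integral_mollifier e i3 i4)
    finally show ?thesis
      using mollifier_nonneg[OF e, where 'a='a] i4
      by (subst ennreal_mult'[symmetric], simp, subst nn_integral_eq_integral) (auto intro!: ennreal_leI)
  qed
  have "(\<integral>\<^sup>+x. ennreal (sq (mollify e f x - f x)) \<partial>lborel)
     \<le> (\<integral>\<^sup>+x. (\<integral>\<^sup>+y. ennreal (mollifier e y) * ennreal (sq (f (x + y) - f x)) \<partial>lborel) \<partial>lborel)"
    by (intro nn_integral_mono pw)
  also have "\<dots> = (\<integral>\<^sup>+y. (\<integral>\<^sup>+x. ennreal (mollifier e y) * ennreal (sq (f (x + y) - f x)) \<partial>lborel) \<partial>lborel)"
    by (intro lborel_pair.Fubini') measurable
  also have "\<dots> = (\<integral>\<^sup>+y. ennreal (mollifier e y) * (\<integral>\<^sup>+x. ennreal (sq (f (x + y) - f x)) \<partial>lborel) \<partial>lborel)"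
    by (intro nn_integral_cong nn_integral_cmult) measurable
  also have "\<dots> \<le> (\<integral>\<^sup>+y. ennreal (mollifier e (y::'a)) * ennreal d \<partial>lborel)"
  proof (intro nn_integral_mono)
    fix y :: 'a
    show "ennreal (mollifier e y) * (\<integral>\<^sup>+x. ennreal (sq (f (x + y) - f x)) \<partial>lborel)
      \<le> ennreal (mollifier e y) * ennreal d"
    proof (cases "norm y \<le> e")
      case True
      have "(\<integral>\<^sup>+x. ennreal (sq (f (x + y) - f x)) \<partial>lborel) = ennreal (LBINT x. sq (f (x + y) - f x))"
        by (intro nn_integral_eq_integral l2_integrable[OF l2_minus[OF l2_shift[OF f] f]]) auto
      with d[OF True] show ?thesis by (intro mult_left_mono) (auto intro: ennreal_leI)
    next
      case False
      then show ?thesis using bump_zero[OF e, of y] by (simp add: mollifier_def)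
    qed
  qed
  also have "\<dots> = ennreal d"
    using integral_mollifier[OF e, where 'a='a] nn_integral_eq_integral[OF integrable_mollifier[OF e, where 'a='a]] mollifier_nonneg[OF e, where 'a='a]
    by (simp add: nn_integral_multc)
  finally show ?thesis .
qed

lemma l2_mollify:
  fixes f :: "'a::euclidean_space \<Rightarrow> complex"
  assumes f: "l2 f" and e: "0 < e"
  shows "l2 (mollify e f)"
proof -
  note [measurable] = l2_measurable[OF f]
  let ?d = "4 * (LBINT x. sq (f x))"
  have "(LBINT x. sq (f (x + y) - f x)) \<le> ?d" for y
  proof -
    have "(LBINT x. sq (f (x + y) - f x)) \<le> (LBINT x. 2 * sq (f (x + y)) + 2 * sq (f x))"
      using l2_integrable[OF l2_shift[OF f, of y]] l2_integrable[OF f]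
      by (intro integral_mono norm_diff_square_le l2_integrable[OF l2_minus[OF l2_shift[OF f] f]]) auto
    also have "\<dots> = ?d"
      using l2_integrable[OF l2_shift[OF f, of y]] l2_integrable[OF f]
        integral_lborel_shift[of "\<lambda>x. sq (f x)" y] by simp
    finally show ?thesis .
  qed
  from mollify_L2_bound[OF f e this]
  have "l2 (\<lambda>x. mollify e f x - f x)"
    by (subst l2_iff_nn) (auto intro: le_less_trans)
  from l2_add[OF this f] show ?thesis by simp
qed

lemma mollify_L2_tendsto:
  fixes f :: "'a::euclidean_space \<Rightarrow> complex"
  assumes f: "l2 f"
  shows "(\<lambda>n. \<integral>x. sq (mollify (inverse (real (Suc n))) f x - f x) \<partial>lborel) \<longlonglongrightarrow> 0"
proof (rule LIMSEQ_I)
  fix r :: real assume r: "0 < r"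
  from L2_translation_continuous[OF f, of "r/2"] r obtain d where d: "d > 0"
    "\<And>y. norm y < d \<Longrightarrow> (LBINT x. sq (f (x + y) - f x)) \<le> r/2" by auto
  obtain N where N: "inverse (real (Suc N)) < d" using reals_Archimedean[OF d(1)] by blast
  show "\<exists>no. \<forall>n\<ge>no. norm ((LBINT x. sq (mollify (inverse (real (Suc n))) f x - f x)) - 0) < r"
  proof (intro exI[of _ N] allI impI)
    fix n assume "N \<le> n"
    then have "inverse (real (Suc n)) < d"
      by (intro le_less_trans[OF _ N] le_imp_inverse_le) auto
    then have "(\<integral>\<^sup>+x. ennreal (sq (mollify (inverse (real (Suc n))) f x - f x)) \<partial>lborel) \<le> ennreal (r/2)"
      by (intro mollify_L2_bound[OF f] d(2)) auto
    moreover have "(\<integral>\<^sup>+x. ennreal (sq (mollify (inverse (real (Suc n))) f x - f x)) \<partial>lborel) =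
       ennreal (LBINT x. sq (mollify (inverse (real (Suc n))) f x - f x))"
      by (intro nn_integral_eq_integral l2_integrable l2_minus l2_mollify f) auto
    ultimately have "(LBINT x. sq (mollify (inverse (real (Suc n))) f x - f x)) \<le> r/2"
      using r by simp
    then show "norm ((LBINT x. sq (mollify (inverse (real (Suc n))) f x - f x)) - 0) < r"
      using r by simp
  qed
qed

text \<open>Differentiation under the integral sign by \<open>bump_second_order\<close>. The minus
  sign arises because the kernel is evaluated at \<open>y - x\<close>.\<close>

lemma mollify_has_derivative:
  fixes f :: "'a::euclidean_space \<Rightarrow> complex"
  assumes f: "l2 f" and e: "0 < e" "e \<le> 1"
  shows "(mollify e f has_derivative
    (\<lambda>v. - (LBINT y. (bump_deriv e (y - x) v / (LBINT y. bump e (y::'a))) *\<^sub>R f y))) (at x)"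
proof -
  note [measurable] = l2_measurable[OF f]
  define Z where "Z = (LBINT y. bump e (y::'a))"
  have Z: "Z > 0" using integral_bump_pos[OF e(1), where 'a='a] by (simp add: Z_def)
  have iD: "integrable lborel (\<lambda>y. (bump_deriv e (y - x) v / Z) *\<^sub>R f y)" for v
  proof (rule l2_scaleR_integrable[OF _ f], rule l2_bounded_support[where C="4 * norm v / Z" and x=x and r=1])
    show "norm (bump_deriv e (y - x) v / Z) \<le> 4 * norm v / Z" for y
      using bump_deriv_bounded[OF e, of "y - x" v] Z by (simp add: divide_right_mono)
    show "y \<notin> cball x 1 \<Longrightarrow> bump_deriv e (y - x) v / Z = 0" for y
      using e by (subst bump_deriv_zero) (auto simp: dist_norm norm_minus_commute)
  qed measurable
  define D where "D v = - (LBINT y. (bump_deriv e (y - x) v / Z) *\<^sub>R f y)" for v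
  have "linear D"
  proof (rule linearI)
    show "D (v + w) = D v + D w" for v w
    proof -
      have "(bump_deriv e (y - x) (v + w) / Z) *\<^sub>R f y = (bump_deriv e (y - x) v / Z) *\<^sub>R f y + (bump_deriv e (y - x) w / Z) *\<^sub>R f y" for y
      proof -
        have "bump_deriv e (y - x) (v + w) / Z = bump_deriv e (y - x) v / Z + bump_deriv e (y - x) w / Z"
          by (simp add: bump_deriv_def inner_add_right distrib_left add_divide_distrib diff_divide_distrib)
        then show ?thesis by (simp only: scaleR_add_left)
      qed
      then show ?thesis using iD by (simp add: D_def)
    qed
    show "D (r *\<^sub>R v) = r *\<^sub>R D v" for r v
    proof -
      have "(bump_deriv e (y - x) (r *\<^sub>R v) / Z) *\<^sub>R f y = r *\<^sub>R ((bump_deriv e (y - x) v / Z) *\<^sub>R f y)" for y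
        by (simp add: bump_deriv_def)
      then show ?thesis using iD[of v] by (simp only: D_def integral_scaleR_right scaleR_minus_right)
    qed
  qed
  then have bl: "bounded_linear D" by (rule linear_conv_bounded_linear[THEN iffD1])
  have iB: "integrable lborel (\<lambda>y. (indicator (cball x 2) y :: real) *\<^sub>R f y)"
    by (rule l2_scaleR_integrable[OF _ f], rule l2_bounded_support[where C=1 and x=x and r=2]) (measurable, auto)
  define I where "I = (LBINT y. norm ((indicator (cball x 2) y :: real) *\<^sub>R f y))"
  define C where "C = 27 / Z * I"
  have "(mollify e f has_derivative D) (at x)"
  proof (rule has_derivativeI_sandwich[of 1 D _ x "mollify e f" "\<lambda>y. C * norm (y - x)"])
    fix z assume z: "z \<noteq> x" "dist z x < 1"
    define v where "v = z - x"
    have v: "norm v \<le> 1" using z by (simp add: v_def dist_norm)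
    have i1: "integrable lborel (\<lambda>y. mollifier e (y - w) *\<^sub>R f y)" for w
      by (rule l2_scaleR_integrable[OF l2_mollifier_shift[OF e(1)] f])
    have "mollify e f z - mollify e f x - D v =
      (LBINT y. mollifier e (y - z) *\<^sub>R f y - mollifier e (y - x) *\<^sub>R f y + (bump_deriv e (y - x) v / Z) *\<^sub>R f y)"
      using i1 iD by (simp add: mollify_def D_def)
    also have "norm \<dots> \<le> (LBINT y. (27 / Z * sq v) * norm ((indicator (cball x 2) y :: real) *\<^sub>R f y))"
    proof (intro order_trans[OF integral_norm_bound] integral_mono)
      fix y
      have "mollifier e (y - z) = bump e (y - x + - v) / Z"
        by (simp add: v_def mollifier_def Z_def)
      then have "mollifier e (y - z) *\<^sub>R f y - mollifier e (y - x) *\<^sub>R f y + (bump_deriv e (y - x) v / Z) *\<^sub>R f y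
        = ((bump e (y - x + - v) - bump e (y - x) - bump_deriv e (y - x) (- v)) / Z) *\<^sub>R f y"
        by (simp add: mollifier_def[of e "y - x"] bump_deriv_def Z_def[symmetric] diff_divide_distrib add_divide_distrib scaleR_diff_left scaleR_add_left)
      also have "norm \<dots> \<le> (27 * sq (-v) * indicator (cball 0 2) (y - x)) / Z * norm (f y)"
        using bump_second_order[OF e, of "-v" "y - x"] v Z
        by (auto intro!: mult_right_mono divide_right_mono)
      also have "\<dots> = (27 / Z * sq v) * norm ((indicator (cball x 2) y :: real) *\<^sub>R f y)"
        by (simp add: indicator_def dist_norm norm_minus_commute)
      finally show "norm (mollifier e (y - z) *\<^sub>R f y - mollifier e (y - x) *\<^sub>R f y + (bump_deriv e (y - x) v / Z) *\<^sub>R f y)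
        \<le> (27 / Z * sq v) * norm ((indicator (cball x 2) y :: real) *\<^sub>R f y)" .
    qed (use i1 iD integrable_norm[OF iB] in auto)
    also have "\<dots> = C * norm v * norm v" by (simp add: C_def I_def power2_eq_square)
    finally show "norm (mollify e f z - mollify e f x - D (z - x)) / norm (z - x) \<le> C * norm (z - x)"
      using z by (simp add: v_def[symmetric] divide_le_eq)
  next
    have "((\<lambda>y. C * norm (y - x)) \<longlongrightarrow> C * norm (x - x)) (at x)"
      by (intro tendsto_intros)
    then show "((\<lambda>y. C * norm (y - x)) \<longlongrightarrow> 0) (at x)" by simp
  qed (use bl in auto)
  then show ?thesis by (simp add: D_def[abs_def] Z_def)
qed

section \<open>The circle inequality\<close>

text \<open>The simple pole of the cotangent is beaten by the double zero of b^2, so the limit is 0.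
  Division by zero gives the expression the value 0 at \<open>c\<close> as well.\<close>

lemma cot_square_continuous:
  fixes b :: "real \<Rightarrow> real"
  assumes der: "(b has_real_derivative b') (at c)" and z: "b c = 0" "sin (c/2) = 0"
  shows "isCont (\<lambda>t. cos (t/2) / (2 * sin (t/2)) * (b t)\<^sup>2) c"
proof -
  have c: "cos (c/2) \<noteq> 0" using sin_cos_squared_add[of "c/2"] z(2) by auto
  have bl: "((\<lambda>t. b t / (t - c)) \<longlongrightarrow> b') (at c)"
    using der z by (simp add: has_field_derivative_iff)
  have "((\<lambda>t. sin (t/2)) has_real_derivative cos (c/2) * (1/2)) (at c)"
    by (auto intro!: derivative_eq_intros)
  then have sl: "((\<lambda>t. sin (t/2) / (t - c)) \<longlongrightarrow> cos (c/2) * (1/2)) (at c)"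
    using z by (simp add: has_field_derivative_iff)
  have b0: "(b \<longlongrightarrow> 0) (at c)" using DERIV_isCont[OF der] z by (simp add: isCont_def)
  have cl: "((\<lambda>t. cos (t/2)) \<longlongrightarrow> cos (c/2)) (at c)" by (intro tendsto_intros) auto
  have "((\<lambda>t. cos (t/2) / 2 * ((b t / (t - c)) / (sin (t/2) / (t - c))) * b t) \<longlongrightarrow>
     cos (c/2) / 2 * (b' / (cos (c/2) * (1/2))) * 0) (at c)"
    using c by (intro tendsto_intros cl bl sl b0) auto
  note this[unfolded mult_zero_right]
  then have "((\<lambda>t. cos (t/2) / (2 * sin (t/2)) * (b t)\<^sup>2) \<longlongrightarrow> 0) (at c)"
    by (rule Lim_transform_eventually) (auto simp: eventually_at_filter power2_eq_square)
  then show ?thesis by (simp add: isCont_def z)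
qed

text \<open>Jacobi's method. The first Dirichlet eigenfunction on an interval of length 2 pi is
  sin(t/2), with eigenvalue 1/4 and logarithmic derivative cot(t/2)/2, and b'^2 - b^2/4 = (b' -
  cot(t/2) b/2)^2 + (cot(t/2) b^2/2)'.\<close>

lemma wirtinger_dirichlet:
  fixes b b' :: "real \<Rightarrow> real"
  assumes der: "\<And>t. (b has_real_derivative b' t) (at t)" and cont: "continuous_on UNIV b'"
    and z: "b 0 = 0" "b (2 * pi) = 0"
  shows "0 \<le> integral {0..2 * pi} (\<lambda>t. (b' t)\<^sup>2 - (b t)\<^sup>2 / 4)"
proof -
  let ?f = "\<lambda>t. (b' t)\<^sup>2 - (b t)\<^sup>2 / 4"
  let ?B = "\<lambda>t. cos (t/2) / (2 * sin (t/2)) * (b t)\<^sup>2"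
  have contb: "continuous_on UNIV b"
    using der by (intro continuous_at_imp_continuous_on ballI DERIV_isCont) blast
  have cf: "continuous_on {0..2 * pi} ?f"
    by (intro continuous_intros continuous_on_subset[OF cont] continuous_on_subset[OF contb]) auto
  have sinpos: "0 < sin (t/2)" if "0 < t" "t < 2 * pi" for t
    using that by (intro sin_gt_zero) auto
  have derB: "(?B has_real_derivative (- (b t)\<^sup>2 / (4 * (sin (t/2))\<^sup>2) + cos (t/2) / sin (t/2) * b t * b' t)) (at t)"
    if t: "0 < t" "t < 2 * pi" for t
  proof -
    have s: "sin (t/2) \<noteq> 0" using sinpos[OF t] by simp
    have e: "(sin (t/2))\<^sup>2 + (cos (t/2))\<^sup>2 = 1" by simp
    have "(?B has_real_derivative
       ((- sin (t/2) * (1/2)) * (2 * sin (t/2)) - cos (t/2) * (2 * (cos (t/2) * (1/2)))) / ((2 * sin (t/2)) * (2 * sin (t/2))) * (b t)\<^sup>2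
       + (2 * b t * b' t) * (cos (t/2) / (2 * sin (t/2)))) (at t)"
      using s by (auto intro!: derivative_eq_intros der) (simp add: field_simps power2_eq_square)
    moreover have "(- sin (t/2) * (1/2)) * (2 * sin (t/2)) - cos (t/2) * (2 * (cos (t/2) * (1/2))) = -1"
      using e by (simp add: power2_eq_square)
    ultimately have "(?B has_real_derivative (-1) / ((2 * sin (t/2)) * (2 * sin (t/2))) * (b t)\<^sup>2
       + (2 * b t * b' t) * (cos (t/2) / (2 * sin (t/2)))) (at t)" by (simp only:)
    then show ?thesis by (rule DERIV_cong) (simp add: power2_eq_square)
  qed
  have contB: "continuous_on {0..2 * pi} ?B"
  proof (intro continuous_at_imp_continuous_on ballI)
    fix t assume "t \<in> {0..2 * pi}"
    then consider "t = 0" | "t = 2 * pi" | "0 < t" "t < 2 * pi" by fastforce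
    then show "isCont ?B t"
    proof cases
      case 1 then show ?thesis using cot_square_continuous[OF der, of 0] z by simp
    next
      case 2 then show ?thesis using cot_square_continuous[OF der, of "2 * pi"] z by simp
    next
      case 3 then show ?thesis by (rule DERIV_isCont[OF derB])
    qed
  qed
  \<comment> \<open>The derivative of \<open>?K\<close> is the completed square, and
    \<open>?B\<close> vanishes at both ends because \<open>b\<close> does.\<close>
  let ?K = "\<lambda>t. integral {0..t} ?f - ?B t"
  have "?K 0 \<le> ?K (2 * pi)"
  proof (rule DERIV_nonneg_imp_increasing_open[where f="?K"])
    show "continuous_on {0..2 * pi} ?K"
      by (intro continuous_on_diff contB indefinite_integral_continuous_1 integrable_continuous_real cf)
    fix t assume t: "0 < t" "t < 2 * pi"
    then have "((\<lambda>x. integral {0..x} ?f) has_real_derivative ?f t) (at t within {0..2 * pi})"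
      by (intro integral_has_real_derivative cf) auto
    then have 1: "((\<lambda>x. integral {0..x} ?f) has_real_derivative ?f t) (at t)"
      using t by (simp add: at_within_Icc_at)
    let ?s = "sin (t/2)" and ?c = "cos (t/2)"
    have s: "?s \<noteq> 0" using sinpos[OF t] by simp
    have "?f t - (- (b t)\<^sup>2 / (4 * ?s\<^sup>2) + ?c / ?s * b t * b' t) = (b' t - ?c / (2 * ?s) * b t)\<^sup>2"
    proof -
      have "?c\<^sup>2 = 1 - ?s\<^sup>2" by (simp add: cos_squared_eq)
      then have "(?c / (2 * ?s) * b t)\<^sup>2 = (b t)\<^sup>2 / (4 * ?s\<^sup>2) - (b t)\<^sup>2 / 4"
      proof -
        have "(1 - q) / (4 * q) * B = B / (4 * q) - B / 4" if "q \<noteq> 0" for q B :: real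
          using that by (simp add: field_simps)
        from this[of "?s\<^sup>2" "(b t)\<^sup>2"] s \<open>?c\<^sup>2 = 1 - ?s\<^sup>2\<close> show ?thesis
          by (simp add: power_mult_distrib power_divide)
      qed
      then show ?thesis unfolding power2_diff by simp
    qed
    moreover have "(?K has_real_derivative ?f t - (- (b t)\<^sup>2 / (4 * ?s\<^sup>2) + ?c / ?s * b t * b' t)) (at t)"
      by (intro DERIV_diff 1 derB t)
    ultimately show "\<exists>y. (?K has_real_derivative y) (at t) \<and> 0 \<le> y" by force
  qed simp
  then show ?thesis by simp
qed

lemma integral_periodic_shift:
  fixes f :: "real \<Rightarrow> real"
  assumes cont: "continuous_on UNIV f" and per: "\<And>t. f (t + p) = f t" and c: "0 \<le> c" "c \<le> p"
  shows "integral {0..p} (\<lambda>t. f (t + c)) = integral {0..p} f"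
proof -
  have i: "f integrable_on {a..b}" for a b
    by (intro integrable_continuous_real continuous_on_subset[OF cont]) auto
  have "integral {0..p} (\<lambda>t. f (t + c)) = integral {c..p + c} f"
    using integral_shift_real_ivl[of c c "p + c" f] by simp
  also have "\<dots> = integral {c..p} f + integral {p..p + c} f"
    using c by (intro Henstock_Kurzweil_Integration.integral_combine[symmetric] i) auto
  also have "integral {p..p + c} f = integral {0..c} f"
    using integral_shift_real_ivl[of p p "p + c" f] by (simp add: per)
  also have "integral {c..p} f + integral {0..c} f = integral {0..p} f"
    using c Henstock_Kurzweil_Integration.integral_combine[of 0 c p f] i by simp
  finally show ?thesis .
qed

text \<open>A real antiperiodic function changes sign and so vanishes at some \<open>c\<close>,
  hence also at c + 2 pi: after a shift by \<open>c\<close> it satisfies Dirichlet conditions. The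
  integrand is quadratic, therefore periodic, and its integral survives the shift.\<close>

lemma wirtinger_antiperiodic:
  fixes a a' :: "real \<Rightarrow> real"
  assumes der: "\<And>t. (a has_real_derivative a' t) (at t)" and cont: "continuous_on UNIV a'"
    and anti: "\<And>t. a (t + 2 * pi) = - a t"
  shows "0 \<le> integral {0..2 * pi} (\<lambda>t. (a' t)\<^sup>2 - (a t)\<^sup>2 / 4)"
proof -
  have conta: "continuous_on S a" for S
    using der by (intro continuous_at_imp_continuous_on ballI DERIV_isCont) blast
  have "\<exists>c\<in>{0..2 * pi}. a c = 0"
  proof -
    have "a 0 \<le> 0 \<and> 0 \<le> a (2 * pi) \<or> a (2 * pi) \<le> 0 \<and> 0 \<le> a 0" using anti[of 0] by auto
    then show ?thesis
      using IVT'[of a 0 0 "2 * pi", OF _ _ _ conta] IVT2'[of a "2 * pi" 0 0, OF _ _ _ conta] by force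
  qed
  then obtain c where c: "0 \<le> c" "c \<le> 2 * pi" "a c = 0" by auto
  have anti': "a' (t + 2 * pi) = - a' t" for t
  proof (rule DERIV_unique)
    show "((\<lambda>t. a (t + 2 * pi)) has_real_derivative a' (t + 2 * pi)) (at t)"
      using DERIV_shift[of a "a' (t + 2 * pi)" t "2 * pi"] der by simp
    have "((\<lambda>t. - a t) has_real_derivative - a' t) (at t)" by (intro DERIV_minus der)
    then show "((\<lambda>t. a (t + 2 * pi)) has_real_derivative - a' t) (at t)" by (simp add: anti)
  qed
  let ?f = "\<lambda>t. (a' t)\<^sup>2 - (a t)\<^sup>2 / 4"
  have "0 \<le> integral {0..2 * pi} (\<lambda>t. ?f (t + c))"
  proof (rule wirtinger_dirichlet[of "\<lambda>t. a (t + c)" "\<lambda>t. a' (t + c)"])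
    show "((\<lambda>t. a (t + c)) has_real_derivative a' (t + c)) (at t)" for t
      using DERIV_shift[of a "a' (t + c)" t c] der by simp
    show "continuous_on UNIV (\<lambda>t. a' (t + c))"
      by (intro continuous_on_compose2[OF cont] continuous_intros) auto
    show "a (0 + c) = 0" "a (2 * pi + c) = 0" using c anti[of c] by (auto simp: add.commute)
  qed
  also have "\<dots> = integral {0..2 * pi} ?f"
    by (rule integral_periodic_shift) (use c in \<open>auto simp: anti anti' intro!: continuous_intros cont conta\<close>)
  finally show ?thesis .
qed

text \<open>The gauge transformation v = exp(-i t/2) p gives |p'|^2 - Im(p* p') = |v'|^2 - |v|^2/4
  and makes \<open>v\<close> antiperiodic, so its real and imaginary parts obey the preceding
  inequality. This is the case s = 1; for s = 0 the integrand is a square, and the general case is a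
  convex combination.\<close>

lemma circle_current_le_energy:
  fixes p p' :: "real \<Rightarrow> complex"
  assumes der: "\<And>t. (p has_vector_derivative p' t) (at t)" and cont: "continuous_on UNIV p'"
    and per: "\<And>t. p (t + 2 * pi) = p t" and s: "0 \<le> s" "s \<le> 1"
  shows "0 \<le> integral {0..2 * pi} (\<lambda>t. sq (p' t) - s * Im (cnj (p t) * p' t))"
proof -
  have contp: "continuous_on S p" for S
    using der by (intro continuous_at_imp_continuous_on ballI has_vector_derivative_continuous) blast
  define v where "v t = cis (- t/2) * p t" for t
  define v' where "v' t = cis (- t/2) * (p' t - \<i> / 2 * p t)" for t
  have cis_der: "((\<lambda>t. cis (- t/2)) has_vector_derivative (- \<i> / 2 * cis (- t/2))) (at t)" for t
  proof -
    have 1: "((\<lambda>t. \<i> * complex_of_real (- t/2)) has_vector_derivative \<i> * of_real (- 1/2)) (at t)"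
      by (intro has_vector_derivative_mult_right has_vector_derivative_of_real)
         (auto intro!: derivative_eq_intros)
    have 2: "(exp has_field_derivative exp (\<i> * complex_of_real (- t/2))) (at (\<i> * complex_of_real (- t/2)))"
      by (rule DERIV_exp)
    from field_vector_diff_chain_at[OF 1 2] show ?thesis
      by (simp add: o_def cis_conv_exp mult.commute)
  qed
  have dv: "(v has_vector_derivative v' t) (at t)" for t
    unfolding v_def v'_def
    by (rule has_vector_derivative_eq_rhs, rule has_vector_derivative_mult[OF cis_der der]) (simp add: algebra_simps)
  have contv': "continuous_on UNIV v'"
    unfolding v'_def by (intro continuous_intros contp cont) auto
  have anti: "v (t + 2 * pi) = - v t" for t
  proof -
    have "- (t + 2 * pi) / 2 = - t/2 - pi" by (simp add: field_simps)
    then have "cis (- (t + 2 * pi) / 2) = cis (- t/2) / cis pi" by (simp only: cis_divide)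
    then show ?thesis unfolding v_def per by simp
  qed
  have re: "0 \<le> integral {0..2 * pi} (\<lambda>t. (Re (v' t))\<^sup>2 - (Re (v t))\<^sup>2 / 4)"
    by (rule wirtinger_antiperiodic)
       (use dv contv' anti in \<open>auto simp: has_real_derivative_iff_has_vector_derivative
          intro!: continuous_intros bounded_linear.has_vector_derivative[OF bounded_linear_Re]\<close>)
  have im: "0 \<le> integral {0..2 * pi} (\<lambda>t. (Im (v' t))\<^sup>2 - (Im (v t))\<^sup>2 / 4)"
    by (rule wirtinger_antiperiodic)
       (use dv contv' anti in \<open>auto simp: has_real_derivative_iff_has_vector_derivative
          intro!: continuous_intros bounded_linear.has_vector_derivative[OF bounded_linear_Im]\<close>)
  have contv: "continuous_on S v" for S unfolding v_def by (intro continuous_intros contp) auto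
  have contv'': "continuous_on S v'" for S by (rule continuous_on_subset[OF contv']) auto
  have contp': "continuous_on S p'" for S by (rule continuous_on_subset[OF cont]) auto
  let ?e = "\<lambda>t. sq (p' t)" and ?j = "\<lambda>t. Im (cnj (p t) * p' t)"
  have eq: "((Re (v' t))\<^sup>2 - (Re (v t))\<^sup>2 / 4) + ((Im (v' t))\<^sup>2 - (Im (v t))\<^sup>2 / 4) = ?e t - ?j t" for t
  proof -
    have "sq (v' t) = sq (p' t - \<i> / 2 * p t)" "sq (v t) = sq (p t)"
      by (simp_all add: v_def v'_def norm_mult)
    moreover have "sq (p' t - \<i> / 2 * p t) = ?e t - ?j t + sq (p t) / 4"
      by (simp add: cmod_power2) (simp add: power2_eq_square algebra_simps)
    moreover have "sq (v' t) = (Re (v' t))\<^sup>2 + (Im (v' t))\<^sup>2" "sq (v t) = (Re (v t))\<^sup>2 + (Im (v t))\<^sup>2"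
      by (simp_all add: cmod_power2)
    ultimately show ?thesis by argo
  qed
  have ii: "?e integrable_on {0..2 * pi}" "(\<lambda>t. ?e t - ?j t) integrable_on {0..2 * pi}"
    by (intro integrable_continuous_real continuous_intros contp contp')+
  have 1: "0 \<le> integral {0..2 * pi} (\<lambda>t. ?e t - ?j t)"
  proof -
    have "integral {0..2 * pi} (\<lambda>t. ?e t - ?j t) =
      integral {0..2 * pi} (\<lambda>t. (Re (v' t))\<^sup>2 - (Re (v t))\<^sup>2 / 4) + integral {0..2 * pi} (\<lambda>t. (Im (v' t))\<^sup>2 - (Im (v t))\<^sup>2 / 4)"
      unfolding eq[symmetric]
      by (intro Henstock_Kurzweil_Integration.integral_add integrable_continuous_real continuous_intros contv contv'') auto
    with re im show ?thesis by simp
  qed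
  have 0: "0 \<le> integral {0..2 * pi} ?e" by (intro Henstock_Kurzweil_Integration.integral_nonneg ii) auto
  have "integral {0..2 * pi} (\<lambda>t. ?e t - s * ?j t) = integral {0..2 * pi} (\<lambda>t. (1 - s) * ?e t + s * (?e t - ?j t))"
    by (intro arg_cong2[where f=integral] ext refl) (simp add: algebra_simps)
  also have "\<dots> = (1 - s) * integral {0..2 * pi} ?e + s * integral {0..2 * pi} (\<lambda>t. ?e t - ?j t)"
    using integrable_cmul[OF ii(1), of "1 - s"] integrable_cmul[OF ii(2), of s]
    by (subst Henstock_Kurzweil_Integration.integral_add) auto
  finally show ?thesis using 0 1 s by simp
qed

section \<open>Integration in space\<close>

definition r2 :: "real^3 \<Rightarrow> real" where "r2 x = (x$1)\<^sup>2 + (x$2)\<^sup>2"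

lemma continuous_r2[continuous_intros]: "continuous_on S f \<Longrightarrow> continuous_on S (\<lambda>x. r2 (f x))"
  unfolding r2_def by (intro continuous_intros)

lemma r2_measurable[measurable]: "r2 \<in> borel_measurable borel"
  by (intro borel_measurable_continuous_onI continuous_intros)

lemma r2_nonneg[simp]: "0 \<le> r2 x" by (simp add: r2_def)

lemma AE_coordinate_nonzero: "AE x::real^3 in lborel. x $ i \<noteq> 0"
  using AE_lborel_inner_neq[of "axis i 1 :: real^3" 0] by (simp add: axis_in_Basis_iff inner_axis)

lemma AE_r2_nonzero: "AE x in lborel. r2 x \<noteq> 0"
  using AE_coordinate_nonzero[of 1] by eventually_elim (auto simp: r2_def add_nonneg_eq_0_iff)

text \<open>The lines along which the fundamental theorem of calculus is applied avoid the axis for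
  almost every starting point.\<close>

lemma integral_partial_derivative_zero:
  fixes h D :: "real^3 \<Rightarrow> 'b::euclidean_space"
  assumes h: "integrable lborel h" and D: "integrable lborel D"
    and der: "\<And>y. r2 y \<noteq> 0 \<Longrightarrow> ((\<lambda>t. h (y + t *\<^sub>R axis a 1)) has_vector_derivative D y) (at 0)"
    and cont: "continuous_on {y. r2 y \<noteq> 0} D"
  shows "(LBINT x. D x) = 0"
proof -
  note [measurable] = borel_measurable_integrable[OF h] borel_measurable_integrable[OF D]
  have [measurable]: "h \<in> borel_measurable borel" "D \<in> borel_measurable borel"
    using borel_measurable_integrable[OF h] borel_measurable_integrable[OF D] by auto
  let ?e = "axis a 1 :: real^3"
  have off: "r2 (x + s *\<^sub>R ?e) \<noteq> 0" if "x$1 \<noteq> 0" "x$2 \<noteq> 0" for x s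
  proof -
    have "a = 1 \<or> a = 2 \<or> a = 3" using exhaust_3 by blast
    then show ?thesis using that by (auto simp: r2_def axis_def add_nonneg_eq_0_iff)
  qed
  \<comment> \<open>The average of \<open>D\<close> over unit segments is integrated over all
    starting points in two ways: translation invariance gives the integral of \<open>D\<close>, and
    the fundamental theorem gives the integral of h(x + e) - h(x), which is 0.\<close>
  have line: "(LBINT s. indicator {0..1} s *\<^sub>R D (x + s *\<^sub>R ?e)) = h (x + ?e) - h x"
    if x: "x$1 \<noteq> 0" "x$2 \<noteq> 0" for x
  proof -
    have "(LBINT s. indicator {0..1} s *\<^sub>R D (x + s *\<^sub>R ?e)) = h (x + 1 *\<^sub>R ?e) - h (x + 0 *\<^sub>R ?e)"
    proof (rule integral_FTC_atLeastAtMost)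
      fix s :: real
      have 1: "((\<lambda>t. t - s) has_vector_derivative 1) (at s)"
        by (auto intro!: derivative_eq_intros)
      have 2: "((\<lambda>t. h ((x + s *\<^sub>R ?e) + t *\<^sub>R ?e)) has_vector_derivative D (x + s *\<^sub>R ?e)) (at (s - s))"
        using der[OF off[OF x]] by simp
      from vector_diff_chain_at[OF 1 2]
      have "((\<lambda>t. h ((x + s *\<^sub>R ?e) + (t - s) *\<^sub>R ?e)) has_vector_derivative D (x + s *\<^sub>R ?e)) (at s)"
        by (simp add: o_def)
      then show "((\<lambda>s. h (x + s *\<^sub>R ?e)) has_vector_derivative D (x + s *\<^sub>R ?e)) (at s within {0..1})"
        by (simp add: algebra_simps has_vector_derivative_at_within)
    next
      show "continuous_on {0..1} (\<lambda>s. D (x + s *\<^sub>R ?e))"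
        by (intro continuous_on_compose2[OF cont] continuous_intros) (use off[OF x] in auto)
    qed simp
    then show ?thesis by simp
  qed
  have norms: "(LBINT x. norm (indicator {0..1} s *\<^sub>R D (x + s *\<^sub>R ?e)))
      = indicator {0..1} s * (LBINT x. norm (D x))" for s :: real
    using integral_lborel_shift[of "\<lambda>x. norm (D x)" "s *\<^sub>R ?e"] by simp
  have "integrable (lborel \<Otimes>\<^sub>M lborel) (\<lambda>(s::real, x). indicator {0..1} s *\<^sub>R D (x + s *\<^sub>R ?e))"
  proof (rule lborel_pair.Fubini_integrable)
    show "(\<lambda>(s::real, x). indicator {0..1} s *\<^sub>R D (x + s *\<^sub>R ?e)) \<in> borel_measurable (lborel \<Otimes>\<^sub>M lborel)"
      by measurable
    show "integrable lborel (\<lambda>s::real. \<integral>x. norm (case (s, x) of (s, x) \<Rightarrow> indicator {0..1} s *\<^sub>R D (x + s *\<^sub>R ?e)) \<partial>lborel)"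
      unfolding prod.case norms by (intro integrable_mult_left) auto
    show "AE s::real in lborel. integrable lborel (\<lambda>x. case (s, x) of (s, x) \<Rightarrow> indicator {0..1} s *\<^sub>R D (x + s *\<^sub>R ?e))"
      using integrable_lborel_shift[OF D] by (intro AE_I2) auto
  qed
  from lborel_pair.Fubini_integral[OF this]
  have "(LBINT x. (LBINT s. indicator {0..1} s *\<^sub>R D (x + s *\<^sub>R ?e)))
     = (LBINT s. (LBINT x. indicator {0..1} (s::real) *\<^sub>R D (x + s *\<^sub>R ?e)))" by simp
  also have "\<dots> = (LBINT s. indicator {0..1} (s::real) *\<^sub>R (LBINT x. D x))"
    by (simp add: integral_lborel_shift integrable_lborel_shift[OF D])
  also have "\<dots> = (LBINT x. D x)" by simp
  also have "(LBINT x. (LBINT s. indicator {0..1} s *\<^sub>R D (x + s *\<^sub>R ?e))) = (LBINT x. h (x + ?e) - h x)"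
    using AE_coordinate_nonzero[of 1] AE_coordinate_nonzero[of 2]
    by (intro integral_cong_AE) (auto simp: line elim!: eventually_elim2)
  also have "\<dots> = 0"
    using h integrable_lborel_shift[OF h] by (simp add: integral_lborel_shift)
  finally show ?thesis by simp
qed

section \<open>Rotations about the third axis and averaging over them\<close>

definition rot :: "real \<Rightarrow> real^3 \<Rightarrow> real^3" where
  "rot \<theta> x = (\<chi> i. if i = 1 then cos \<theta> * x$1 - sin \<theta> * x$2
                else if i = 2 then sin \<theta> * x$1 + cos \<theta> * x$2 else x$3)"

lemma rot_nth [simp]:
  "rot \<theta> x $ 1 = cos \<theta> * x$1 - sin \<theta> * x$2"
  "rot \<theta> x $ 2 = sin \<theta> * x$1 + cos \<theta> * x$2"
  "rot \<theta> x $ 3 = x$3"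
  by (simp_all add: rot_def)

lemma r2_rot[simp]: "r2 (rot \<theta> x) = r2 x"
proof -
  have "r2 (rot \<theta> x) = ((cos \<theta>)\<^sup>2 + (sin \<theta>)\<^sup>2) * r2 x"
    by (simp only: r2_def rot_nth) algebra
  then show ?thesis by simp
qed

lemma orthogonal_rot: "orthogonal_transformation (rot \<theta>)"
proof -
  have "linear (rot \<theta>)"
    by (rule linearI) (simp_all add: vec_eq_iff forall_3 algebra_simps)
  moreover have "rot \<theta> v \<bullet> rot \<theta> w = v \<bullet> w" for v w
  proof -
    have "rot \<theta> v \<bullet> rot \<theta> w = ((cos \<theta>)\<^sup>2 + (sin \<theta>)\<^sup>2) * (v$1 * w$1 + v$2 * w$2) + v$3 * w$3"
      by (simp only: inner_vec_def sum_3 inner_real_def rot_nth) algebra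
    then show ?thesis by (simp add: inner_vec_def sum_3)
  qed
  ultimately show ?thesis by (simp add: orthogonal_transformation_def)
qed

lemma continuous_rot[continuous_intros]:
  fixes f :: "'a::t2_space \<Rightarrow> real"
  assumes "continuous_on S f" "continuous_on S g"
  shows "continuous_on S (\<lambda>x. rot (f x) (g x))"
proof -
  have "continuous_on S (\<lambda>x. \<chi> i. rot (f x) (g x) $ i)"
  proof (intro continuous_on_vec_lambda)
    fix i :: 3 
    have "i = 1 \<or> i = 2 \<or> i = 3" using exhaust_3 by blast
    then show "continuous_on S (\<lambda>x. rot (f x) (g x) $ i)"
      by (elim disjE; simp; intro continuous_intros assms)
  qed
  then show ?thesis by simp
qed

text \<open>Lebesgue measure is determined by boxes, and the preimage of a box is its image under
  the inverse orthogonal map, which preserves volume.\<close>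

lemma lborel_distr_rot: "distr lborel borel (rot \<theta>) = lborel"
proof (rule lborel_eqI[symmetric])
  have [measurable]: "rot \<theta> \<in> borel_measurable borel"
    by (intro borel_measurable_continuous_onI continuous_intros)
  fix l u :: "real^3" assume lu: "\<And>b. b \<in> Basis \<Longrightarrow> l \<bullet> b \<le> u \<bullet> b"
  have o: "orthogonal_transformation (inv (rot \<theta>))"
    using orthogonal_transformation_inv[OF orthogonal_rot] .
  have v: "rot \<theta> -` box l u = inv (rot \<theta>) ` box l u"
    using orthogonal_transformation_bij[OF orthogonal_rot] by (simp add: bij_vimage_eq_inv_image)
  have b: "box l u \<in> lmeasurable" by simp
  have s: "rot \<theta> -` box l u \<in> sets borel"
    using measurable_sets[of "rot \<theta>" borel borel "box l u"] by simp
  have "emeasure (distr lborel borel (rot \<theta>)) (box l u) = emeasure lebesgue (rot \<theta> -` box l u)"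
    using s by (simp add: emeasure_distr)
  also have "\<dots> = ennreal (measure lebesgue (rot \<theta> -` box l u))"
    using measurable_orthogonal_image[OF o b] by (simp add: v emeasure_eq_measure2)
  also have "\<dots> = ennreal (measure lebesgue (box l u))"
    by (simp add: v measure_orthogonal_image[OF o b])
  also have "\<dots> = (\<Prod>b\<in>Basis. (u - l) \<bullet> b)"
    using lu by (simp add: measure_lborel_box_eq inner_diff_left)
  finally show "emeasure (distr lborel borel (rot \<theta>)) (box l u) = (\<Prod>b\<in>Basis. (u - l) \<bullet> b)" .
qed simp

text \<open>Averaging over rotations takes the place of polar coordinates: 2 pi times the integral
  of \<open>H\<close> is the integral over x of the integral of \<open>H\<close> along the circle
  through x. There \<open>w\<close> is constant and \<open>L\<close> is the derivative of
  \<open>u\<close> along the circle, so the circle inequality applies.\<close>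

lemma integral_angular_nonneg:
  fixes u :: "real^3 \<Rightarrow> complex" and G :: "real^3 \<Rightarrow> complex^3" and w :: "real^3 \<Rightarrow> real"
  assumes der: "\<And>x. (u has_derivative (\<lambda>v. \<Sum>a\<in>UNIV. v$a *\<^sub>R G x$a)) (at x)"
    and contG: "continuous_on UNIV G" and s: "0 \<le> s" "s \<le> 1"
    and w[measurable]: "w \<in> borel_measurable borel" and w0: "\<And>x. 0 \<le> w x" and wrot: "\<And>\<theta> x. w (rot \<theta> x) = w x"
  defines "L \<equiv> \<lambda>x. x$1 *\<^sub>R G x$2 - x$2 *\<^sub>R G x$1"
  defines "H \<equiv> \<lambda>x. w x * (sq (L x) - s * Im (cnj (u x) * L x))"
  assumes int: "integrable lborel H"
  shows "0 \<le> (LBINT x. H x)"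
proof -
  have contu: "continuous_on S u" for S
    using der by (intro continuous_at_imp_continuous_on ballI has_derivative_continuous) blast
  have contL: "continuous_on UNIV L"
    unfolding L_def by (intro continuous_intros contG)
  have [measurable]: "u \<in> borel_measurable borel" "L \<in> borel_measurable borel"
    using contu contL by (auto intro: borel_measurable_continuous_onI)
  have [measurable]: "(\<lambda>x. cnj (u x)) \<in> borel_measurable borel"
    by (intro borel_measurable_continuous_onI continuous_intros contu)
  have [measurable]: "H \<in> borel_measurable borel" unfolding H_def by measurable
  have "continuous_on UNIV (\<lambda>p. rot (fst p) (snd p))" by (intro continuous_intros)
  then have "(\<lambda>p. rot (fst p) (snd p)) \<in> borel_measurable borel"
    by (rule borel_measurable_continuous_onI)
  then have [measurable]: "(\<lambda>p. rot (fst p) (snd p)) \<in> borel_measurable (borel \<Otimes>\<^sub>M borel)"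
    by (simp add: borel_prod)
  have [measurable]: "rot \<theta> \<in> borel_measurable borel" for \<theta>
    by (intro borel_measurable_continuous_onI continuous_intros)
  have inv: "(LBINT x. f (rot \<theta> x)) = (LBINT x. f x)" if [measurable]: "f \<in> borel_measurable borel" for f :: "_ \<Rightarrow> real" and \<theta>
  proof -
    have "(LBINT x. f x) = (\<integral>x. f x \<partial>distr lborel borel (rot \<theta>))" by (simp add: lborel_distr_rot)
    also have "\<dots> = (LBINT x. f (rot \<theta> x))" by (rule integral_distr) auto
    finally show ?thesis by simp
  qed
  have irot: "integrable lborel (\<lambda>x. H (rot \<theta> x))" for \<theta>
  proof -
    have "integrable (distr lborel borel (rot \<theta>)) H" using int by (simp add: lborel_distr_rot)
    then show ?thesis by (subst (asm) integrable_distr_eq) auto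
  qed
  let ?I = "{0..2 * pi}"
  have norms: "(LBINT x. norm (indicator ?I t * H (rot t x))) = indicator ?I t * (LBINT x. norm (H x))" for t
    using inv[of "\<lambda>x. norm (H x)" t] by (simp add: abs_mult)
  have "integrable (lborel \<Otimes>\<^sub>M lborel) (\<lambda>(t, x). indicator ?I t * H (rot t x))"
  proof (rule lborel_pair.Fubini_integrable)
    show "(\<lambda>(t, x). indicator ?I t * H (rot t x)) \<in> borel_measurable (lborel \<Otimes>\<^sub>M lborel)"
      unfolding split_beta' by measurable
    show "integrable lborel (\<lambda>t. \<integral>x. norm (case (t, x) of (t, x) \<Rightarrow> indicator ?I t * H (rot t x)) \<partial>lborel)"
      unfolding prod.case norms by (intro integrable_mult_left) auto
    show "AE t in lborel. integrable lborel (\<lambda>x. case (t, x) of (t, x) \<Rightarrow> indicator ?I t * H (rot t x))"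
      using irot by (intro AE_I2) auto
  qed
  from lborel_pair.Fubini_integral[OF this]
  have "(LBINT x. (LBINT t. indicator ?I t * H (rot t x))) = (LBINT t. (LBINT x. indicator ?I t * H (rot t x)))"
    by simp
  also have "\<dots> = (LBINT t. indicator ?I t * (LBINT x. H x))"
    by (simp add: inv)
  also have "\<dots> = 2 * pi * (LBINT x. H x)" by simp
  finally have eq: "2 * pi * (LBINT x. H x) = (LBINT x. (LBINT t. indicator ?I t * H (rot t x)))" ..
  have "0 \<le> (LBINT t. indicator ?I t * H (rot t x))" for x
  proof -
    define p where "p t = u (rot t x)" for t
    define p' where "p' t = L (rot t x)" for t
    have "(p has_vector_derivative p' t) (at t)" for t
    proof -
      \<comment> \<open>The orbit of x is cos t v1 + sin t v2 + v3, which makes its velocity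
        explicit.\<close>
      define v1 :: "real^3" where "v1 = (\<chi> i. if i = 3 then 0 else x$i)"
      define v2 :: "real^3" where "v2 = (\<chi> i. if i = 1 then - x$2 else if i = 2 then x$1 else 0)"
      define v3 :: "real^3" where "v3 = (\<chi> i. if i = 3 then x$3 else 0)"
      have rx: "rot t x = cos t *\<^sub>R v1 + sin t *\<^sub>R v2 + v3" for t
        by (simp add: vec_eq_iff forall_3 v1_def v2_def v3_def)
      have 1: "((\<lambda>t. rot t x) has_vector_derivative (- sin t) *\<^sub>R v1 + cos t *\<^sub>R v2) (at t)"
      proof -
        have "((\<lambda>t. cos t *\<^sub>R v1 + sin t *\<^sub>R v2 + v3) has_vector_derivative
           (cos t *\<^sub>R 0 + (- sin t) *\<^sub>R v1) + (sin t *\<^sub>R 0 + cos t *\<^sub>R v2) + 0) (at t)"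
          by (intro has_vector_derivative_add has_vector_derivative_scaleR has_vector_derivative_const DERIV_cos DERIV_sin)
        then show ?thesis by (simp only: rx scaleR_zero_right add_0_left add_0_right)
      qed
      have 2: "(u has_derivative (\<lambda>v. \<Sum>a\<in>UNIV. v$a *\<^sub>R G (rot t x)$a)) (at (rot t x) within range (\<lambda>t. rot t x))"
        by (rule has_derivative_at_withinI[OF der])
      have "(u \<circ> (\<lambda>t. rot t x) has_vector_derivative
         (\<Sum>a\<in>UNIV. ((- sin t) *\<^sub>R v1 + cos t *\<^sub>R v2)$a *\<^sub>R G (rot t x)$a)) (at t)"
        using vector_derivative_diff_chain_within[OF 1 2] by simp
      moreover have "(\<Sum>a\<in>UNIV. ((- sin t) *\<^sub>R v1 + cos t *\<^sub>R v2)$a *\<^sub>R G (rot t x)$a) = p' t"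
        by (simp add: sum_3 p'_def L_def v1_def v2_def scaleR_diff_left scaleR_add_left)
      ultimately show ?thesis by (simp add: p_def[abs_def] o_def)
    qed
    moreover have "continuous_on UNIV p'" unfolding p'_def
      by (intro continuous_on_compose2[OF contL] continuous_intros) auto
    moreover have "p (t + 2 * pi) = p t" for t
    proof -
      have "rot (t + 2 * pi) x = rot t x" by (simp add: vec_eq_iff forall_3)
      then show ?thesis by (simp add: p_def)
    qed
    ultimately have "0 \<le> integral ?I (\<lambda>t. sq (p' t) - s * Im (cnj (p t) * p' t))"
      using s by (intro circle_current_le_energy)
    also have "\<dots> = (LBINT t. indicator ?I t * (sq (p' t) - s * Im (cnj (p t) * p' t)))"
    proof -
      have "continuous_on ?I (\<lambda>t. sq (p' t) - s * Im (cnj (p t) * p' t))"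
        unfolding p_def p'_def
        by (intro continuous_intros continuous_on_compose2[OF contL] continuous_on_compose2[OF contu[of UNIV]]) auto
      then have "set_integrable lborel ?I (\<lambda>t. sq (p' t) - s * Im (cnj (p t) * p' t))"
        unfolding set_integrable_def by (intro borel_integrable_compact compact_Icc)
      from set_borel_integral_eq_integral(2)[OF this] show ?thesis
        by (simp add: set_lebesgue_integral_def)
    qed
    finally have "0 \<le> w x * \<dots>" using w0 by simp
    also have "\<dots> = (LBINT t. w x * (indicator ?I t * (sq (p' t) - s * Im (cnj (p t) * p' t))))" by simp
    also have "\<dots> = (LBINT t. indicator ?I t * H (rot t x))"
      by (intro arg_cong2[where f=lebesgue_integral] ext refl) (simp add: H_def p_def p'_def wrot)
    finally show ?thesis .
  qed
  then have "0 \<le> 2 * pi * (LBINT x. H x)" unfolding eq by (intro integral_nonneg_AE) auto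
  then show ?thesis using pi_gt_zero by (simp add: zero_le_mult_iff)
qed

section \<open>The ground state inequality\<close>

lemma vec_nth_measurable:
  "(\<lambda>z::'a::euclidean_space^'n. z $ a) \<in> borel_measurable borel"
  by (intro borel_measurable_continuous_onI continuous_intros)

lemma norm_square_vec3: "sq (v::real^3) = (v$1)\<^sup>2 + (v$2)\<^sup>2 + (v$3)\<^sup>2"
  unfolding power2_norm_eq_inner by (simp add: inner_vec_def sum_3 power2_eq_square)

lemma norm_square_cvec3:
  "sq (v::complex^3) = sq (v$1) + sq (v$2) + sq (v$3)"
  unfolding power2_norm_eq_inner by (simp add: inner_vec_def sum_3 power2_eq_square)

lemma norm_component_le: "norm ((v::complex^3) $ a) \<le> norm v"
  by (rule Finite_Cartesian_Product.norm_nth_le)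

text \<open>Half a flux quantum along the third coordinate axis.\<close>

definition flux :: "real^3 \<Rightarrow> real^3" where
  "flux x = (\<chi> a. if a = 1 then x$2 / (2 * r2 x) else if a = 2 then - x$1 / (2 * r2 x) else 0)"

lemma flux_nth [simp]:
  "flux x $ 1 = x$2 / (2 * r2 x)" "flux x $ 2 = - x$1 / (2 * r2 x)" "flux x $ 3 = 0"
  by (simp_all add: flux_def)

lemma norm_flux: assumes "r2 x \<noteq> 0" shows "sq (flux x) = 1 / (4 * r2 x)"
proof -
  have "sq (flux x) = r2 x / (4 * (r2 x)\<^sup>2)"
    by (simp add: norm_square_vec3 power_mult_distrib power_divide add_divide_distrib[symmetric])
       (simp add: r2_def add.commute)
  with assms show ?thesis by (simp add: power2_eq_square)
qed

text \<open>Twice the kinetic energy density. The value \<open>u\<close> and the gradient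
  \<open>G\<close> at the point are separate arguments, so that classical and weak gradients can be
  inserted alike.\<close>

definition kinetic :: "field \<Rightarrow> complex \<Rightarrow> complex^3 \<Rightarrow> real^3 \<Rightarrow> real" where
  "kinetic A u G x = sq (\<chi> a. - \<i> * (G $ a) + of_real (A x $ a) * u)"

text \<open>The angular derivative, that is i times the third component of the angular momentum
  operator applied to the function.\<close>

definition current :: "complex \<Rightarrow> complex^3 \<Rightarrow> real^3 \<Rightarrow> complex" where
  "current u G x = x$1 *\<^sub>R G$2 - x$2 *\<^sub>R G$1"

text \<open>The logarithmic gradient of the function \<open>sqrt (r2 x) * exp (- sq x / 2)\<close>.\<close>

definition drift :: "real^3 \<Rightarrow> real^3" where
  "drift x = (\<chi> a. if a = 1 then x$1 / r2 x - x$1 else if a = 2 then x$2 / r2 x - x$2 else - x$3)"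

lemma drift_nth [simp]:
  "drift x $ 1 = x$1 / r2 x - x$1" "drift x $ 2 = x$2 / r2 x - x$2" "drift x $ 3 = - x$3"
  by (simp_all add: drift_def)

text \<open>The derivative of |u|^2 in the direction of \<open>drift\<close>.\<close>

definition dflow :: "complex \<Rightarrow> complex^3 \<Rightarrow> real^3 \<Rightarrow> real" where
  "dflow u G x = (\<Sum>a\<in>UNIV. drift x $ a * (2 * Re (cnj u * G $ a)))"

lemma norm_drift:
  assumes "r2 x \<noteq> 0" shows "sq (drift x) = 1 / r2 x - 2 + sq x"
proof -
  have "sq (drift x) = r2 x * (1 / r2 x - 1)\<^sup>2 + (x$3)\<^sup>2"
  proof -
    have e: "(a / r - a)\<^sup>2 = a\<^sup>2 * (1 / r - 1)\<^sup>2" for a r :: real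
      by (simp add: power2_eq_square algebra_simps)
    have "(x$1)\<^sup>2 * q + (x$2)\<^sup>2 * q = r2 x * q" for q by (simp add: r2_def distrib_right)
    then show ?thesis unfolding norm_square_vec3 drift_nth power2_minus e[of "x$1"] e[of "x$2"] by simp
  qed
  also have "r2 x * (1 / r2 x - 1)\<^sup>2 = 1 / r2 x - 2 + r2 x"
    using assms by (simp add: power2_eq_square field_simps)
  finally show ?thesis by (simp add: norm_square_vec3 r2_def)
qed

text \<open>Lagrange's identity: the defect is the squared norm of the radial combination x1 G1 + x2
  G2.\<close>

lemma norm_current_le: "sq (current u G x) \<le> r2 x * (sq (G$1) + sq (G$2))"
proof -
  have "r2 x * (sq (G$1) + sq (G$2)) - sq (current u G x) = sq (x$1 *\<^sub>R G$1 + x$2 *\<^sub>R G$2)"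
    unfolding current_def r2_def cmod_power2 by (simp add: power2_eq_square algebra_simps)
  then show ?thesis using zero_le_power2[of "norm (x$1 *\<^sub>R G$1 + x$2 *\<^sub>R G$2)"] by linarith
qed

lemma kinetic_expand:
  "kinetic A u G x = sq G + 2 * (\<Sum>a\<in>UNIV. A x $ a * Im (cnj u * G $ a)) + sq (A x) * sq u"
proof -
  have *: "sq (- \<i> * g + of_real c * u) = sq g + 2 * (c * Im (cnj u * g)) + c\<^sup>2 * sq u" for g c
    unfolding cmod_power2 by (simp add: power2_eq_square algebra_simps)
  show ?thesis
    unfolding kinetic_def norm_square_cvec3 norm_square_vec3 vec_lambda_beta * sum_3 by (simp add: algebra_simps)
qed

lemma kinetic_flux:
  assumes "r2 x \<noteq> 0"
  shows "kinetic (\<lambda>x. s *\<^sub>R flux x) u G x =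
    sq G - s * Im (cnj u * current u G x) / r2 x + s\<^sup>2 / (4 * r2 x) * sq u"
proof -
  have 1: "sq (s *\<^sub>R flux x) = s\<^sup>2 / (4 * r2 x)"
    by (simp add: power_mult_distrib norm_flux[OF assms])
  have 2: "2 * (\<Sum>a\<in>UNIV. (s *\<^sub>R flux x) $ a * Im (cnj u * G $ a)) = - (s * Im (cnj u * current u G x) / r2 x)"
    using assms by (simp add: sum_3 current_def field_simps)
  show ?thesis unfolding kinetic_expand 1 2 by simp
qed

text \<open>Subtracting \<open>drift\<close> times \<open>u\<close> from the gradient leaves the
  angular derivative unchanged, since \<open>drift\<close> has no angular component. Hence |G -
  drift u|^2 still dominates the angular energy, and expanding it gives the claim.\<close>

lemma square_completion:
  assumes "r2 x \<noteq> 0"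
  shows "sq (current u G x) / r2 x + dflow u G x - sq (drift x) * sq u \<le> sq G"
proof -
  define P where "P = (\<chi> a. G$a - of_real (drift x $ a) * u)"
  have r: "r2 x > 0" using assms r2_nonneg[of x] by linarith
  have *: "sq (g - of_real c * u) = sq g - c * (2 * Re (cnj u * g)) + c\<^sup>2 * sq u" for g c
    unfolding cmod_power2 by (simp add: power2_eq_square algebra_simps)
  have n: "sq P = sq G - dflow u G x + sq (drift x) * sq u"
    unfolding P_def norm_square_cvec3 norm_square_vec3 vec_lambda_beta * dflow_def sum_3 by (simp add: algebra_simps)
  have "current u P x = current u G x"
    by (simp add: current_def P_def scaleR_conv_of_real algebra_simps)
  then have "sq (current u G x) \<le> r2 x * (sq (P$1) + sq (P$2))"
    using norm_current_le[of u P x] by simp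
  also have "\<dots> \<le> r2 x * sq P"
    unfolding norm_square_cvec3 by (intro mult_left_mono) auto
  finally have "sq (current u G x) / r2 x \<le> sq P"
    using r by (simp add: divide_le_eq mult.commute)
  then show ?thesis unfolding n by linarith
qed

section \<open>Integrability classes and integration by parts against the drift\<close>

definition C1_gradient :: "(real^3 \<Rightarrow> complex) \<Rightarrow> (real^3 \<Rightarrow> complex^3) \<Rightarrow> bool" where
  "C1_gradient u G \<longleftrightarrow> (\<forall>x. (u has_derivative (\<lambda>v. \<Sum>a\<in>UNIV. v$a *\<^sub>R G x$a)) (at x)) \<and> continuous_on UNIV G"

lemma C1_gradient_partial:
  assumes "(u has_derivative (\<lambda>v. \<Sum>a\<in>UNIV. v$a *\<^sub>R (G::complex^3)$a)) (at x)"
  shows "((\<lambda>t. u (x + t *\<^sub>R axis a 1)) has_vector_derivative G$a) (at 0)"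
proof -
  have 1: "((\<lambda>t. x + t *\<^sub>R axis a (1::real)) has_vector_derivative axis a 1) (at 0)"
    by (auto intro!: derivative_eq_intros)
  have 2: "(u has_derivative (\<lambda>v. \<Sum>a\<in>UNIV. v$a *\<^sub>R G$a)) (at (x + 0 *\<^sub>R axis a 1) within range (\<lambda>t. x + t *\<^sub>R axis a 1))"
    using assms by (simp add: has_derivative_at_withinI)
  have "(\<Sum>b\<in>UNIV. axis a (1::real) $ b *\<^sub>R G$b) = G$a"
  proof -
    have "(\<Sum>b\<in>UNIV. axis a (1::real) $ b *\<^sub>R G$b) = (\<Sum>b\<in>UNIV. if b = a then G$b else 0)"
      by (intro sum.cong) (auto simp: axis_def)
    then show ?thesis by simp
  qed
  with vector_derivative_diff_chain_within[OF 1 2] show ?thesis by (simp add: o_def)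
qed

lemma norm_square_has_derivative:
  assumes "((f::real \<Rightarrow> complex) has_vector_derivative f') (at t)"
  shows "((\<lambda>t. sq (f t)) has_vector_derivative 2 * Re (cnj (f t) * f')) (at t)"
proof -
  have "((\<lambda>t. Re (f t)) has_real_derivative Re f') (at t)" "((\<lambda>t. Im (f t)) has_real_derivative Im f') (at t)"
    using bounded_linear.has_vector_derivative[OF bounded_linear_Re assms] bounded_linear.has_vector_derivative[OF bounded_linear_Im assms]
    by (simp_all add: has_real_derivative_iff_has_vector_derivative)
  from DERIV_add[OF DERIV_power[OF this(1), of 2] DERIV_power[OF this(2), of 2]]
  have "((\<lambda>t. (Re (f t))\<^sup>2 + (Im (f t))\<^sup>2) has_real_derivative 2 * Re (cnj (f t) * f')) (at t)"
    by (rule DERIV_cong) (simp add: algebra_simps)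
  then show ?thesis by (simp add: cmod_power2 has_real_derivative_iff_has_vector_derivative)
qed

text \<open>The weight dominates the potential as well as the squares of \<open>drift\<close> and of
  the vector potential off the axis, up to constants; the summand 1 puts \<open>u\<close> into
  L^2.\<close>

definition weighted :: "(real^3 \<Rightarrow> complex) \<Rightarrow> bool" where
  "weighted u \<longleftrightarrow> u \<in> borel_measurable borel \<and>
     integrable lborel (\<lambda>x. (1 + 1 / r2 x + sq x) * sq (u x))"

text \<open>The common integrability test for the terms of the energy identity. A pointwise bound
  off the axis is enough because the axis is a null set.\<close>

lemma weighted_bound:
  fixes f :: "real^3 \<Rightarrow> real"
  assumes u: "weighted u" and G: "l2 G" and f: "f \<in> borel_measurable borel"
    and b: "\<And>x. r2 x \<noteq> 0 \<Longrightarrow> \<bar>f x\<bar> \<le> C * ((1 + 1 / r2 x + sq x) * sq (u x) + sq (G x))"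
  shows "integrable lborel f"
proof (rule Bochner_Integration.integrable_bound)
  show "integrable lborel (\<lambda>x. C * ((1 + 1 / r2 x + sq x) * sq (u x) + sq (G x)))"
    using u l2_integrable[OF G] by (auto simp: weighted_def)
  show "AE x in lborel. norm (f x) \<le> norm (C * ((1 + 1 / r2 x + sq x) * sq (u x) + sq (G x)))"
    using AE_r2_nonzero by eventually_elim (use b in \<open>auto intro: order_trans[OF _ abs_ge_self]\<close>)
qed (use f in simp)

lemma weighted_l2: assumes "weighted u" shows "l2 u"
proof -
  have "integrable lborel (\<lambda>x. sq (u x))"
    using assms
    by (intro weighted_bound[OF assms, of "\<lambda>_. 0 :: real" _ 1])
       (auto simp: weighted_def l2_def distrib_right intro!: add_nonneg_nonneg)
  with assms show ?thesis by (auto simp: l2_def weighted_def)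
qed

lemma young: "a * b \<le> a\<^sup>2 + b\<^sup>2" for a b :: real
proof -
  have "0 \<le> (a - b)\<^sup>2 + a\<^sup>2 + b\<^sup>2" by simp
  then show ?thesis by (simp add: power2_eq_square algebra_simps)
qed

lemma coordinate_bounds:
  assumes "r2 x \<noteq> 0"
  shows "\<bar>x$1 / r2 x\<bar> \<le> 1 / sqrt (r2 x)" "\<bar>x$2 / r2 x\<bar> \<le> 1 / sqrt (r2 x)"
    and "\<bar>x$i\<bar> \<le> norm x" "\<bar>drift x $ i\<bar> \<le> 1 / sqrt (r2 x) + norm x"
proof -
  have r: "r2 x > 0" using assms r2_nonneg[of x] by linarith
  have s: "r2 x = sqrt (r2 x) * sqrt (r2 x)" using r by simp
  have c: "\<bar>x$1\<bar> \<le> sqrt (r2 x)" "\<bar>x$2\<bar> \<le> sqrt (r2 x)"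
    by (auto simp: r2_def intro!: real_le_rsqrt)
  have q: "\<bar>c / r2 x\<bar> \<le> 1 / sqrt (r2 x)" if "\<bar>c\<bar> \<le> sqrt (r2 x)" for c
  proof -
    have "\<bar>c / r2 x\<bar> = \<bar>c\<bar> / r2 x" using r by simp
    also have "\<dots> \<le> sqrt (r2 x) / r2 x" using that r by (intro divide_right_mono) auto
    also have "\<dots> = 1 / sqrt (r2 x)" using r s by (simp add: field_simps)
    finally show ?thesis .
  qed
  show 1: "\<bar>x$1 / r2 x\<bar> \<le> 1 / sqrt (r2 x)" "\<bar>x$2 / r2 x\<bar> \<le> 1 / sqrt (r2 x)" using c q by auto
  show n: "\<bar>x$i\<bar> \<le> norm x" for i using component_le_norm_cart[of x i] by simp
  have "0 \<le> 1 / sqrt (r2 x)" using r by simp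
  moreover have "\<bar>c - d\<bar> \<le> 1 / sqrt (r2 x) + norm x" if "\<bar>c\<bar> \<le> 1 / sqrt (r2 x)" "\<bar>d\<bar> \<le> norm x" for c d
    using abs_triangle_ineq4[of c d] that by linarith
  moreover have "i = 1 \<or> i = 2 \<or> i = 3" using exhaust_3 by blast
  ultimately show "\<bar>drift x $ i\<bar> \<le> 1 / sqrt (r2 x) + norm x"
  proof (elim disjE)
    assume "i = 3"
    then have "\<bar>drift x $ i\<bar> = \<bar>x$3\<bar>" by (simp only: drift_nth abs_minus_cancel)
    with n[of 3] \<open>0 \<le> 1 / sqrt (r2 x)\<close> show ?thesis by linarith
  qed (use 1 n[of 1] n[of 2] in \<open>simp_all only: drift_nth\<close>)
qed

text \<open>Shaped for \<open>weighted_bound\<close>: \<open>g\<close> will be a component of the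
  gradient and \<open>B\<close> the norm of the whole gradient.\<close>

lemma drift_term_bound:
  assumes r: "r2 x \<noteq> 0"
  shows "\<bar>drift x $ a * (2 * Re (cnj u * g))\<bar> \<le> 4 * ((1 + 1 / r2 x + sq x) * sq u + sq g)"
    and "\<bar>drift x $ a * sq u\<bar> \<le> 4 * ((1 + 1 / r2 x + sq x) * sq u + B\<^sup>2)"
proof -
  have rp: "r2 x > 0" using r r2_nonneg[of x] by linarith
  let ?d = "1 / sqrt (r2 x) + norm x"
  have d2: "?d\<^sup>2 \<le> 2 * (1 / r2 x + sq x)"
  proof -
    have "?d\<^sup>2 \<le> 2 * (1 / sqrt (r2 x))\<^sup>2 + 2 * sq x"
      using zero_le_power2[of "1 / sqrt (r2 x) - norm x"] unfolding power2_diff power2_sum by linarith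
    then show ?thesis using rp by (simp add: power_divide)
  qed
  have *: "\<bar>drift x $ a\<bar> * norm u * b \<le> 2 * ((1 / r2 x + sq x) * sq u) + b\<^sup>2" if "0 \<le> b" for b
  proof -
    have "\<bar>drift x $ a\<bar> * norm u * b \<le> (?d * norm u) * b"
      using coordinate_bounds(4)[OF r, of a] that by (intro mult_right_mono) auto
    also have "\<dots> \<le> (?d * norm u)\<^sup>2 + b\<^sup>2" by (rule young)
    also have "(?d * norm u)\<^sup>2 \<le> 2 * ((1 / r2 x + sq x) * sq u)"
      unfolding power_mult_distrib mult.assoc[symmetric] by (intro mult_right_mono d2) auto
    finally show ?thesis by simp
  qed
  let ?w = "(1 / r2 x + sq x) * sq u"
  have w: "0 \<le> ?w" using rp by simp
  have e: "(1 + 1 / r2 x + sq x) * sq u = sq u + ?w" by (simp add: algebra_simps)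
  have "\<bar>Re (cnj u * g)\<bar> \<le> norm u * norm g"
    using abs_Re_le_cmod[of "cnj u * g"] by (simp add: norm_mult)
  then have "\<bar>drift x $ a\<bar> * \<bar>Re (cnj u * g)\<bar> \<le> \<bar>drift x $ a\<bar> * (norm u * norm g)"
    by (intro mult_left_mono) auto
  moreover have "\<bar>drift x $ a * (2 * Re (cnj u * g))\<bar> = 2 * (\<bar>drift x $ a\<bar> * \<bar>Re (cnj u * g)\<bar>)"
    by (simp only: abs_mult)
  moreover have "\<bar>drift x $ a\<bar> * (norm u * norm g) \<le> 2 * ?w + sq g"
    using *[of "norm g"] by (simp add: mult.assoc)
  ultimately have "\<bar>drift x $ a * (2 * Re (cnj u * g))\<bar> \<le> 2 * (2 * ?w + sq g)" by (smt (verit))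
  also have "\<dots> \<le> 4 * (sq u + ?w + sq g)" by simp
  finally show "\<bar>drift x $ a * (2 * Re (cnj u * g))\<bar> \<le> 4 * ((1 + 1 / r2 x + sq x) * sq u + sq g)"
    unfolding e .
  have "\<bar>drift x $ a * sq u\<bar> = \<bar>drift x $ a\<bar> * norm u * norm u" by (simp add: abs_mult power2_eq_square)
  also have "\<dots> \<le> 2 * ?w + sq u" by (rule *) simp
  also have "\<dots> \<le> 4 * (sq u + ?w + B\<^sup>2)" using w by (simp add: add_increasing2)
  finally show "\<bar>drift x $ a * sq u\<bar> \<le> 4 * ((1 + 1 / r2 x + sq x) * sq u + B\<^sup>2)"
    unfolding e .
qed

definition drift_partial :: "3 \<Rightarrow> real^3 \<Rightarrow> real" where
  "drift_partial a x = (if a = 1 then ((x$2)\<^sup>2 - (x$1)\<^sup>2) / (r2 x)\<^sup>2 - 1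
     else if a = 2 then ((x$1)\<^sup>2 - (x$2)\<^sup>2) / (r2 x)\<^sup>2 - 1 else - 1)"

text \<open>Off the axis (x1, x2)/r2 is the gradient of log r, which is harmonic in the plane, so
  only the summand -x of \<open>drift\<close> contributes to the divergence.\<close>

lemma drift_partial_sum: "r2 x \<noteq> 0 \<Longrightarrow> (\<Sum>a\<in>UNIV. drift_partial a x) = - 3"
  by (simp add: sum_3 drift_partial_def diff_divide_distrib)

lemma drift_partial_bound: assumes "r2 x \<noteq> 0" shows "\<bar>drift_partial a x\<bar> \<le> 1 + 1 / r2 x"
proof -
  have rp: "r2 x > 0" using assms r2_nonneg[of x] by linarith
  have "\<bar>c / (r2 x)\<^sup>2\<bar> \<le> 1 / r2 x" if "\<bar>c\<bar> \<le> r2 x" for c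
  proof -
    have "\<bar>c / (r2 x)\<^sup>2\<bar> \<le> r2 x / (r2 x)\<^sup>2" using that rp by (simp add: divide_right_mono)
    also have "\<dots> = 1 / r2 x" using rp by (simp add: power2_eq_square)
    finally show ?thesis .
  qed
  from this[of "(x$2)\<^sup>2 - (x$1)\<^sup>2"] this[of "(x$1)\<^sup>2 - (x$2)\<^sup>2"]
  have "\<bar>((x$2)\<^sup>2 - (x$1)\<^sup>2) / (r2 x)\<^sup>2\<bar> \<le> 1 / r2 x" "\<bar>((x$1)\<^sup>2 - (x$2)\<^sup>2) / (r2 x)\<^sup>2\<bar> \<le> 1 / r2 x"
    by (auto simp: r2_def abs_le_iff)
  moreover have "0 \<le> 1 / r2 x" using rp by simp
  ultimately show ?thesis unfolding drift_partial_def by (auto simp: abs_le_iff simp del: abs_divide)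
qed

lemma drift_has_partial:
  assumes "r2 x \<noteq> 0"
  shows "((\<lambda>t. drift (x + t *\<^sub>R axis a 1) $ a) has_real_derivative drift_partial a x) (at 0)"
proof -
  have "a = 1 \<or> a = 2 \<or> a = 3" using exhaust_3 by blast
  moreover have "((\<lambda>t. (p + t) / ((p + t)\<^sup>2 + q\<^sup>2) - (p + t)) has_real_derivative (q\<^sup>2 - p\<^sup>2) / (p\<^sup>2 + q\<^sup>2)\<^sup>2 - 1) (at 0)"
    if "p\<^sup>2 + q\<^sup>2 \<noteq> 0" for p q :: real
  proof -
    have "((\<lambda>t. (p + t) / ((p + t)\<^sup>2 + q\<^sup>2) - (p + t)) has_real_derivative
      (1 * ((p + 0)\<^sup>2 + q\<^sup>2) - (p + 0) * (2 * (p + 0))) / (((p + 0)\<^sup>2 + q\<^sup>2) * ((p + 0)\<^sup>2 + q\<^sup>2)) - 1) (at 0)"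
      using that by (auto intro!: derivative_eq_intros)
    then show ?thesis by (rule DERIV_cong) (simp add: power2_eq_square)
  qed
  from this[of "x$1" "x$2"] this[of "x$2" "x$1"]
  have "((\<lambda>t. (x$1 + t) / ((x$1 + t)\<^sup>2 + (x$2)\<^sup>2) - (x$1 + t)) has_real_derivative ((x$2)\<^sup>2 - (x$1)\<^sup>2) / (r2 x)\<^sup>2 - 1) (at 0)"
    "((\<lambda>t. (x$2 + t) / ((x$1)\<^sup>2 + (x$2 + t)\<^sup>2) - (x$2 + t)) has_real_derivative ((x$1)\<^sup>2 - (x$2)\<^sup>2) / (r2 x)\<^sup>2 - 1) (at 0)"
    using assms by (simp_all add: r2_def add.commute)
  moreover have "((\<lambda>t. - (x$3 + t)) has_real_derivative - 1) (at 0)" by (auto intro!: derivative_eq_intros)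
  ultimately show ?thesis
    by (auto simp: drift_partial_def r2_def axis_def)
qed

lemma drift_measurable[measurable]: "(\<lambda>x. drift x $ a) \<in> borel_measurable borel"
proof -
  note [measurable] = vec_nth_measurable[where 'a=real and 'n=3]
  have "a = 1 \<or> a = 2 \<or> a = 3" using exhaust_3 by blast
  then show ?thesis by (elim disjE; simp; measurable)
qed

lemma drift_partial_measurable[measurable]: "drift_partial a \<in> borel_measurable borel"
proof -
  note [measurable] = vec_nth_measurable[where 'a=real and 'n=3]
  show ?thesis unfolding drift_partial_def[abs_def] by measurable
qed

text \<open>Integration by parts in each coordinate: the derivatives of drift_a |u|^2 have integral
  0, and the divergence of \<open>drift\<close> is -3.\<close>

lemma integral_dflow:
  assumes uG: "C1_gradient u G" and u: "weighted u" and G: "l2 G"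
  shows "integrable lborel (\<lambda>x. dflow (u x) (G x) x)"
    and "(LBINT x. dflow (u x) (G x) x) = 3 * (LBINT x. sq (u x))"
proof -
  have der: "(u has_derivative (\<lambda>v. \<Sum>a\<in>UNIV. v$a *\<^sub>R G x$a)) (at x)" for x
    using uG by (auto simp: C1_gradient_def)
  have contG: "continuous_on S G" for S
    using uG by (auto simp: C1_gradient_def intro: continuous_on_subset)
  have contu: "continuous_on S u" for S
    using der by (intro continuous_at_imp_continuous_on ballI has_derivative_continuous) blast
  have [measurable]: "u \<in> borel_measurable borel" using u by (simp add: weighted_def)
  have [measurable]: "(\<lambda>x. Re (cnj (u x) * G x $ a)) \<in> borel_measurable borel" for a
    by (intro borel_measurable_continuous_onI continuous_intros contu contG)
  have Ga: "norm (G x $ a) \<le> norm (G x)" for x a by (rule norm_component_le)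
  have Ga2: "sq (G x $ a) \<le> sq (G x)" for x a by (intro power_mono Ga) auto
  let ?T = "\<lambda>a x. drift x $ a * (2 * Re (cnj (u x) * G x $ a))"
  let ?h = "\<lambda>a x. drift x $ a * sq (u x)"
  let ?S = "\<lambda>a x. drift_partial a x * sq (u x)"
  have iT: "integrable lborel (?T a)" for a
  proof (rule weighted_bound[OF u G, of _ 4])
    show "\<bar>?T a x\<bar> \<le> 4 * ((1 + 1 / r2 x + sq x) * sq (u x) + sq (G x))" if "r2 x \<noteq> 0" for x
      by (rule order_trans[OF drift_term_bound(1)[OF that]]) (simp add: Ga2)
  qed measurable
  have ih: "integrable lborel (?h a)" for a
    by (rule weighted_bound[OF u G, of _ 4]) (measurable, rule drift_term_bound(2))
  have iS: "integrable lborel (?S a)" for a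
  proof (rule weighted_bound[OF u G, of _ 1])
    fix x assume r: "r2 x \<noteq> 0"
    have "\<bar>?S a x\<bar> \<le> (1 + 1 / r2 x) * sq (u x)"
      unfolding abs_mult abs_power2 by (simp add: mult_right_mono[OF drift_partial_bound[OF r]])
    also have "\<dots> \<le> 1 * ((1 + 1 / r2 x + sq x) * sq (u x) + sq (G x))"
      by (simp add: distrib_right)
    finally show "\<bar>?S a x\<bar> \<le> 1 * ((1 + 1 / r2 x + sq x) * sq (u x) + sq (G x))" .
  qed measurable
  have zero: "(LBINT x. ?T a x + ?S a x) = 0" for a
  proof (rule integral_partial_derivative_zero[of "?h a" _ a])
    fix y assume r: "r2 y \<noteq> 0"
    have "((\<lambda>t. drift (y + t *\<^sub>R axis a 1) $ a * sq (u (y + t *\<^sub>R axis a 1))) has_vector_derivative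
      drift (y + 0 *\<^sub>R axis a 1) $ a *\<^sub>R (2 * Re (cnj (u (y + 0 *\<^sub>R axis a 1)) * G y $ a))
        + drift_partial a y *\<^sub>R sq (u (y + 0 *\<^sub>R axis a 1))) (at 0)"
      unfolding real_scaleR_def[symmetric, of "drift _ $ a"]
      by (intro has_vector_derivative_scaleR norm_square_has_derivative drift_has_partial r C1_gradient_partial der)
    then show "((\<lambda>t. ?h a (y + t *\<^sub>R axis a 1)) has_vector_derivative ?T a y + ?S a y) (at 0)" by simp
  next
    have c: "continuous_on {y. r2 y \<noteq> 0} (\<lambda>x. drift x $ a)" "continuous_on {y. r2 y \<noteq> 0} (drift_partial a)"
    proof -
      have "a = 1 \<or> a = 2 \<or> a = 3" using exhaust_3 by blast
      then show "continuous_on {y. r2 y \<noteq> 0} (\<lambda>x. drift x $ a)"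
        by (elim disjE; simp; auto intro!: continuous_intros)
      from \<open>a = 1 \<or> a = 2 \<or> a = 3\<close> show "continuous_on {y. r2 y \<noteq> 0} (drift_partial a)"
        unfolding drift_partial_def[abs_def] by (elim disjE; simp; auto intro!: continuous_intros)
    qed
    show "continuous_on {y. r2 y \<noteq> 0} (\<lambda>x. ?T a x + ?S a x)"
      by (intro continuous_intros c contu contG)
  qed (use ih iT iS in auto)
  have T: "(LBINT x. ?T a x) = - (LBINT x. ?S a x)" for a
    using zero[of a] iT[of a] iS[of a] by simp
  show "integrable lborel (\<lambda>x. dflow (u x) (G x) x)"
    unfolding dflow_def by (intro Bochner_Integration.integrable_sum iT)
  have "(LBINT x. dflow (u x) (G x) x) = (\<Sum>a\<in>UNIV. \<integral>x. ?T a x \<partial>lborel)"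
    unfolding dflow_def by (intro Bochner_Integration.integral_sum iT)
  also have "\<dots> = - (LBINT x. (\<Sum>a\<in>UNIV. ?S a x))"
    unfolding T by (subst Bochner_Integration.integral_sum) (auto simp: iS sum_negf)
  also have "(LBINT x. (\<Sum>a\<in>UNIV. ?S a x)) = (LBINT x. - 3 * sq (u x))"
    using AE_r2_nonzero
    by (intro integral_cong_AE) (auto simp: sum_distrib_right[symmetric] drift_partial_sum elim!: eventually_mono)
  finally show "(LBINT x. dflow (u x) (G x) x) = 3 * (LBINT x. sq (u x))" by simp
qed

text \<open>Up to a constant, \<open>weight s\<close> is the scalar potential for which \<open>psi0\<close> (defined below) is a
  ground state in the vector potential \<open>s *\<^sub>R flux\<close>.\<close>

definition weight :: "real \<Rightarrow> real^3 \<Rightarrow> real" where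
  "weight s x = sq x / 2 + (4 - s\<^sup>2) / (8 * r2 x)"

lemma weight_measurable[measurable]: "weight s \<in> borel_measurable borel"
  unfolding weight_def[abs_def] by measurable

lemma flux_measurable[measurable]: "(\<lambda>x. flux x $ a) \<in> borel_measurable borel"
proof -
  note [measurable] = vec_nth_measurable[where 'a=real and 'n=3]
  have "a = 1 \<or> a = 2 \<or> a = 3" using exhaust_3 by blast
  then show ?thesis by (elim disjE; simp; measurable)
qed

lemma kinetic_measurable[measurable]:
  assumes [measurable]: "u \<in> borel_measurable borel" "G \<in> borel_measurable borel" "\<And>a. (\<lambda>x. A x $ a) \<in> borel_measurable borel"
  shows "(\<lambda>x. kinetic A (u x) (G x) x) \<in> borel_measurable borel"
proof -
  from measurable_compose[OF assms(2) vec_nth_measurable]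
  have [measurable]: "(\<lambda>x. G x $ a) \<in> borel_measurable borel" for a .
  show ?thesis unfolding kinetic_def norm_square_cvec3 vec_lambda_beta by measurable
qed

text \<open>Off the axis the integrand is at least \<open>H + dflow + 2 |u|^2\<close>, with
  \<open>H\<close> the angular part. The integral of \<open>H\<close> is nonnegative by rotation
  averaging. The constant is 5 = 3 + 2: 3 from the divergence of \<open>drift\<close>, and 2 from
  the constant -2 in \<open>norm_drift\<close>.\<close>

lemma smooth_ground_state_inequality:
  assumes uG: "C1_gradient u G" and u: "weighted u" and G: "l2 G" and s: "0 \<le> s" "s \<le> 1"
  shows "5 * (LBINT x. sq (u x)) \<le>
    (LBINT x. kinetic (\<lambda>x. s *\<^sub>R flux x) (u x) (G x) x + 2 * weight s x * sq (u x))"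
proof -
  have der: "(u has_derivative (\<lambda>v. \<Sum>a\<in>UNIV. v$a *\<^sub>R G x$a)) (at x)" for x
    using uG by (auto simp: C1_gradient_def)
  have contG: "continuous_on S G" for S
    using uG by (auto simp: C1_gradient_def intro: continuous_on_subset)
  have contu: "continuous_on S u" for S
    using der by (intro continuous_at_imp_continuous_on ballI has_derivative_continuous) blast
  have [measurable]: "u \<in> borel_measurable borel" "G \<in> borel_measurable borel"
    using contu contG by (auto intro: borel_measurable_continuous_onI)
  have [measurable]: "(\<lambda>x. current (u x) (G x) x) \<in> borel_measurable borel"
    unfolding current_def by (intro borel_measurable_continuous_onI continuous_intros contG)
  have [measurable]: "(\<lambda>x. Im (cnj (u x) * current (u x) (G x) x)) \<in> borel_measurable borel"
    unfolding current_def by (intro borel_measurable_continuous_onI continuous_intros contG contu)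
  define H where "H x = 1 / r2 x * (sq (current (u x) (G x) x) - s * Im (cnj (u x) * current (u x) (G x) x))" for x
  define K where "K x = kinetic (\<lambda>x. s *\<^sub>R flux x) (u x) (G x) x + 2 * weight s x * sq (u x)" for x
  have [measurable]: "H \<in> borel_measurable borel" unfolding H_def by measurable
  have [measurable]: "K \<in> borel_measurable borel" 
  proof -
    have [measurable]: "(\<lambda>x. kinetic (\<lambda>x. s *\<^sub>R flux x) (u x) (G x) x) \<in> borel_measurable borel"
      by (rule kinetic_measurable) simp_all
    show ?thesis unfolding K_def by measurable
  qed
  let ?B = "\<lambda>x. (1 + 1 / r2 x + sq x) * sq (u x) + sq (G x)"
  have cur: "sq (current (u x) (G x) x) / r2 x \<le> sq (G x)"
    "\<bar>Im (cnj (u x) * current (u x) (G x) x) / r2 x\<bar> \<le> sq (u x) / r2 x + sq (G x)" if r: "r2 x \<noteq> 0" for x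
  proof -
    have rp: "r2 x > 0" using r r2_nonneg[of x] by linarith
    have "sq (current (u x) (G x) x) \<le> r2 x * sq (G x)"
      by (rule order_trans[OF norm_current_le]) (auto simp: norm_square_cvec3 intro!: mult_left_mono)
    then show 1: "sq (current (u x) (G x) x) / r2 x \<le> sq (G x)"
      using rp by (simp add: divide_le_eq mult.commute)
    have "\<bar>Im (cnj (u x) * current (u x) (G x) x)\<bar> \<le> norm (u x) * norm (current (u x) (G x) x)"
      using abs_Im_le_cmod[of "cnj (u x) * current (u x) (G x) x"] by (simp add: norm_mult)
    also have "\<dots> \<le> sq (u x) + sq (current (u x) (G x) x)" by (rule young)
    finally have "\<bar>Im (cnj (u x) * current (u x) (G x) x)\<bar> / r2 x \<le> (sq (u x) + sq (current (u x) (G x) x)) / r2 x"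
      using rp by (intro divide_right_mono) auto
    then show "\<bar>Im (cnj (u x) * current (u x) (G x) x) / r2 x\<bar> \<le> sq (u x) / r2 x + sq (G x)"
      using 1 rp by (simp add: add_divide_distrib)
  qed
  have iH: "integrable lborel H"
  proof (rule weighted_bound[OF u G, of _ 2])
    fix x assume r: "r2 x \<noteq> 0"
    have "\<bar>H x\<bar> \<le> sq (current (u x) (G x) x) / r2 x + \<bar>Im (cnj (u x) * current (u x) (G x) x) / r2 x\<bar>"
    proof -
      have "H x = sq (current (u x) (G x) x) / r2 x - s * (Im (cnj (u x) * current (u x) (G x) x) / r2 x)"
      proof -
        have "1 / r * (a - s * b) = a / r - s * (b / r)" for r a b :: real by (simp add: diff_divide_distrib)
        then show ?thesis unfolding H_def .
      qed
      moreover have "\<bar>s * (Im (cnj (u x) * current (u x) (G x) x) / r2 x)\<bar> \<le> 1 * \<bar>Im (cnj (u x) * current (u x) (G x) x) / r2 x\<bar>"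
        unfolding abs_mult using s by (intro mult_right_mono) auto
      moreover have "0 \<le> sq (current (u x) (G x) x) / r2 x" by simp
      ultimately show ?thesis by linarith
    qed
    also have "\<dots> \<le> sq (u x) / r2 x + 2 * sq (G x)" using cur[OF r] by linarith
    also have "\<dots> \<le> 2 * ?B x"
    proof -
      have e: "?B x = sq (u x) + sq (u x) / r2 x + sq x * sq (u x) + sq (G x)"
        by (simp add: algebra_simps)
      have "0 \<le> sq (u x) / r2 x" "0 \<le> sq x * sq (u x)" "0 \<le> sq (u x)" by auto
      then show ?thesis unfolding e by argo
    qed
    finally show "\<bar>H x\<bar> \<le> 2 * ?B x" .
  qed measurable
  have H0: "0 \<le> (LBINT x. H x)"
    unfolding H_def current_def
    by (rule integral_angular_nonneg[OF der contG s, of "\<lambda>x. 1 / r2 x"])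
       (use iH in \<open>auto simp: H_def[abs_def] current_def\<close>)
  have s2: "s\<^sup>2 \<le> 1" using power_mono[of s 1 2] s by simp
  \<comment> \<open>The diamagnetic term s^2 |u|^2 / (4 r2) cancels the dependence of
    \<open>weight\<close> on \<open>s\<close>.\<close>
  have Keq: "K x = (sq (G x) - s * Im (cnj (u x) * current (u x) (G x) x) / r2 x) + sq (u x) * (1 / r2 x + sq x)"
    if r: "r2 x \<noteq> 0" for x
    unfolding K_def kinetic_flux[OF r] weight_def using r by (simp add: field_simps)
  have iK: "integrable lborel K"
  proof (rule weighted_bound[OF u G, of _ 3])
    fix x assume r: "r2 x \<noteq> 0"
    have rp: "r2 x > 0" using r r2_nonneg[of x] by linarith
    have 1: "\<bar>s * (Im (cnj (u x) * current (u x) (G x) x) / r2 x)\<bar> \<le> 1 * \<bar>Im (cnj (u x) * current (u x) (G x) x) / r2 x\<bar>"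
      unfolding abs_mult using s by (intro mult_right_mono) auto
    have e: "K x = sq (G x) - s * (Im (cnj (u x) * current (u x) (G x) x) / r2 x) + sq (u x) / r2 x + sq (u x) * sq x"
      unfolding Keq[OF r] by (simp add: algebra_simps)
    have B: "?B x = sq (u x) + sq (u x) / r2 x + sq (u x) * sq x + sq (G x)"
      by (simp add: algebra_simps)
    have gen: "\<bar>a - q + b + c\<bar> \<le> 3 * (d + b + c + a)"
      if "\<bar>q\<bar> \<le> b + a" "0 \<le> a" "0 \<le> b" "0 \<le> c" "0 \<le> d" for a b c d q :: real
      using that by (smt (verit))
    show "\<bar>K x\<bar> \<le> 3 * ?B x"
      unfolding e B using 1 cur(2)[OF r] by (intro gen) auto
  qed measurable
  have iu: "integrable lborel (\<lambda>x. sq (u x))" using l2_integrable[OF weighted_l2[OF u]] .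
  note idf = integral_dflow[OF uG u G]
  have "(LBINT x. H x + dflow (u x) (G x) x + 2 * sq (u x)) \<le> (LBINT x. K x)"
  proof (rule integral_mono_AE)
    show "AE x in lborel. H x + dflow (u x) (G x) x + 2 * sq (u x) \<le> K x"
      using AE_r2_nonzero
    proof eventually_elim
      fix x assume r: "r2 x \<noteq> 0"
      have "H x = sq (current (u x) (G x) x) / r2 x - s * Im (cnj (u x) * current (u x) (G x) x) / r2 x"
        by (simp add: H_def diff_divide_distrib)
      moreover have "sq (drift x) * sq (u x) = sq (u x) * (1 / r2 x + sq x) - 2 * sq (u x)"
        unfolding norm_drift[OF r] by (simp add: algebra_simps)
      ultimately show "H x + dflow (u x) (G x) x + 2 * sq (u x) \<le> K x"
        using square_completion[OF r, of "u x" "G x"] unfolding Keq[OF r] by linarith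
    qed
  qed (use iH idf iu iK in auto)
  also have "(LBINT x. H x + dflow (u x) (G x) x + 2 * sq (u x))
    = (LBINT x. H x) + 5 * (LBINT x. sq (u x))"
    using iH idf iu by simp
  finally show ?thesis using H0 unfolding K_def by linarith
qed

section \<open>Weak gradients\<close>

text \<open>One-particle versions of \<open>test_function\<close> and \<open>weak_gradient\<close>.\<close>

definition test3 :: "(real^3 \<Rightarrow> real) \<Rightarrow> (3 \<Rightarrow> real^3 \<Rightarrow> real) \<Rightarrow> bool" where
  "test3 \<phi> D \<longleftrightarrow> continuous_on UNIV \<phi> \<and>
     (\<forall>a x. ((\<lambda>t. \<phi> (x + t *\<^sub>R axis a 1)) has_real_derivative D a x) (at 0)) \<and>
     (\<forall>a. continuous_on UNIV (D a)) \<and> (\<exists>R. \<forall>x. R < norm x \<longrightarrow> \<phi> x = 0)"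

definition weak_grad3 :: "(real^3 \<Rightarrow> complex) \<Rightarrow> (real^3 \<Rightarrow> complex^3) \<Rightarrow> bool" where
  "weak_grad3 \<psi> g \<longleftrightarrow> l2 \<psi> \<and> l2 g \<and>
     (\<forall>a \<phi> D. test3 \<phi> D \<longrightarrow>
        (LBINT x. \<psi> x * of_real (D a x)) = - (LBINT x. (g x $ a) * of_real (\<phi> x)))"

lemma l2_component: assumes "l2 (g :: real^3 \<Rightarrow> complex^3)" shows "l2 (\<lambda>x. g x $ a)"
proof -
  from measurable_compose[OF l2_measurable[OF assms] vec_nth_measurable] show ?thesis
    by (rule l2_bound[OF _ assms, of _ 1]) (simp add: norm_component_le)
qed

lemma vec_lambda_measurable:
  assumes [measurable]: "\<And>a. (\<lambda>x. f x $ a) \<in> borel_measurable borel"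
  shows "(f :: real^3 \<Rightarrow> complex^3) \<in> borel_measurable borel"
proof -
  have "f = (\<lambda>x. (f x $ 1) *s axis 1 1 + (f x $ 2) *s axis 2 1 + (f x $ 3) *s axis 3 1)"
    by (simp add: fun_eq_iff vec_eq_iff forall_3 axis_def)
  moreover have "(\<lambda>z. z *s axis i (1::complex) :: complex^3) \<in> borel_measurable borel" for i :: 3
  proof (rule borel_measurable_continuous_onI)
    have "continuous_on UNIV (\<lambda>z. \<chi> j. z * axis i (1::complex) $ j)"
      by (intro continuous_intros)
    then show "continuous_on UNIV (\<lambda>z. z *s axis i (1::complex) :: complex^3)"
      by (simp add: vector_scalar_mult_def)
  qed
  note [measurable] = measurable_compose[OF assms this]
  have "(\<lambda>x. (f x $ 1) *s axis 1 1 + (f x $ 2) *s axis 2 1 + (f x $ 3) *s axis 3 (1::complex) :: complex^3) \<in> borel_measurable borel"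
    by (intro borel_measurable_add) measurable
  ultimately show ?thesis by simp
qed

lemma l2_vec:
  assumes "\<And>a. l2 (\<lambda>x. f x $ a)"
  shows "l2 (f :: real^3 \<Rightarrow> complex^3)"
  unfolding l2_def norm_square_cvec3
  using assms[THEN l2_integrable] vec_lambda_measurable[OF assms[THEN l2_measurable]] by auto

lemma bump_has_derivative:
  fixes y :: "'a::euclidean_space"
  assumes e: "0 < e" "e \<le> 1"
  shows "(bump e has_derivative bump_deriv e y) (at y)"
proof (rule has_derivativeI_sandwich[of 1 _ _ y "bump e" "\<lambda>z. 27 * norm (z - y)"])
  show "bounded_linear (bump_deriv e y)"
    unfolding bump_deriv_def by (intro bounded_linear_intros)
  fix z assume z: "z \<noteq> y" "dist z y < 1"
  have "\<bar>bump e (y + (z - y)) - bump e y - bump_deriv e y (z - y)\<bar> \<le> 27 * sq (z - y) * indicator (cball 0 2) y"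
    using z by (intro bump_second_order e) (simp add: dist_norm)
  also have "\<dots> \<le> 27 * norm (z - y) * norm (z - y)"
    by (auto simp: indicator_def power2_eq_square)
  finally show "norm (bump e z - bump e y - bump_deriv e y (z - y)) / norm (z - y) \<le> 27 * norm (z - y)"
    using z by (simp add: divide_le_eq)
next
  have "((\<lambda>z. 27 * norm (z - y)) \<longlongrightarrow> 27 * norm (y - y)) (at y)" by (intro tendsto_intros)
  then show "((\<lambda>z. 27 * norm (z - y)) \<longlongrightarrow> 0) (at y)" by simp
qed auto

lemma test3_mollifier:
  fixes x :: "real^3"
  assumes e: "0 < e" "e \<le> 1"
  shows "test3 (\<lambda>y. mollifier e (y - x)) (\<lambda>a y. bump_deriv e (y - x) (axis a 1) / (LBINT y. bump e (y::real^3)))"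
  unfolding test3_def
proof (intro conjI allI)
  let ?Z = "\<integral>y. bump e (y::real^3) \<partial>lborel"
  show "continuous_on UNIV (\<lambda>y. mollifier e (y - x))"
    unfolding mollifier_def bump_def by (intro continuous_intros) (use integral_bump_pos[OF e(1), where 'a="real^3"] in \<open>simp_all add: bump_def\<close>)
  show "continuous_on UNIV (\<lambda>y. bump_deriv e (y - x) (axis a 1) / ?Z)" for a
    unfolding bump_deriv_def by (intro continuous_intros) (use integral_bump_pos[OF e(1), where 'a="real^3"] in simp_all)
  show "\<exists>R. \<forall>y. R < norm y \<longrightarrow> mollifier e (y - x) = 0"
  proof (intro exI allI impI)
    fix y :: "real^3" assume "1 + norm x < norm y"
    then have "1 \<le> norm (y - x)" using norm_triangle_ineq2[of y x] by linarith
    with e show "mollifier e (y - x) = 0" by (simp add: mollifier_def bump_zero)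
  qed
  fix a :: 3 and y :: "real^3"
  have 1: "((\<lambda>t. y + t *\<^sub>R axis a (1::real) - x) has_vector_derivative axis a 1) (at 0)"
    by (auto intro!: derivative_eq_intros)
  have 2: "(bump e has_derivative bump_deriv e (y - x)) (at (y + 0 *\<^sub>R axis a 1 - x) within range (\<lambda>t. y + t *\<^sub>R axis a 1 - x))"
    using bump_has_derivative[OF e, of "y - x"] by (simp add: has_derivative_at_withinI)
  have "((\<lambda>t. bump e (y + t *\<^sub>R axis a 1 - x)) has_real_derivative bump_deriv e (y - x) (axis a 1)) (at 0)"
    using vector_derivative_diff_chain_within[OF 1 2] by (simp add: o_def has_real_derivative_iff_has_vector_derivative)
  then show "((\<lambda>t. mollifier e (y + t *\<^sub>R axis a 1 - x)) has_real_derivative bump_deriv e (y - x) (axis a 1) / ?Z) (at 0)"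
    unfolding mollifier_def by (rule DERIV_cdivide)
qed

text \<open>The translated kernel is itself a test function, so the defining identity of the weak
  gradient says that mollification commutes with differentiation.\<close>

lemma mollify_weak_gradient:
  fixes x :: "real^3"
  assumes w: "weak_grad3 \<psi> g" and e: "0 < e" "e \<le> 1"
  shows "- (LBINT y. (bump_deriv e (y - x) (axis a 1) / (LBINT y. bump e (y::real^3))) *\<^sub>R \<psi> y)
    = mollify e (\<lambda>y. g y $ a) x"
proof -
  have "(LBINT y. \<psi> y * of_real (bump_deriv e (y - x) (axis a 1) / (LBINT y. bump e (y::real^3))))
     = - (LBINT y. (g y $ a) * of_real (mollifier e (y - x)))"
    using w test3_mollifier[OF e, of x] unfolding weak_grad3_def by blast
  then show ?thesis by (simp add: mollify_def scaleR_conv_of_real mult.commute)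
qed

lemma mollify_continuous:
  fixes f :: "'a::euclidean_space \<Rightarrow> complex"
  assumes "l2 f" "0 < e" "e \<le> 1" shows "continuous_on S (mollify e f)"
  using mollify_has_derivative[OF assms]
  by (intro continuous_at_imp_continuous_on ballI has_derivative_continuous)

lemma C1_gradient_mollify:
  assumes w: "weak_grad3 \<psi> g" and e: "0 < e" "e \<le> 1"
  shows "C1_gradient (mollify e \<psi>) (\<lambda>x. \<chi> a. mollify e (\<lambda>y. g y $ a) x)"
  unfolding C1_gradient_def
proof (intro conjI allI)
  have l: "l2 \<psi>" "l2 g" using w by (auto simp: weak_grad3_def)
  show "continuous_on UNIV (\<lambda>x. \<chi> a. mollify e (\<lambda>y. g y $ a) x)"
    by (intro continuous_on_vec_lambda mollify_continuous l2_component l e)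
  fix x
  define D where "D v = - (LBINT y. (bump_deriv e (y - x) v / (LBINT y. bump e (y::real^3))) *\<^sub>R \<psi> y)" for v
  have D: "(mollify e \<psi> has_derivative D) (at x)"
    unfolding D_def by (rule mollify_has_derivative[OF l(1) e])
  then have lin: "linear D" by (rule has_derivative_linear)
  have "D v = (\<Sum>a\<in>UNIV. v$a *\<^sub>R (\<chi> a. mollify e (\<lambda>y. g y $ a) x)$a)" for v
  proof -
    have "v = (\<Sum>a\<in>UNIV. v$a *\<^sub>R axis a 1)"
      by (simp add: vec_eq_iff forall_3 sum_3 axis_def)
    then have "D v = (\<Sum>a\<in>UNIV. v$a *\<^sub>R D (axis a 1))"
      by (metis (no_types, lifting) lin linear_scale linear_sum sum.cong)
    then show ?thesis by (simp add: D_def mollify_weak_gradient[OF w e])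
  qed
  with D show "(mollify e \<psi> has_derivative (\<lambda>v. \<Sum>a\<in>UNIV. v$a *\<^sub>R (\<chi> a. mollify e (\<lambda>y. g y $ a) x)$a)) (at x)"
    by (simp add: fun_eq_iff[symmetric] flip: fun_eq_iff) (metis (no_types, lifting) D ext)
qed

text \<open>Both candidates have the same mollifications, namely the derivatives of the mollified
  function, and these converge to each of them in L^2. This ties the gradient picked by the choice
  operator in \<open>wgrad\<close> to explicit formulas.\<close>

lemma weak_grad3_unique:
  assumes w: "weak_grad3 \<psi> g" "weak_grad3 \<psi> g'"
  shows "AE x in lborel. g x = g' x"
proof -
  have l: "l2 (\<lambda>x. g x $ a)" "l2 (\<lambda>x. g' x $ a)" for a
    using w by (auto simp: weak_grad3_def intro: l2_component)
  have "AE x in lborel. g x $ a = g' x $ a" for a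
  proof -
    let ?f = "\<lambda>x. g x $ a" and ?f' = "\<lambda>x. g' x $ a"
    let ?e = "\<lambda>n. inverse (real (Suc n))"
    have e: "0 < ?e n" "?e n \<le> 1" for n by (auto simp: divide_simps)
    have same: "mollify (?e n) ?f = mollify (?e n) ?f'" for n
      using mollify_weak_gradient[OF w(1) e[of n]] mollify_weak_gradient[OF w(2) e[of n]] by (simp add: fun_eq_iff)
    let ?m = "\<lambda>n. mollify (?e n) ?f"
    have lm: "l2 (?m n)" for n by (intro l2_mollify l e)
    have le: "(LBINT x. sq (?f x - ?f' x)) \<le> 2 * (LBINT x. sq (?m n x - ?f x)) + 2 * (LBINT x. sq (?m n x - ?f' x))" for n
    proof -
      note i = l2_integrable[OF l2_minus[OF lm[of n] l(1)[of a]]] l2_integrable[OF l2_minus[OF lm[of n] l(2)[of a]]]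
      have "(LBINT x. sq (?f x - ?f' x)) \<le> (LBINT x. 2 * sq (?m n x - ?f x) + 2 * sq (?m n x - ?f' x))"
      proof (rule integral_mono)
        show "sq (?f x - ?f' x) \<le> 2 * sq (?m n x - ?f x) + 2 * sq (?m n x - ?f' x)" for x
          using norm_add_square_le[of "?f x - ?m n x" "?m n x - ?f' x"] by (simp add: norm_minus_commute)
      qed (use i l2_integrable[OF l2_minus[OF l]] in auto)
      also have "\<dots> = 2 * (LBINT x. sq (?m n x - ?f x)) + 2 * (LBINT x. sq (?m n x - ?f' x))"
        using i by simp
      finally show ?thesis .
    qed
    have "(\<lambda>n. 2 * (LBINT x. sq (?m n x - ?f x)) + 2 * (LBINT x. sq (?m n x - ?f' x))) \<longlonglongrightarrow> 2 * 0 + 2 * 0"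
      using mollify_L2_tendsto[OF l(1)[of a]] mollify_L2_tendsto[OF l(2)[of a]] unfolding same[symmetric]
      by (intro tendsto_intros)
    from LIMSEQ_le_const[OF this] le have "(LBINT x. sq (?f x - ?f' x)) \<le> 0" by auto
    moreover have "0 \<le> (LBINT x. sq (?f x - ?f' x))" by simp
    ultimately have "(LBINT x. sq (?f x - ?f' x)) = 0" by linarith
    then have "AE x in lborel. sq (?f x - ?f' x) = 0"
      by (subst (asm) integral_nonneg_eq_0_iff_AE) (auto intro!: l2_integrable l2_minus l)
    then show ?thesis by simp
  qed
  from this[of 1] this[of 2] this[of 3] show ?thesis
    by eventually_elim (simp add: vec_eq_iff forall_3)
qed

section \<open>Cutoffs\<close>

text \<open>The first factor tames the singularity of \<open>flux\<close> on the axis, the second one the growth of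
  \<open>weight\<close> at infinity.\<close>

definition cutoff :: "real \<Rightarrow> real^3 \<Rightarrow> real" where
  "cutoff N x = (1 - 1 / (1 + N * r2 x)) * (1 / (1 + sq x / N))"

definition cutoff_grad :: "real \<Rightarrow> real^3 \<Rightarrow> real^3" where
  "cutoff_grad N x = (\<chi> a. (1 / (1 + sq x / N)) * (if a = 3 then 0 else 2 * N * x$a / (1 + N * r2 x)\<^sup>2)
     - (1 - 1 / (1 + N * r2 x)) * (2 / N * x$a / (1 + sq x / N)\<^sup>2))"

lemma cutoff_denominators:
  assumes "1 \<le> N" shows "0 < 1 + N * r2 x" "0 < 1 + sq x / N"
proof -
  have "0 \<le> N * r2 x" "0 \<le> sq x / N" using assms by auto
  then show "0 < 1 + N * r2 x" "0 < 1 + sq x / N" by linarith+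
qed

lemma cutoff_has_derivative:
  assumes N: "1 \<le> N"
  shows "(cutoff N has_derivative (\<lambda>v. \<Sum>a\<in>UNIV. v$a * cutoff_grad N x $ a)) (at x)"
proof -
  note q = cutoff_denominators[OF N, of x]
  have c: "((\<lambda>x::real^3. x$i) has_derivative (\<lambda>v. v$i)) (at x)" for i
    by (rule bounded_linear_imp_has_derivative[OF bounded_linear_vec_nth])
  have r: "(r2 has_derivative (\<lambda>v. 2 * (x$1 * v$1 + x$2 * v$2))) (at x)"
    unfolding r2_def[abs_def] by (rule has_derivative_eq_rhs, (rule derivative_intros c)+) (simp add: fun_eq_iff)
  have n: "((\<lambda>x. sq x) has_derivative (\<lambda>v. 2 * (x$1 * v$1 + x$2 * v$2 + x$3 * v$3))) (at x)"
    unfolding norm_square_vec3 by (rule has_derivative_eq_rhs, (rule derivative_intros c)+) (simp add: fun_eq_iff)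
  have inv: "((\<lambda>t. 1 / t) has_real_derivative - (1 / t\<^sup>2)) (at t)" if "0 < t" for t :: real
    using that by (auto intro!: derivative_eq_intros simp: power2_eq_square)
  have ch: "((\<lambda>x. 1 / f x) has_derivative (\<lambda>v. f' v * - (1 / (f x)\<^sup>2))) (at x)"
    if "(f has_derivative f') (at x)" "0 < f x" for f :: "real^3 \<Rightarrow> real" and f'
    using has_derivative_compose[OF that(1) inv[OF that(2), unfolded has_field_derivative_def]]
    by (simp add: mult.commute)
  have A: "((\<lambda>x. 1 - 1 / (1 + N * r2 x)) has_derivative
      (\<lambda>v. 0 - (0 + N * (2 * (x$1 * v$1 + x$2 * v$2))) * - (1 / (1 + N * r2 x)\<^sup>2))) (at x)"
    by (intro has_derivative_diff has_derivative_const ch has_derivative_add has_derivative_mult_right r q)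
  have B: "((\<lambda>x. 1 / (1 + sq x / N)) has_derivative
      (\<lambda>v. (0 + 2 * (x$1 * v$1 + x$2 * v$2 + x$3 * v$3) / N) * - (1 / (1 + sq x / N)\<^sup>2))) (at x)"
    by (intro ch has_derivative_const has_derivative_add bounded_linear.has_derivative[OF bounded_linear_divide] n q)
  show ?thesis unfolding cutoff_def[abs_def]
  proof (rule has_derivative_eq_rhs[OF has_derivative_mult[OF A B]])
    define Q P a b where "Q = 1 / (1 + N * r2 x)\<^sup>2" and "P = 1 / (1 + sq x / N)\<^sup>2"
      and "a = 1 - 1 / (1 + N * r2 x)" and "b = 1 / (1 + sq x / N)"
    have e: "cutoff_grad N x $ 1 = b * (2 * N * x$1 * Q) - a * (2 / N * x$1 * P)"
      "cutoff_grad N x $ 2 = b * (2 * N * x$2 * Q) - a * (2 / N * x$2 * P)"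
      "cutoff_grad N x $ 3 = b * 0 - a * (2 / N * x$3 * P)"
      by (simp_all add: cutoff_grad_def Q_def P_def a_def b_def)
    show "(\<lambda>v. (1 - 1 / (1 + N * r2 x)) * ((0 + 2 * (x$1 * v$1 + x$2 * v$2 + x$3 * v$3) / N) * - (1 / (1 + sq x / N)\<^sup>2))
      + (0 - (0 + N * (2 * (x$1 * v$1 + x$2 * v$2))) * - (1 / (1 + N * r2 x)\<^sup>2)) * (1 / (1 + sq x / N)))
      = (\<lambda>v. \<Sum>a\<in>UNIV. v$a * cutoff_grad N x $ a)"
      unfolding sum_3 e Q_def[symmetric] P_def[symmetric] a_def[symmetric] b_def[symmetric]
      by (simp add: fun_eq_iff algebra_simps add_divide_distrib)
  qed
qed

text \<open>The bounds that contain N make the cutoff energy continuous on L^2 at fixed N; the last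
  one is uniform in N and serves dominated convergence when the cutoff is removed.\<close>

lemma cutoff_bounds:
  assumes N: "1 \<le> N"
  shows "0 \<le> cutoff N x" "cutoff N x \<le> 1"
    and "(cutoff N x)\<^sup>2 * (1 + 1 / r2 x + sq x) \<le> 1 + 2 * N"
    and "sq (cutoff_grad N x) \<le> 8 * (N + 1)" "r2 x \<noteq> 0 \<Longrightarrow> sq (cutoff_grad N x) \<le> 8 * (1 / r2 x + 1)"
proof -
  define r R q p where "r = r2 x" and "R = sq x" and "q = 1 + N * r" and "p = 1 + R / N"
  have r: "0 \<le> r" "0 \<le> R" by (auto simp: r_def R_def)
  have q1: "1 \<le> q" "N * r \<le> q" and p1: "1 \<le> p" "R \<le> N * p"
    using N r by (auto simp: q_def p_def field_simps)
  have Nr: "0 \<le> N * r" using N r by simp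
  define a b where "a = 1 - 1 / q" and "b = 1 / p"
  have aq: "a = N * r / q" using q1 by (simp add: a_def q_def field_simps)
  have a: "0 \<le> a" "a \<le> 1" using q1 by (auto simp: a_def)
  have b: "0 \<le> b" "b \<le> 1" using p1 by (auto simp: b_def)
  have cutoff: "cutoff N x = a * b" by (simp add: cutoff_def a_def b_def q_def p_def r_def R_def)
  show "0 \<le> cutoff N x" "cutoff N x \<le> 1" unfolding cutoff using a b by (auto intro: mult_le_one)
  have a2: "a\<^sup>2 \<le> 1" "0 \<le> a\<^sup>2" and b2: "b\<^sup>2 \<le> 1" "0 \<le> b\<^sup>2"
    using power_mono[of a 1 2] power_mono[of b 1 2] a b by auto
  have pow: "q \<le> q\<^sup>2" "q\<^sup>2 \<le> q ^ 4" "p \<le> p\<^sup>2" "p\<^sup>2 \<le> p ^ 4"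
    using power_increasing[of 1 2 q] power_increasing[of 2 4 q] power_increasing[of 1 2 p] power_increasing[of 2 4 p] q1 p1 by auto
  have 1: "a\<^sup>2 * (1 / r) \<le> N"
  proof (cases "r = 0")
    case False
    with r have rp: "0 < r" by simp
    have "a\<^sup>2 * (1 / r) = N * ((N * r) / q\<^sup>2)"
      using rp by (simp add: aq power_divide power2_eq_square)
    also have "\<dots> \<le> N * 1" using q1 pow N by (intro mult_left_mono) (auto simp: divide_le_eq_1)
    finally show ?thesis by simp
  qed (use N in simp)
  have 2: "b\<^sup>2 * R \<le> N"
  proof -
    have "b\<^sup>2 * R = R / p\<^sup>2" by (simp add: b_def power_divide)
    also have "\<dots> \<le> N"
      using p1 pow N order_trans[OF p1(2), of "N * p\<^sup>2"] by (simp add: divide_le_eq mult_left_mono)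
    finally show ?thesis .
  qed
  have "(a * b)\<^sup>2 * (1 + 1 / r + R) = a\<^sup>2 * b\<^sup>2 + b\<^sup>2 * (a\<^sup>2 * (1 / r)) + a\<^sup>2 * (b\<^sup>2 * R)"
    by (simp add: power_mult_distrib algebra_simps)
  also have "\<dots> \<le> 1 * 1 + 1 * N + 1 * N"
    using a2 b2 1 2 N r by (intro add_mono mult_mono) auto
  finally show "(cutoff N x)\<^sup>2 * (1 + 1 / r2 x + sq x) \<le> 1 + 2 * N"
    by (simp add: cutoff r_def R_def)
  \<comment> \<open>\<open>al\<close> and \<open>- be\<close> are the gradients of the two factors
    \<open>a\<close> and \<open>b\<close>.\<close>
  define al :: "real^3" where "al = (\<chi> a. if a = 3 then 0 else 2 * N * x$a / q\<^sup>2)"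
  define be :: "real^3" where "be = (2 / (N * p\<^sup>2)) *\<^sub>R x"
  have "cutoff_grad N x = (\<chi> i. b * (if i = 3 then 0 else 2 * N * x$i / q\<^sup>2) - a * (2 / N * x$i / p\<^sup>2))"
    unfolding cutoff_grad_def a_def b_def q_def p_def r_def R_def by (rule refl)
  then have d: "cutoff_grad N x = b *\<^sub>R al + (- a) *\<^sub>R be"
    by (simp add: vec_eq_iff al_def be_def)
  have "sq (cutoff_grad N x) \<le> 2 * (b\<^sup>2 * sq al) + 2 * (a\<^sup>2 * sq be)"
    unfolding d using norm_add_square_le[of "b *\<^sub>R al" "(- a) *\<^sub>R be"] by (simp add: power_mult_distrib)
  also have "\<dots> \<le> 2 * (1 * sq al) + 2 * (1 * sq be)"
    using a2 b2 by (intro add_mono mult_left_mono mult_right_mono) auto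
  finally have dle: "sq (cutoff_grad N x) \<le> 2 * sq al + 2 * sq be" by simp
  have al: "sq al = 4 * (N\<^sup>2 * r / q ^ 4)"
    by (simp add: norm_square_vec3 al_def r_def r2_def power_mult_distrib power_divide add_divide_distrib[symmetric] algebra_simps flip: power_mult)
  have be: "sq be = 4 * (R / (N\<^sup>2 * p ^ 4))"
    by (simp add: be_def R_def power_mult_distrib power_divide flip: power_mult)
  have "R \<le> N\<^sup>2 * p ^ 4"
  proof -
    have "R \<le> N * p" by (rule p1)
    also have "\<dots> \<le> N\<^sup>2 * p ^ 4"
      using N p1 pow power_increasing[of 1 2 N] by (intro mult_mono) auto
    finally show ?thesis .
  qed
  then have be4: "sq be \<le> 4" 
  proof -
    have "0 < N\<^sup>2 * p ^ 4" using N p1 by simp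
    with \<open>R \<le> N\<^sup>2 * p ^ 4\<close> have "R / (N\<^sup>2 * p ^ 4) \<le> 1" by (simp add: divide_le_eq_1)
    then show ?thesis unfolding be by linarith
  qed
  have "N\<^sup>2 * r / q ^ 4 \<le> N"
  proof -
    have "N * (N * r) \<le> N * q ^ 4" using N q1 pow by (intro mult_left_mono) auto
    then show ?thesis using q1 by (simp add: divide_le_eq power2_eq_square mult.assoc)
  qed
  then have "sq al \<le> 4 * N" unfolding al by simp
  with dle be4 show "sq (cutoff_grad N x) \<le> 8 * (N + 1)" by simp
  assume "r2 x \<noteq> 0"
  with r have rp: "0 < r" unfolding r_def by linarith
  have "(N * r)\<^sup>2 \<le> q ^ 4"
    using power_mono[OF q1(2) Nr, of 2] pow by linarith
  then have "N\<^sup>2 * r / q ^ 4 \<le> 1 / r"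
    using rp q1 by (simp add: divide_simps power2_eq_square mult.assoc mult.left_commute)
  then have "sq al \<le> 4 * (1 / r)" unfolding al by (intro mult_left_mono) auto
  with dle be4 show "sq (cutoff_grad N x) \<le> 8 * (1 / r2 x + 1)" by (simp add: r_def)
qed

lemma cutoff_tendsto:
  assumes "r2 x \<noteq> 0"
  shows "(\<lambda>n. cutoff (real (Suc n)) x) \<longlonglongrightarrow> 1" "(\<lambda>n. cutoff_grad (real (Suc n)) x $ a) \<longlonglongrightarrow> 0"
proof -
  let ?i = "\<lambda>n. inverse (real (Suc n))"
  define r where "r = r2 x"
  have r: "0 < r" using assms r2_nonneg[of x] unfolding r_def by linarith
  have i: "?i \<longlonglongrightarrow> 0" by (rule LIMSEQ_inverse_real_of_nat)
  \<comment> \<open>Rewritten in terms of 1/N, every limit below is continuity at 0.\<close>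
  have e1: "1 / (1 + N * r) = inverse N / (inverse N + r)" and e2: "1 / (1 + sq x / N) = 1 / (1 + sq x * inverse N)"
    and e3: "2 * N * c / (1 + N * r)\<^sup>2 = 2 * inverse N * c / (inverse N + r)\<^sup>2" if "0 < N" for N c
  proof -
    have "1 + N * r = N * (inverse N + r)" using that by (simp add: distrib_left)
    then show "1 / (1 + N * r) = inverse N / (inverse N + r)" "2 * N * c / (1 + N * r)\<^sup>2 = 2 * inverse N * c / (inverse N + r)\<^sup>2"
      using that by (simp_all add: power_mult_distrib power2_eq_square field_simps)
  qed (simp add: divide_inverse)
  have N: "0 < real (Suc n)" for n by simp
  have "(\<lambda>n. (1 - ?i n / (?i n + r)) * (1 / (1 + sq x * ?i n))) \<longlonglongrightarrow> (1 - 0 / (0 + r)) * (1 / (1 + sq x * 0))"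
    using r by (intro tendsto_intros i) auto
  then show "(\<lambda>n. cutoff (real (Suc n)) x) \<longlonglongrightarrow> 1"
    unfolding cutoff_def r_def[symmetric] e1[OF N] e2[OF N] by simp
  define F where "F n = (1 / (1 + sq x * ?i n)) * (if a = 3 then 0 else 2 * ?i n * x$a / (?i n + r)\<^sup>2)
     - (1 - ?i n / (?i n + r)) * (2 * ?i n * x$a / (1 + sq x * ?i n)\<^sup>2)" for n
  have L1: "(\<lambda>n. 1 / (1 + sq x * ?i n)) \<longlonglongrightarrow> 1 / (1 + sq x * 0)"
    by (intro tendsto_intros i) simp
  have "(\<lambda>n. 2 * ?i n * x$a / (?i n + r)\<^sup>2) \<longlonglongrightarrow> 2 * 0 * x$a / (0 + r)\<^sup>2"
    using r by (intro tendsto_intros i) simp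
  then have L2: "(\<lambda>n. if a = 3 then 0 else 2 * ?i n * x$a / (?i n + r)\<^sup>2) \<longlonglongrightarrow> 0"
    by (cases "a = 3") simp_all
  have L3: "(\<lambda>n. 1 - ?i n / (?i n + r)) \<longlonglongrightarrow> 1 - 0 / (0 + r)"
    using r by (intro tendsto_intros i) simp
  have L4: "(\<lambda>n. 2 * ?i n * x$a / (1 + sq x * ?i n)\<^sup>2) \<longlonglongrightarrow> 2 * 0 * x$a / (1 + sq x * 0)\<^sup>2"
    by (intro tendsto_intros i) simp
  from tendsto_diff[OF tendsto_mult[OF L1 L2] tendsto_mult[OF L3 L4]]
  have "F \<longlonglongrightarrow> (1 / (1 + sq x * 0)) * 0 - (1 - 0 / (0 + r)) * (2 * 0 * x$a / (1 + sq x * 0)\<^sup>2)"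
    unfolding F_def[abs_def] .
  then have "F \<longlonglongrightarrow> 0" by simp
  moreover have "cutoff_grad (real (Suc n)) x $ a = F n" for n
    unfolding cutoff_grad_def vec_lambda_beta r_def[symmetric] e1[OF N] e3[OF N] F_def
    by (simp only: divide_inverse)
  ultimately show "(\<lambda>n. cutoff_grad (real (Suc n)) x $ a) \<longlonglongrightarrow> 0" by simp
qed

lemma cutoff_measurable[measurable]:
  "cutoff N \<in> borel_measurable borel" "(\<lambda>x. cutoff_grad N x $ a) \<in> borel_measurable borel"
proof -
  note [measurable] = vec_nth_measurable[where 'a=real and 'n=3]
  show "cutoff N \<in> borel_measurable borel" unfolding cutoff_def[abs_def] by measurable
  show "(\<lambda>x. cutoff_grad N x $ a) \<in> borel_measurable borel" unfolding cutoff_grad_def vec_lambda_beta by measurable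
qed

definition cutoff_gradient :: "real \<Rightarrow> complex \<Rightarrow> complex^3 \<Rightarrow> real^3 \<Rightarrow> complex^3" where
  "cutoff_gradient N v g x = (\<chi> a. cutoff N x *\<^sub>R g$a + cutoff_grad N x $ a *\<^sub>R v)"

lemma norm_cutoff_gradient: "sq (cutoff_gradient N v g x) \<le> 2 * ((cutoff N x)\<^sup>2 * sq g) + 2 * (sq (cutoff_grad N x) * sq v)"
proof -
  have "sq (cutoff N x *\<^sub>R g$a + cutoff_grad N x $ a *\<^sub>R v) \<le> 2 * ((cutoff N x)\<^sup>2 * sq (g$a)) + 2 * ((cutoff_grad N x $ a)\<^sup>2 * sq v)" for a
    using norm_add_square_le[of "cutoff N x *\<^sub>R g$a" "cutoff_grad N x $ a *\<^sub>R v"] by (simp add: power_mult_distrib)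
  from add_mono[OF add_mono[OF this[of 1] this[of 2]] this[of 3]] show ?thesis
    unfolding cutoff_gradient_def norm_square_cvec3 norm_square_vec3 vec_lambda_beta by (simp add: algebra_simps)
qed

lemma kinetic_flux_le:
  assumes r: "r2 x \<noteq> 0" and s: "0 \<le> s" "s \<le> 1"
  shows "kinetic (\<lambda>x. s *\<^sub>R flux x) u G x \<le> 2 * sq G + sq u / r2 x"
proof -
  have rp: "r2 x > 0" using r r2_nonneg[of x] by linarith
  have "sq (- \<i> * G $ a + of_real ((s *\<^sub>R flux x) $ a) * u) \<le> 2 * sq (G $ a) + 2 * (((s *\<^sub>R flux x) $ a)\<^sup>2 * sq u)" for a
    using norm_add_square_le[of "- \<i> * G $ a" "of_real ((s *\<^sub>R flux x) $ a) * u"] by (simp add: norm_mult power_mult_distrib)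
  from add_mono[OF add_mono[OF this[of 1] this[of 2]] this[of 3]]
  have "kinetic (\<lambda>x. s *\<^sub>R flux x) u G x \<le> 2 * sq G + 2 * (sq (s *\<^sub>R flux x) * sq u)"
    unfolding kinetic_def norm_square_cvec3 norm_square_vec3 vec_lambda_beta by (simp add: algebra_simps)
  also have "sq (s *\<^sub>R flux x) * sq u \<le> 1 / (4 * r2 x) * sq u"
  proof (rule mult_right_mono)
    have "s\<^sup>2 * (1 / (4 * r2 x)) \<le> 1 * (1 / (4 * r2 x))"
      using power_mono[of s 1 2] s rp by (intro mult_right_mono) auto
    then show "sq (s *\<^sub>R flux x) \<le> 1 / (4 * r2 x)" by (simp add: power_mult_distrib norm_flux[OF r])
  qed simp
  also have "2 * sq G + 2 * (1 / (4 * r2 x) * sq u) \<le> 2 * sq G + sq u / r2 x"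
    using rp by (simp add: field_simps)
  finally show ?thesis by simp
qed

lemma weight_bounds:
  assumes s: "0 \<le> s" "s \<le> 1"
  shows "0 \<le> weight s x" "2 * weight s x \<le> 1 / r2 x + sq x"
proof -
  have s2: "s\<^sup>2 \<le> 1" "0 \<le> s\<^sup>2" using power_mono[of s 1 2] s by auto
  then show "0 \<le> weight s x" by (simp add: weight_def)
  have g: "2 * (a / (8 * r)) = a / (4 * r)" for a r :: real by (cases "r = 0") (auto simp: field_simps)
  have "2 * weight s x = sq x + (4 - s\<^sup>2) / (4 * r2 x)"
    unfolding weight_def distrib_left g by simp
  also have "(4 - s\<^sup>2) / (4 * r2 x) \<le> 4 / (4 * r2 x)" using s2 by (intro divide_right_mono) auto
  finally show "2 * weight s x \<le> 1 / r2 x + sq x" by simp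
qed

text \<open>A weighted Young inequality bounds | |a|^2 - |b|^2 | by (1 + 1/d) |a - b|^2 + d |b|^2.
  The small \<open>d\<close> is fixed first and the convergence handles the other term.\<close>

lemma L2_norm_tendsto:
  fixes f :: "nat \<Rightarrow> 'a::euclidean_space \<Rightarrow> 'b::euclidean_space"
  assumes f: "\<And>n. l2 (f n)" and g: "l2 g" and lim: "(\<lambda>n. \<integral>x. sq (f n x - g x) \<partial>lborel) \<longlonglongrightarrow> 0"
  shows "(\<lambda>n. \<integral>x. sq (f n x) \<partial>lborel) \<longlonglongrightarrow> (LBINT x. sq (g x))"
proof (rule LIMSEQ_I)
  fix r :: real assume r: "0 < r"
  define M where "M = (LBINT x. sq (g x))"
  have M: "0 \<le> M" by (simp add: M_def)
  \<comment> \<open>Makes d M at most r/2; the added 1 covers M = 0.\<close>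
  define d where "d = r / (2 * (M + 1))"
  have d: "0 < d" using r M by (simp add: d_def)
  have dM: "d * M \<le> r / 2" using r M by (simp add: d_def field_simps)
  have pw: "\<bar>sq a - sq b\<bar> \<le> (1 + 1 / d) * sq (a - b) + d * sq b" for a b :: 'b
  proof -
    let ?c = "norm (a - b)"
    have 1: "\<bar>norm a - norm b\<bar> \<le> ?c" by (rule norm_triangle_ineq3)
    have "sq a - sq b = (norm a - norm b)\<^sup>2 + 2 * norm b * (norm a - norm b)"
      by (simp add: power2_eq_square algebra_simps)
    then have "\<bar>sq a - sq b\<bar> \<le> (norm a - norm b)\<^sup>2 + 2 * norm b * \<bar>norm a - norm b\<bar>"
      by (metis (no_types, opaque_lifting) abs_mult abs_norm_cancel abs_numeral abs_power2 abs_triangle_ineq)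
    also have "\<dots> \<le> ?c\<^sup>2 + 2 * norm b * ?c"
      using 1 power_mono[OF 1, of 2] by (intro add_mono mult_left_mono) auto
    also have "2 * norm b * ?c \<le> 1 / d * ?c\<^sup>2 + d * sq b"
    proof -
      have "0 \<le> (?c - d * norm b)\<^sup>2 / d" using d by simp
      also have "\<dots> = 1 / d * ?c\<^sup>2 + d * sq b - 2 * norm b * ?c"
        using d by (simp add: power2_eq_square field_simps)
      finally show ?thesis by simp
    qed
    finally show ?thesis by (simp add: algebra_simps)
  qed
  have "\<bar>(LBINT x. sq (f n x)) - M\<bar> \<le> (1 + 1 / d) * (LBINT x. sq (f n x - g x)) + d * M" for n
  proof -
    note i = l2_integrable[OF f[of n]] l2_integrable[OF g] l2_integrable[OF l2_minus[OF f[of n] g]]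
    have "(LBINT x. sq (f n x)) - M = (LBINT x. sq (f n x) - sq (g x))"
      using i by (simp add: M_def)
    also have "\<bar>\<dots>\<bar> \<le> (LBINT x. \<bar>sq (f n x) - sq (g x)\<bar>)"
      using integral_norm_bound[of lborel "\<lambda>x. sq (f n x) - sq (g x)"] by simp
    also have "\<dots> \<le> (LBINT x. (1 + 1 / d) * sq (f n x - g x) + d * sq (g x))"
      using i by (intro integral_mono pw) auto
    also have "\<dots> = (1 + 1 / d) * (LBINT x. sq (f n x - g x)) + d * M"
      using i by (simp add: M_def)
    finally show ?thesis .
  qed
  note bnd = this
  have "(\<lambda>n. (1 + 1 / d) * (LBINT x. sq (f n x - g x))) \<longlonglongrightarrow> (1 + 1 / d) * 0"
    by (intro tendsto_intros lim)
  then have "eventually (\<lambda>n. (1 + 1 / d) * (LBINT x. sq (f n x - g x)) < r / 2) sequentially"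
    using r by (intro order_tendstoD(2)) auto
  then obtain N where N: "\<And>n. N \<le> n \<Longrightarrow> (1 + 1 / d) * (LBINT x. sq (f n x - g x)) < r / 2"
    by (auto simp: eventually_sequentially)
  show "\<exists>N. \<forall>n\<ge>N. norm ((LBINT x. sq (f n x)) - (LBINT x. sq (g x))) < r"
    unfolding M_def[symmetric] real_norm_def
  proof (intro exI[of _ N] allI impI)
    fix n assume "N \<le> n"
    from N[OF this] bnd[of n] dM show "\<bar>(LBINT x. sq (f n x)) - M\<bar> < r" by linarith
  qed
qed

section \<open>The ground state inequality for weakly differentiable functions\<close>

text \<open>The two sides of the inequality become squared \<open>L\<^sup>2\<close> norms of expressions linear in \<open>(v, g)\<close>, so they
  are continuous under mollification.\<close>

definition energy_field :: "real \<Rightarrow> real \<Rightarrow> complex \<Rightarrow> complex^3 \<Rightarrow> real^3 \<Rightarrow> (complex^3) \<times> complex" where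
  "energy_field N s v g x =
     ((\<chi> a. - \<i> * (cutoff_gradient N v g x $ a) + of_real ((s *\<^sub>R flux x) $ a) * (cutoff N x *\<^sub>R v)),
      sqrt (2 * weight s x) *\<^sub>R cutoff N x *\<^sub>R v)"

lemma norm_energy_field:
  assumes "0 \<le> s" "s \<le> 1"
  shows "sq (energy_field N s v g x) =
    kinetic (\<lambda>x. s *\<^sub>R flux x) (cutoff N x *\<^sub>R v) (cutoff_gradient N v g x) x + 2 * weight s x * sq (cutoff N x *\<^sub>R v)"
  using weight_bounds(1)[OF assms, of x]
  by (simp add: energy_field_def norm_Pair kinetic_def power_mult_distrib)

lemma energy_field_diff:
  "energy_field N s v g x - energy_field N s v' g' x = energy_field N s (v - v') (g - g') x"
  by (simp add: energy_field_def cutoff_gradient_def vec_eq_iff scaleR_diff_right algebra_simps)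

text \<open>Two regimes again: the first bound is uniform in N and provides the dominating function
  as the cutoff is removed; the second involves no weight and gives L^2 continuity for fixed
  N.\<close>

lemma energy_field_le:
  assumes N: "1 \<le> N" and r: "r2 x \<noteq> 0" and s: "0 \<le> s" "s \<le> 1"
  shows "sq (energy_field N s v g x) \<le> 36 * ((1 + 1 / r2 x + sq x) * sq v + sq g)"
    and "sq (energy_field N s v g x) \<le> 100 * N * (sq v + sq g)"
proof -
  have rp: "0 < r2 x" using r r2_nonneg[of x] by linarith
  let ?c = "(cutoff N x)\<^sup>2" and ?V = "sq v" and ?g = "sq g"
  note cb = cutoff_bounds[OF N, of x]
  have c1: "0 \<le> ?c" "?c \<le> 1" using power_mono[of "cutoff N x" 1 2] cb by auto
  have cv: "sq (cutoff N x *\<^sub>R v) = ?c * ?V" by (simp add: power_mult_distrib)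
  have "sq (energy_field N s v g x) \<le> (2 * sq (cutoff_gradient N v g x) + ?c * ?V / r2 x) + (1 / r2 x + sq x) * (?c * ?V)"
    unfolding norm_energy_field[OF s] cv[symmetric]
    by (intro add_mono kinetic_flux_le r s mult_right_mono weight_bounds) auto
  also have "\<dots> \<le> (2 * (2 * (?c * ?g) + 2 * (sq (cutoff_grad N x) * ?V)) + ?c * ?V / r2 x) + (1 / r2 x + sq x) * (?c * ?V)"
    by (intro add_mono mult_left_mono norm_cutoff_gradient) auto
  also have "\<dots> = 4 * (?c * ?g) + 4 * (sq (cutoff_grad N x) * ?V) + (?c * (2 / r2 x + sq x)) * ?V"
    by (simp add: algebra_simps)
  finally have main: "sq (energy_field N s v g x) \<le>
    4 * (?c * ?g) + 4 * (sq (cutoff_grad N x) * ?V) + (?c * (2 / r2 x + sq x)) * ?V" .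
  have cg: "?c * ?g \<le> ?g" using c1 by (simp add: mult_left_le_one_le)
  have nn: "0 \<le> 2 / r2 x + sq x" using rp by simp
  note main
  also have "4 * (?c * ?g) + 4 * (sq (cutoff_grad N x) * ?V) + (?c * (2 / r2 x + sq x)) * ?V
    \<le> 4 * ?g + 4 * ((8 * (1 / r2 x + 1)) * ?V) + (1 * (2 / r2 x + sq x)) * ?V"
    using cg c1 nn cb(5)[OF r] by (intro add_mono mult_left_mono mult_right_mono) auto
  also have "\<dots> = 4 * ?g + 32 * ?V + 34 * (?V / r2 x) + sq x * ?V" by (simp add: algebra_simps)
  also have "\<dots> \<le> 36 * ?g + 36 * ?V + 36 * (?V / r2 x) + 36 * (sq x * ?V)"
    using rp by (intro add_mono mult_right_mono) auto
  also have "\<dots> = 36 * ((1 + 1 / r2 x + sq x) * ?V + ?g)" by (simp add: algebra_simps)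
  finally show "sq (energy_field N s v g x) \<le> 36 * ((1 + 1 / r2 x + sq x) * ?V + ?g)" .
  have "?c * (2 / r2 x + sq x) \<le> 2 * (?c * (1 + 1 / r2 x + sq x))"
    using c1 by (simp add: algebra_simps)
  also have "\<dots> \<le> 2 * (1 + 2 * N)" using cb(3) by simp
  finally have c3: "?c * (2 / r2 x + sq x) \<le> 2 * (1 + 2 * N)" .
  note main
  also have "4 * (?c * ?g) + 4 * (sq (cutoff_grad N x) * ?V) + (?c * (2 / r2 x + sq x)) * ?V
    \<le> 4 * ?g + 4 * ((8 * (N + 1)) * ?V) + (2 * (1 + 2 * N)) * ?V"
    using cg c3 cb(4) by (intro add_mono mult_left_mono mult_right_mono) auto
  also have "\<dots> = 4 * ?g + (34 + 36 * N) * ?V" by (simp add: algebra_simps)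
  also have "\<dots> \<le> (100 * N) * ?g + (100 * N) * ?V" using N by (intro add_mono mult_right_mono) auto
  also have "\<dots> = 100 * N * (?V + ?g)" by (simp add: algebra_simps)
  finally show "sq (energy_field N s v g x) \<le> 100 * N * (?V + ?g)" .
qed

lemma C1_gradient_cutoff:
  assumes u: "C1_gradient v g" and N: "1 \<le> N"
  shows "C1_gradient (\<lambda>x. cutoff N x *\<^sub>R v x) (\<lambda>x. cutoff_gradient N (v x) (g x) x)"
  unfolding C1_gradient_def
proof (intro conjI allI)
  have der: "(v has_derivative (\<lambda>w. \<Sum>a\<in>UNIV. w$a *\<^sub>R g x$a)) (at x)" for x
    using u by (auto simp: C1_gradient_def)
  have contv: "continuous_on UNIV v"
    using der by (intro continuous_at_imp_continuous_on ballI has_derivative_continuous) blast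
  have contg: "continuous_on UNIV g" using u by (simp add: C1_gradient_def)
  note q = cutoff_denominators[OF N]
  have c1: "continuous_on UNIV (cutoff N)"
    using cutoff_has_derivative[OF N] by (intro continuous_at_imp_continuous_on ballI has_derivative_continuous) blast
  have c2: "continuous_on UNIV (\<lambda>x. cutoff_grad N x $ a)" for a
  proof -
    have "1 + N * r2 x \<noteq> 0" "1 + sq x / N \<noteq> 0" "N \<noteq> 0" for x using q[of x] N by auto
    then show ?thesis unfolding cutoff_grad_def vec_lambda_beta
      by (cases "a = 3") (simp_all only: if_True if_False, (intro continuous_intros, auto)+)
  qed
  have c3: "continuous_on UNIV (\<lambda>x. g x $ a)" for a by (intro continuous_intros contg)
  show "continuous_on UNIV (\<lambda>x. cutoff_gradient N (v x) (g x) x)"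
    unfolding cutoff_gradient_def by (intro continuous_on_vec_lambda continuous_on_add continuous_on_scaleR contv c1 c2 c3)
  fix x
  have "((\<lambda>x. cutoff N x *\<^sub>R v x) has_derivative
     (\<lambda>w. cutoff N x *\<^sub>R (\<Sum>a\<in>UNIV. w$a *\<^sub>R g x$a) + (\<Sum>a\<in>UNIV. w$a * cutoff_grad N x $ a) *\<^sub>R v x)) (at x)"
    by (intro has_derivative_scaleR cutoff_has_derivative N der)
  then show "((\<lambda>x. cutoff N x *\<^sub>R v x) has_derivative (\<lambda>w. \<Sum>a\<in>UNIV. w$a *\<^sub>R cutoff_gradient N (v x) (g x) x $ a)) (at x)"
    by (simp add: cutoff_gradient_def sum_3 algebra_simps scaleR_add_right scaleR_add_left)
qed

lemma energy_field_measurable: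
  assumes [measurable]: "v \<in> borel_measurable borel" and g: "g \<in> borel_measurable borel"
  shows "(\<lambda>x. energy_field N s (v x) (g x) x) \<in> borel_measurable borel"
proof -
  from measurable_compose[OF g vec_nth_measurable]
  have [measurable]: "(\<lambda>x. g x $ a) \<in> borel_measurable borel" for a .
  have "(\<lambda>x. \<chi> a. - \<i> * (cutoff_gradient N (v x) (g x) x $ a) + of_real ((s *\<^sub>R flux x) $ a) * (cutoff N x *\<^sub>R v x)) \<in> borel_measurable borel"
    by (rule vec_lambda_measurable) (simp add: cutoff_gradient_def)
  moreover have "(\<lambda>x. sqrt (2 * weight s x) *\<^sub>R cutoff N x *\<^sub>R v x) \<in> borel_measurable borel" by measurable
  ultimately show ?thesis unfolding energy_field_def by (rule borel_measurable_Pair)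
qed

lemma energy_field_integrable:
  assumes v: "l2 v" and g: "l2 g" and N: "1 \<le> N" and s: "0 \<le> s" "s \<le> 1"
  shows "l2 (\<lambda>x. energy_field N s (v x) (g x) x)"
    and "(LBINT x. sq (energy_field N s (v x) (g x) x)) \<le>
      100 * N * ((LBINT x. sq (v x)) + (LBINT x. sq (g x)))"
proof -
  note [measurable] = energy_field_measurable[OF l2_measurable[OF v] l2_measurable[OF g], of N s]
  have i: "integrable lborel (\<lambda>x. 100 * N * (sq (v x) + sq (g x)))"
    using l2_integrable[OF v] l2_integrable[OF g] by simp
  have b: "AE x in lborel. sq (energy_field N s (v x) (g x) x) \<le> 100 * N * (sq (v x) + sq (g x))"
    using AE_r2_nonzero by eventually_elim (rule energy_field_le(2)[OF N _ s])
  have "integrable lborel (\<lambda>x. sq (energy_field N s (v x) (g x) x))"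
    by (rule Bochner_Integration.integrable_bound[OF i]) (measurable, use b in \<open>auto elim!: eventually_mono intro: order_trans[OF _ abs_ge_self]\<close>)
  then show l: "l2 (\<lambda>x. energy_field N s (v x) (g x) x)" by (simp add: l2_def)
  have "(LBINT x. sq (energy_field N s (v x) (g x) x)) \<le> (LBINT x. 100 * N * (sq (v x) + sq (g x)))"
    by (rule integral_mono_AE[OF l2_integrable[OF l] i b])
  also have "\<dots> = 100 * N * ((LBINT x. sq (v x)) + (LBINT x. sq (g x)))"
    using l2_integrable[OF v] l2_integrable[OF g] by simp
  finally show "(LBINT x. sq (energy_field N s (v x) (g x) x)) \<le>
      100 * N * ((LBINT x. sq (v x)) + (LBINT x. sq (g x)))" .
qed

lemma cutoff_weighted:
  assumes v: "l2 v" and N: "1 \<le> N"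
  shows "weighted (\<lambda>x. cutoff N x *\<^sub>R v x)"
proof -
  note [measurable] = l2_measurable[OF v]
  have "integrable lborel (\<lambda>x. (1 + 1 / r2 x + sq x) * sq (cutoff N x *\<^sub>R v x))"
  proof (rule Bochner_Integration.integrable_bound)
    show "integrable lborel (\<lambda>x. (1 + 2 * N) * sq (v x))" using l2_integrable[OF v] by simp
    have "(1 + 1 / r2 x + sq x) * sq (cutoff N x *\<^sub>R v x) \<le> (1 + 2 * N) * sq (v x)" for x
      using mult_right_mono[OF cutoff_bounds(3)[OF N, of x], of "sq (v x)"] by (simp add: power_mult_distrib mult_ac)
    then show "AE x in lborel. norm ((1 + 1 / r2 x + sq x) * sq (cutoff N x *\<^sub>R v x)) \<le> norm ((1 + 2 * N) * sq (v x))"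
      using N by (intro AE_I2) (simp add: abs_mult)
  qed measurable
  then show ?thesis by (simp add: weighted_def)
qed

lemma l2_cutoff_gradient:
  assumes v: "l2 v" and g: "l2 g" and N: "1 \<le> N"
  shows "l2 (\<lambda>x. cutoff_gradient N (v x) (g x) x)"
proof -
  note [measurable] = l2_measurable[OF v] l2_component[OF g, THEN l2_measurable]
  have [measurable]: "(\<lambda>x. cutoff_gradient N (v x) (g x) x) \<in> borel_measurable borel"
    by (rule vec_lambda_measurable) (simp add: cutoff_gradient_def)
  have "integrable lborel (\<lambda>x. sq (cutoff_gradient N (v x) (g x) x))"
  proof (rule Bochner_Integration.integrable_bound)
    show "integrable lborel (\<lambda>x. 2 * sq (g x) + 16 * (N + 1) * sq (v x))"
      using l2_integrable[OF v] l2_integrable[OF g] by simp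
    have "sq (cutoff_gradient N (v x) (g x) x) \<le> 2 * sq (g x) + 16 * (N + 1) * sq (v x)" for x
    proof -
      have "(cutoff N x)\<^sup>2 \<le> 1" using power_mono[of "cutoff N x" 1 2] cutoff_bounds[OF N, of x] by auto
      then have "2 * ((cutoff N x)\<^sup>2 * sq (g x)) + 2 * (sq (cutoff_grad N x) * sq (v x))
        \<le> 2 * (1 * sq (g x)) + 2 * ((8 * (N + 1)) * sq (v x))"
        using cutoff_bounds(4)[OF N, of x] by (intro add_mono mult_left_mono mult_right_mono) auto
      with norm_cutoff_gradient[of N "v x" "g x" x] show ?thesis by (simp add: algebra_simps)
    qed
    then show "AE x in lborel. norm (sq (cutoff_gradient N (v x) (g x) x)) \<le> norm (2 * sq (g x) + 16 * (N + 1) * sq (v x))"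
      by (intro AE_I2) (auto intro: order_trans[OF _ abs_ge_self])
  qed measurable
  then show ?thesis by (simp add: l2_def)
qed

text \<open>The function is mollified first and cut off afterwards, which yields a C^1 function in
  the class \<open>weighted\<close>, where the smooth inequality holds. For fixed N both sides then
  pass to the limit, because the bound for \<open>energy_field\<close> applies to
  differences.\<close>

lemma cutoff_ground_state_inequality:
  assumes w: "weak_grad3 \<psi> g" and N: "1 \<le> N" and s: "0 \<le> s" "s \<le> 1"
  shows "5 * (LBINT x. sq (cutoff N x *\<^sub>R \<psi> x)) \<le> (LBINT x. sq (energy_field N s (\<psi> x) (g x) x))"
proof -
  have l: "l2 \<psi>" "l2 g" using w by (auto simp: weak_grad3_def)
  let ?e = "\<lambda>n. inverse (real (Suc n))"
  have e: "0 < ?e n" "?e n \<le> 1" for n by (auto simp: divide_simps)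
  define v where "v n = mollify (?e n) \<psi>" for n
  define h where "h n x = (\<chi> a. mollify (?e n) (\<lambda>y. g y $ a) x)" for n x
  have C1: "C1_gradient (v n) (h n)" for n
    unfolding v_def h_def[abs_def] by (rule C1_gradient_mollify[OF w e])
  have lv: "l2 (v n)" for n unfolding v_def by (rule l2_mollify[OF l(1) e(1)])
  have lh: "l2 (h n)" for n
    by (rule l2_vec) (unfold h_def vec_lambda_beta, rule l2_mollify[OF l2_component[OF l(2)] e(1)])
  have vlim: "(\<lambda>n. \<integral>x. sq (v n x - \<psi> x) \<partial>lborel) \<longlonglongrightarrow> 0"
    unfolding v_def by (rule mollify_L2_tendsto[OF l(1)])
  have hlim: "(\<lambda>n. \<integral>x. sq (h n x - g x) \<partial>lborel) \<longlonglongrightarrow> 0"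
  proof -
    have "(LBINT x. sq (h n x - g x)) = (LBINT x. sq (h n x $ 1 - g x $ 1))
      + (LBINT x. sq (h n x $ 2 - g x $ 2)) + (LBINT x. sq (h n x $ 3 - g x $ 3))" for n
      unfolding norm_square_cvec3 vector_minus_component
      using l2_integrable[OF l2_minus[OF l2_component[OF lh[of n]] l2_component[OF l(2)]]] by simp
    moreover have "(\<lambda>n. \<integral>x. sq (h n x $ a - g x $ a) \<partial>lborel) \<longlonglongrightarrow> 0" for a
      unfolding h_def vec_lambda_beta by (rule mollify_L2_tendsto[OF l2_component[OF l(2)]])
    from tendsto_add[OF tendsto_add[OF this[of 1] this[of 2]] this[of 3]] 
    have "(\<lambda>n. (LBINT x. sq (h n x $ 1 - g x $ 1))
      + (LBINT x. sq (h n x $ 2 - g x $ 2)) + (LBINT x. sq (h n x $ 3 - g x $ 3))) \<longlonglongrightarrow> 0"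
      by simp
    ultimately show ?thesis by simp
  qed
  have step: "5 * (LBINT x. sq (cutoff N x *\<^sub>R v n x)) \<le> (LBINT x. sq (energy_field N s (v n x) (h n x) x))" for n
    unfolding norm_energy_field[OF s]
    by (rule smooth_ground_state_inequality[OF C1_gradient_cutoff[OF C1 N] cutoff_weighted[OF lv N] l2_cutoff_gradient[OF lv lh N] s])
  have lc: "l2 (\<lambda>x. cutoff N x *\<^sub>R f x)" if "l2 f" for f :: "real^3 \<Rightarrow> complex"
    by (rule weighted_l2[OF cutoff_weighted[OF that N]])
  have sandwich: "F \<longlonglongrightarrow> 0" if "\<And>n. 0 \<le> F n" "\<And>n. F n \<le> G n" "G \<longlonglongrightarrow> 0" for F G :: "nat \<Rightarrow> real"
    using that by (intro tendsto_sandwich[OF _ _ tendsto_const that(3)]) auto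
  have "(\<lambda>n. \<integral>x. sq (cutoff N x *\<^sub>R v n x - cutoff N x *\<^sub>R \<psi> x) \<partial>lborel) \<longlonglongrightarrow> 0"
  proof (rule sandwich[OF _ _ vlim])
    fix n
    have "(cutoff N x)\<^sup>2 \<le> 1" for x using power_mono[of "cutoff N x" 1 2] cutoff_bounds[OF N, of x] by auto
    then have "sq (cutoff N x *\<^sub>R v n x - cutoff N x *\<^sub>R \<psi> x) \<le> sq (v n x - \<psi> x)" for x
      unfolding scaleR_diff_right[symmetric] norm_scaleR power_mult_distrib power2_abs by (simp add: mult_left_le_one_le)
    then show "(LBINT x. sq (cutoff N x *\<^sub>R v n x - cutoff N x *\<^sub>R \<psi> x)) \<le> (LBINT x. sq (v n x - \<psi> x))"
      by (intro integral_mono l2_integrable l2_minus lc lv l) auto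
  qed simp
  from L2_norm_tendsto[OF lc[OF lv] lc[OF l(1)] this]
  have lim1: "(\<lambda>n. 5 * (LBINT x. sq (cutoff N x *\<^sub>R v n x))) \<longlonglongrightarrow> 5 * (LBINT x. sq (cutoff N x *\<^sub>R \<psi> x))"
    by (rule tendsto_mult_left)
  have "(\<lambda>n. \<integral>x. sq (energy_field N s (v n x) (h n x) x - energy_field N s (\<psi> x) (g x) x) \<partial>lborel) \<longlonglongrightarrow> 0"
  proof (rule sandwich)
    show "(LBINT x. sq (energy_field N s (v n x) (h n x) x - energy_field N s (\<psi> x) (g x) x))
      \<le> 100 * N * ((LBINT x. sq (v n x - \<psi> x)) + (LBINT x. sq (h n x - g x)))" for n
      unfolding energy_field_diff by (intro energy_field_integrable(2) l2_minus lv lh l N s)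
    have "(\<lambda>n. 100 * N * ((LBINT x. sq (v n x - \<psi> x)) + (LBINT x. sq (h n x - g x)))) \<longlonglongrightarrow> 100 * N * (0 + 0)"
      by (intro tendsto_intros vlim hlim)
    then show "(\<lambda>n. 100 * N * ((LBINT x. sq (v n x - \<psi> x)) + (LBINT x. sq (h n x - g x)))) \<longlonglongrightarrow> 0" by simp
  qed simp
  from L2_norm_tendsto[OF energy_field_integrable(1)[OF lv lh N s] energy_field_integrable(1)[OF l N s] this]
  have "(\<lambda>n. \<integral>x. sq (energy_field N s (v n x) (h n x) x) \<partial>lborel) \<longlonglongrightarrow> (LBINT x. sq (energy_field N s (\<psi> x) (g x) x))" .
  from LIMSEQ_le[OF lim1 this] step show ?thesis by blast
qed

text \<open>Dominated convergence as the cutoff tends to 1; membership in \<open>weighted\<close>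
  supplies the dominating function. The two integrability claims allow kinetic and potential energy
  to be separated later.\<close>

lemma ground_state_inequality:
  assumes w: "weak_grad3 \<psi> g" and \<psi>: "weighted \<psi>" and s: "0 \<le> s" "s \<le> 1"
  shows "integrable lborel (\<lambda>x. kinetic (\<lambda>x. s *\<^sub>R flux x) (\<psi> x) (g x) x)"
    and "integrable lborel (\<lambda>x. 2 * weight s x * sq (\<psi> x))"
    and "5 * (LBINT x. sq (\<psi> x)) \<le>
      (LBINT x. kinetic (\<lambda>x. s *\<^sub>R flux x) (\<psi> x) (g x) x + 2 * weight s x * sq (\<psi> x))"
proof -
  have l: "l2 \<psi>" "l2 g" using w by (auto simp: weak_grad3_def)
  note [measurable] = l2_measurable[OF l(1)]
  have [measurable]: "(\<lambda>x. kinetic (\<lambda>x. s *\<^sub>R flux x) (\<psi> x) (g x) x) \<in> borel_measurable borel"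
    by (rule kinetic_measurable[OF l(1)[THEN l2_measurable] l(2)[THEN l2_measurable]]) simp
  let ?K = "\<lambda>x. kinetic (\<lambda>x. s *\<^sub>R flux x) (\<psi> x) (g x) x"
  let ?B = "\<lambda>x. (1 + 1 / r2 x + sq x) * sq (\<psi> x) + sq (g x)"
  have B: "?B x = sq (\<psi> x) + sq (\<psi> x) / r2 x + sq x * sq (\<psi> x) + sq (g x)" for x
    by (simp add: algebra_simps)
  have pos: "0 \<le> sq (\<psi> x) / r2 x" "0 \<le> sq x * sq (\<psi> x)" "0 \<le> sq (\<psi> x)" "0 \<le> sq (g x)" for x
    by auto
  show "integrable lborel ?K"
  proof (rule weighted_bound[OF \<psi> l(2), of _ 2])
    fix x assume r: "r2 x \<noteq> 0"
    have "\<bar>?K x\<bar> = ?K x" by (simp add: kinetic_def)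
    also have "\<dots> \<le> 2 * sq (g x) + sq (\<psi> x) / r2 x" by (rule kinetic_flux_le[OF r s])
    also have "\<dots> \<le> 2 * ?B x" unfolding B using pos[of x] by (smt (verit))
    finally show "\<bar>?K x\<bar> \<le> 2 * ?B x" .
  qed measurable
  show "integrable lborel (\<lambda>x. 2 * weight s x * sq (\<psi> x))"
  proof (rule weighted_bound[OF \<psi> l(2), of _ 1])
    fix x
    have "\<bar>2 * weight s x * sq (\<psi> x)\<bar> = 2 * weight s x * sq (\<psi> x)"
      using weight_bounds(1)[OF s, of x] by simp
    also have "\<dots> \<le> (1 / r2 x + sq x) * sq (\<psi> x)"
      by (intro mult_right_mono weight_bounds s) auto
    also have "\<dots> = sq (\<psi> x) / r2 x + sq x * sq (\<psi> x)" by (simp add: algebra_simps)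
    also have "\<dots> \<le> 1 * ?B x" unfolding B using pos[of x] by (smt (verit))
    finally show "\<bar>2 * weight s x * sq (\<psi> x)\<bar> \<le> 1 * ?B x" .
  qed measurable
  let ?N = "\<lambda>n. real (Suc n)"
  have N: "1 \<le> ?N n" for n by simp
  have iB: "integrable lborel (\<lambda>x. 36 * ?B x)"
    using \<psi> l2_integrable[OF l(2)] by (auto simp: weighted_def)
  have lim1: "(\<lambda>n. \<integral>x. sq (cutoff (?N n) x *\<^sub>R \<psi> x) \<partial>lborel) \<longlonglongrightarrow> (LBINT x. sq (\<psi> x))"
  proof (rule integral_dominated_convergence[where w="\<lambda>x. sq (\<psi> x)"])
    have "(cutoff (?N n) x)\<^sup>2 \<le> 1" for n x using power_mono[of "cutoff (?N n) x" 1 2] cutoff_bounds[OF N[of n], of x] by auto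
    then show "AE x in lborel. norm (sq (cutoff (?N n) x *\<^sub>R \<psi> x)) \<le> sq (\<psi> x)" for n
      by (intro AE_I2) (simp add: power_mult_distrib mult_left_le_one_le)
    show "AE x in lborel. (\<lambda>n. sq (cutoff (?N n) x *\<^sub>R \<psi> x)) \<longlonglongrightarrow> sq (\<psi> x)"
      using AE_r2_nonzero
    proof eventually_elim
      fix x assume r: "r2 x \<noteq> 0"
      have "(\<lambda>n. sq (cutoff (?N n) x *\<^sub>R \<psi> x)) \<longlonglongrightarrow> sq (1 *\<^sub>R \<psi> x)"
        by (intro tendsto_intros cutoff_tendsto r)
      then show "(\<lambda>n. sq (cutoff (?N n) x *\<^sub>R \<psi> x)) \<longlonglongrightarrow> sq (\<psi> x)" by simp
    qed
  qed (use l2_integrable[OF l(1)] in auto)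
  have lim2: "(\<lambda>n. \<integral>x. sq (energy_field (?N n) s (\<psi> x) (g x) x) \<partial>lborel) \<longlonglongrightarrow> (LBINT x. ?K x + 2 * weight s x * sq (\<psi> x))"
  proof (rule integral_dominated_convergence[where w="\<lambda>x. 36 * ?B x"])
    show "AE x in lborel. norm (sq (energy_field (?N n) s (\<psi> x) (g x) x)) \<le> 36 * ?B x" for n
      using AE_r2_nonzero by eventually_elim (use energy_field_le(1)[OF N _ s] in simp)
    show "(\<lambda>x. sq (energy_field (?N n) s (\<psi> x) (g x) x)) \<in> borel_measurable lborel" for n
      using energy_field_measurable[OF l(1)[THEN l2_measurable] l(2)[THEN l2_measurable], of "?N n" s] by simp
    show "AE x in lborel. (\<lambda>n. sq (energy_field (?N n) s (\<psi> x) (g x) x)) \<longlonglongrightarrow> ?K x + 2 * weight s x * sq (\<psi> x)"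
      using AE_r2_nonzero
    proof eventually_elim
      fix x assume r: "r2 x \<noteq> 0"
      have c: "(\<lambda>n. cutoff_gradient (?N n) (\<psi> x) (g x) x $ a) \<longlonglongrightarrow> 1 *\<^sub>R g x $ a + 0 *\<^sub>R \<psi> x" for a
        unfolding cutoff_gradient_def vec_lambda_beta by (intro tendsto_intros cutoff_tendsto r)
      have "(\<lambda>n. sq (- \<i> * (cutoff_gradient (?N n) (\<psi> x) (g x) x $ a) + of_real ((s *\<^sub>R flux x) $ a) * (cutoff (?N n) x *\<^sub>R \<psi> x)))
        \<longlonglongrightarrow> sq (- \<i> * (1 *\<^sub>R g x $ a + 0 *\<^sub>R \<psi> x) + of_real ((s *\<^sub>R flux x) $ a) * (1 *\<^sub>R \<psi> x))" for a
        by (intro tendsto_intros cutoff_tendsto r c)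
      note k = tendsto_add[OF tendsto_add[OF this[of 1] this[of 2]] this[of 3]]
      have "(\<lambda>n. kinetic (\<lambda>x. s *\<^sub>R flux x) (cutoff (?N n) x *\<^sub>R \<psi> x) (cutoff_gradient (?N n) (\<psi> x) (g x) x) x) \<longlonglongrightarrow> ?K x"
        unfolding kinetic_def norm_square_cvec3 vec_lambda_beta using k by simp
      moreover have "(\<lambda>n. 2 * weight s x * sq (cutoff (?N n) x *\<^sub>R \<psi> x)) \<longlonglongrightarrow> 2 * weight s x * sq (1 *\<^sub>R \<psi> x)"
        by (intro tendsto_intros cutoff_tendsto r)
      ultimately have "(\<lambda>n. kinetic (\<lambda>x. s *\<^sub>R flux x) (cutoff (?N n) x *\<^sub>R \<psi> x) (cutoff_gradient (?N n) (\<psi> x) (g x) x) x + 2 * weight s x * sq (cutoff (?N n) x *\<^sub>R \<psi> x)) \<longlonglongrightarrow> ?K x + 2 * weight s x * sq (1 *\<^sub>R \<psi> x)"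
        by (rule tendsto_add)
      then show "(\<lambda>n. sq (energy_field (?N n) s (\<psi> x) (g x) x)) \<longlonglongrightarrow> ?K x + 2 * weight s x * sq (\<psi> x)"
        unfolding norm_energy_field[OF s] by simp
    qed
  qed (use iB in auto)
  from LIMSEQ_le[OF tendsto_mult_left[OF lim1, of 5] lim2] cutoff_ground_state_inequality[OF w N s]
  show "5 * (LBINT x. sq (\<psi> x)) \<le> (LBINT x. ?K x + 2 * weight s x * sq (\<psi> x))"
    by blast
qed

section \<open>One-particle configurations\<close>

text \<open>Keeps the particle number in the form \<open>1\<close>, in which the facts below are
  stated.\<close>

declare One_nat_def [simp del]

text \<open>A one-particle configuration is extensional: it carries \<open>undefined\<close> at
  every index other than 0. With this value outside \<open>{..<1}\<close>, \<open>conf\<close> is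
  the inverse of evaluation at 0.\<close>

definition conf :: "real^3 \<Rightarrow> config" where "conf r = (\<lambda>_. undefined)(0 := r)"

lemma conf_0 [simp]: "conf r 0 = r" by (simp add: conf_def)

lemma conf_upd [simp]: "(conf r)(0 := r') = conf r'" by (simp add: conf_def)

lemma lessThan_1: "{..<1::nat} = {0}" by auto

lemma conf_in_space [simp]: "conf r \<in> space (configs 1)"
  by (auto simp: space_PiM conf_def PiE_def extensional_def)

lemma conf_coordinate: "x \<in> space (configs 1) \<Longrightarrow> conf (x 0) = x"
  by (auto simp: space_PiM conf_def PiE_def extensional_def fun_eq_iff)

lemma conf_measurable: "conf \<in> measurable borel (configs 1)"
proof -
  have "(\<lambda>r i. conf r i) \<in> measurable borel (configs 1)"
  proof (rule measurable_PiM_single')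
    show "(\<lambda>r. conf r i) \<in> measurable borel lborel" if "i \<in> {..<1}" for i
      using that by (simp add: lessThan_1)
    show "(\<lambda>r i. conf r i) \<in> space borel \<rightarrow> (\<Pi>\<^sub>E i\<in>{..<1}. space lborel)"
      by (auto simp: conf_def PiE_def extensional_def)
  qed
  then show ?thesis by simp
qed

lemma coordinate_measurable: "(\<lambda>x. x 0) \<in> measurable (configs 1) borel"
proof -
  have "(\<lambda>x. x 0) \<in> measurable (configs 1) (lborel :: (real^3) measure)"
    by (rule measurable_component_singleton) simp
  then show ?thesis by simp
qed

lemma configs_1: "configs 1 = distr lborel (configs 1) conf"
proof -
  interpret product_sigma_finite "\<lambda>_::nat. lborel :: (real^3) measure"
    by standard
  have s: "distr (configs 1) lborel (\<lambda>x. x 0) = lborel"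
    unfolding lessThan_1 by (rule distr_singleton)
  have "distr lborel (configs 1) conf = distr (distr (configs 1) lborel (\<lambda>x. x 0)) (configs 1) conf"
    by (simp only: s)
  also have "\<dots> = distr (configs 1) (configs 1) (conf \<circ> (\<lambda>x. x 0))"
    by (rule distr_distr) (simp_all add: conf_measurable coordinate_measurable)
  also have "\<dots> = distr (configs 1) (configs 1) (\<lambda>x. x)"
    by (rule distr_cong) (auto simp: conf_coordinate)
  finally show ?thesis by simp
qed

lemma nn_integral_configs_1:
  assumes "f \<in> borel_measurable (configs 1)"
  shows "(\<integral>\<^sup>+x. f x \<partial>configs 1) = (\<integral>\<^sup>+r. f (conf r) \<partial>lborel)"
  by (subst configs_1, subst nn_integral_distr) (use assms conf_measurable in auto)

lemma measurable_conf_iff: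
  "f \<in> measurable (configs 1) M \<longleftrightarrow> (\<lambda>r. f (conf r)) \<in> measurable borel M"
proof
  assume "(\<lambda>r. f (conf r)) \<in> measurable borel M"
  from measurable_compose[OF coordinate_measurable this]
  show "f \<in> measurable (configs 1) M"
    by (rule measurable_cong[THEN iffD1, rotated]) (simp add: conf_coordinate)
qed (rule measurable_compose[OF conf_measurable])

text \<open>For a function that is not measurable both integrals are 0 by convention. The
  unconditional form lets the weak gradient identities be transported by rewriting.\<close>

lemma integral_configs_1:
  fixes f :: "config \<Rightarrow> 'b::{banach, second_countable_topology}"
  shows "(\<integral>x. f x \<partial>configs 1) = (LBINT r. f (conf r))"
proof (cases "f \<in> borel_measurable (configs 1)")
  case True
  then show ?thesis by (subst configs_1, subst integral_distr) (auto simp: conf_measurable)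
next
  case False
  then have "(\<lambda>r. f (conf r)) \<notin> borel_measurable borel" by (simp add: measurable_conf_iff)
  with False have "\<not> integrable (configs 1) f" "\<not> integrable lborel (\<lambda>r. f (conf r))"
    by (auto dest: borel_measurable_integrable)
  then show ?thesis by (simp add: not_integrable_integral_eq)
qed

lemma continuous_conf: "continuous_on S conf"
proof (rule continuous_on_coordinatewise_then_product)
  show "continuous_on S (\<lambda>x. conf x i)" for i
    by (cases "i = 0") (auto simp: conf_def)
qed

lemma continuous_coordinate: "continuous_on S (\<lambda>x::config. x i)"
  by (rule continuous_on_subset[OF continuous_on_product_coordinates]) simp

section \<open>Test functions, weak gradients and states of a single particle\<close>

lemma partial_coordinate:
  assumes "test3 \<phi> D" shows "partial 0 a (\<lambda>x. \<phi> (x 0)) x = D a (x 0)"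
  using assms unfolding partial_def test3_def by (auto intro!: DERIV_imp_deriv)

lemma test_function_coordinate:
  assumes t: "test3 \<phi> D" shows "test_function 1 (\<lambda>x. \<phi> (x 0))"
  unfolding test_function_def
proof (intro conjI allI impI ballI)
  have c: "continuous_on UNIV \<phi>" "continuous_on UNIV (D a)" for a using t by (auto simp: test3_def)
  show "continuous_on (space (configs 1)) (\<lambda>x. \<phi> (x 0))"
    by (rule continuous_on_compose2[OF c(1) continuous_coordinate]) simp
  show "\<exists>R. \<forall>x\<in>space (configs 1). (\<exists>j<1. R < norm (x j)) \<longrightarrow> \<phi> (x 0) = 0"
    using t by (auto simp: test3_def)
  fix j :: nat and a :: 3 assume "j < 1"
  then have j: "j = 0" by simp
  show "continuous_on (space (configs 1)) (partial j a (\<lambda>x. \<phi> (x 0)))"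
    unfolding j partial_coordinate[OF t, abs_def]
    by (rule continuous_on_compose2[OF c(2) continuous_coordinate]) simp
  fix x :: config
  have "((\<lambda>t. \<phi> (x 0 + t *\<^sub>R axis a 1)) has_real_derivative D a (x 0)) (at 0)"
    using t by (auto simp: test3_def)
  then show "(\<lambda>t. \<phi> ((x(j := x j + t *\<^sub>R axis a 1)) 0)) differentiable at 0"
    unfolding j by (auto simp: real_differentiable_def)
qed

lemma test3_conf:
  assumes t: "test_function 1 \<phi>"
  shows "test3 (\<lambda>r. \<phi> (conf r)) (\<lambda>a r. partial 0 a \<phi> (conf r))"
  unfolding test3_def
proof (intro conjI allI)
  have c: "continuous_on (space (configs 1)) \<phi>" "continuous_on (space (configs 1)) (partial 0 a \<phi>)"
    "\<And>x. x \<in> space (configs 1) \<Longrightarrow> (\<lambda>t::real. \<phi> (x(0 := x 0 + t *\<^sub>R axis a 1))) differentiable (at 0)" for a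
    using t by (auto simp: test_function_def)
  show "continuous_on UNIV (\<lambda>r. \<phi> (conf r))"
    by (rule continuous_on_compose2[OF c(1) continuous_conf]) auto
  show "continuous_on UNIV (\<lambda>r. partial 0 a \<phi> (conf r))" for a
    by (rule continuous_on_compose2[OF c(2) continuous_conf]) auto
  obtain R where "\<And>x. x \<in> space (configs 1) \<Longrightarrow> (\<exists>j<1. R < norm (x j)) \<Longrightarrow> \<phi> x = 0"
    using t by (auto simp: test_function_def)
  from this[OF conf_in_space] show "\<exists>R. \<forall>r. R < norm r \<longrightarrow> \<phi> (conf r) = 0" by auto
  fix a r
  show "((\<lambda>t. \<phi> (conf (r + t *\<^sub>R axis a 1))) has_real_derivative partial 0 a \<phi> (conf r)) (at 0)"
    using c(3)[OF conf_in_space, of r a] by (simp add: partial_def DERIV_deriv_iff_real_differentiable)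
qed

lemma weak_gradient_conf:
  assumes m: "\<psi> \<in> borel_measurable (configs 1)" and n: "(\<integral>\<^sup>+x. ennreal (sq (\<psi> x)) \<partial>configs 1) < \<infinity>"
    and w: "weak_gradient 1 \<psi> g"
  shows "weak_grad3 (\<lambda>r. \<psi> (conf r)) (\<lambda>r. g 0 (conf r))"
  unfolding weak_grad3_def
proof (intro conjI allI impI)
  have g: "g 0 \<in> borel_measurable (configs 1)" "(\<integral>\<^sup>+x. ennreal (sq (g 0 x)) \<partial>configs 1) < \<infinity>"
    using w by (auto simp: weak_gradient_def)
  show "l2 (\<lambda>r. \<psi> (conf r))"
    using n m nn_integral_configs_1[of "\<lambda>x. ennreal (sq (\<psi> x))"] measurable_conf_iff[of \<psi> borel]
    by (subst l2_iff_nn) auto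
  show "l2 (\<lambda>r. g 0 (conf r))"
    using g nn_integral_configs_1[of "\<lambda>x. ennreal (sq (g 0 x))"] measurable_conf_iff[of "g 0" borel]
    by (subst l2_iff_nn) auto
  fix a \<phi> D assume t: "test3 \<phi> D"
  have "(\<integral>x. \<psi> x * of_real (partial 0 a (\<lambda>x. \<phi> (x 0)) x) \<partial>configs 1) = - (\<integral>x. (g 0 x $ a) * of_real (\<phi> (x 0)) \<partial>configs 1)"
    using w test_function_coordinate[OF t] by (auto simp: weak_gradient_def)
  then show "(LBINT x. \<psi> (conf x) * of_real (D a x)) = - (LBINT x. (g 0 (conf x) $ a) * of_real (\<phi> x))"
    by (simp add: integral_configs_1 partial_coordinate[OF t])
qed

lemma weak_gradient_coordinate:
  assumes w: "weak_grad3 \<psi> g" shows "weak_gradient 1 (\<lambda>x. \<psi> (x 0)) (\<lambda>j x. g (x 0))"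
  unfolding weak_gradient_def
proof (intro allI impI conjI)
  have l: "l2 \<psi>" "l2 g" using w by (auto simp: weak_grad3_def)
  note [measurable] = l(2)[THEN l2_measurable]
  show m: "(\<lambda>x. g (x 0)) \<in> borel_measurable (configs 1)"
    by (rule measurable_compose[OF coordinate_measurable]) measurable
  show "(\<integral>\<^sup>+x. ennreal (sq (g (x 0))) \<partial>configs 1) < \<infinity>"
    using l(2) l2_iff_nn[of g] by (subst nn_integral_configs_1) (auto intro!: measurable_compose[OF coordinate_measurable])
  fix j a \<phi> assume j: "j < (1::nat)" and t: "test_function 1 \<phi>"
  from j have "j = 0" by simp
  with w test3_conf[OF t] show "(\<integral>x. \<psi> (x 0) * of_real (partial j a \<phi> x) \<partial>configs 1) = - (\<integral>x. (g (x 0) $ a) * of_real (\<phi> x) \<partial>configs 1)"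
    by (auto simp: integral_configs_1 weak_grad3_def)
qed

text \<open>For one particle the remaining coordinates range over an empty product, which is a
  single point of mass 1.\<close>

lemma integral_PiM_empty:
  fixes f :: "config \<Rightarrow> 'b::{banach, second_countable_topology}"
  shows "(\<integral>x. f x \<partial>Pi\<^sub>M {1..<1} (\<lambda>_. lborel :: (real^3) measure)) = f (\<lambda>_. undefined)"
  by (simp add: PiM_empty lebesgue_integral_count_space_finite)

lemma density_1: "density 1 \<psi> r = sq (\<psi> (conf r))"
  unfolding density_def integral_PiM_empty by (simp add: conf_def)

lemma para_current_1: "para_current 1 \<psi> r = (\<chi> a. Im (cnj (\<psi> (conf r)) * (wgrad 1 \<psi> 0 (conf r) $ a)))"
  unfolding para_current_def integral_PiM_empty by (simp add: conf_def)

lemma pure_state_1D: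
  assumes "pure_state 1 \<psi>"
  shows "weak_grad3 (\<lambda>r. \<psi> (conf r)) (\<lambda>r. wgrad 1 \<psi> 0 (conf r))"
    and "(LBINT x. sq (\<psi> (conf x))) = 1"
proof -
  have p: "\<psi> \<in> borel_measurable (configs 1)" "(\<integral>\<^sup>+x. ennreal (sq (\<psi> x)) \<partial>configs 1) = 1"
    "\<exists>g. weak_gradient 1 \<psi> g" using assms by (auto simp: pure_state_def)
  from someI_ex[OF p(3)] have "weak_gradient 1 \<psi> (wgrad 1 \<psi>)" by (simp add: wgrad_def)
  then show w: "weak_grad3 (\<lambda>r. \<psi> (conf r)) (\<lambda>r. wgrad 1 \<psi> 0 (conf r))"
    by (intro weak_gradient_conf p) (simp add: p)
  have "(\<integral>\<^sup>+r. ennreal (sq (\<psi> (conf r))) \<partial>lborel) = 1"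
    using p nn_integral_configs_1[of "\<lambda>x. ennreal (sq (\<psi> x))"] by simp
  moreover have "integrable lborel (\<lambda>r. sq (\<psi> (conf r)))"
    using w by (auto simp: weak_grad3_def l2_def)
  ultimately show "(LBINT x. sq (\<psi> (conf x))) = 1"
    by (simp add: integral_eq_nn_integral)
qed

text \<open>A single particle has no pairs, so the interaction sum is empty.\<close>

lemma pure_energy_1:
  assumes p: "pure_state 1 \<psi>" and A: "\<And>a. (\<lambda>x. A x $ a) \<in> borel_measurable borel"
  shows "pure_energy 1 A \<psi> = (\<integral>\<^sup>+r. ennreal (1/2 * kinetic A (\<psi> (conf r)) (wgrad 1 \<psi> 0 (conf r)) r) \<partial>lborel)"
proof -
  have l: "l2 (\<lambda>r. \<psi> (conf r))" "l2 (\<lambda>r. wgrad 1 \<psi> 0 (conf r))"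
    using pure_state_1D(1)[OF p] by (auto simp: weak_grad3_def)
  have "(\<lambda>r. kinetic A (\<psi> (conf r)) (wgrad 1 \<psi> 0 (conf r)) r) \<in> borel_measurable borel"
    by (rule kinetic_measurable[OF l(1)[THEN l2_measurable] l(2)[THEN l2_measurable] A])
  then have "(\<lambda>x. ennreal (1/2 * kinetic A (\<psi> x) (wgrad 1 \<psi> 0 x) (x 0))) \<in> borel_measurable (configs 1)"
    by (subst measurable_conf_iff) simp
  from nn_integral_configs_1[OF this] show ?thesis
    unfolding pure_energy_def by (simp add: kinetic_def lessThan_1)
qed

text \<open>The second claim replaces the gradient chosen by \<open>wgrad\<close> with the explicit
  one, by uniqueness of weak gradients.\<close>

lemma trial_state:
  assumes w: "weak_grad3 \<psi> g" and n: "(LBINT x. sq (\<psi> x)) = 1"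
  shows "pure_state 1 (\<lambda>x. \<psi> (x 0))" and "AE r in lborel. wgrad 1 (\<lambda>x. \<psi> (x 0)) 0 (conf r) = g r"
proof -
  have l: "l2 \<psi>" using w by (auto simp: weak_grad3_def)
  note [measurable] = l[THEN l2_measurable]
  show p: "pure_state 1 (\<lambda>x. \<psi> (x 0))"
    unfolding pure_state_def
  proof (intro conjI allI impI)
    show "(\<lambda>x. \<psi> (x 0)) \<in> borel_measurable (configs 1)"
    by (rule measurable_compose[OF coordinate_measurable]) measurable
    show "(\<integral>\<^sup>+x. ennreal (sq (\<psi> (x 0))) \<partial>configs 1) = 1"
      using n nn_integral_eq_integral[OF l2_integrable[OF l]] by (subst nn_integral_configs_1) (auto intro!: measurable_compose[OF coordinate_measurable])
    show "\<exists>g. weak_gradient 1 (\<lambda>x. \<psi> (x 0)) g" using weak_gradient_coordinate[OF w] by blast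
    fix \<pi> :: "nat \<Rightarrow> nat" assume "\<pi> permutes {..<1}"
    then have "\<pi> = id" by (simp add: lessThan_1)
    then show "AE x in configs 1. \<psi> (x (\<pi> 0)) = of_int (sign \<pi>) * \<psi> (x 0)" by simp
  qed
  from weak_grad3_unique[OF pure_state_1D(1)[OF p]] w
  show "AE r in lborel. wgrad 1 (\<lambda>x. \<psi> (x 0)) 0 (conf r) = g r" by simp
qed

section \<open>Mixed states\<close>

text \<open>Half of the inequality with constant 5. If the potential energy is infinite there is
  nothing to prove; if it is finite, it forces the state into the class
  \<open>weighted\<close>.\<close>

lemma pure_energy_lower_bound:
  assumes p: "pure_state 1 \<psi>" and s: "0 \<le> s" "s \<le> 1"
  shows "ennreal (5/2) \<le> pure_energy 1 (\<lambda>x. s *\<^sub>R flux x) \<psi> + (\<integral>\<^sup>+r. ennreal (weight s r * sq (\<psi> (conf r))) \<partial>lborel)"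
proof (cases "(\<integral>\<^sup>+r. ennreal (weight s r * sq (\<psi> (conf r))) \<partial>lborel) = \<infinity>")
  case False
  define u where "u r = \<psi> (conf r)" for r
  let ?g = "\<lambda>r. wgrad 1 \<psi> 0 (conf r)"
  note w = pure_state_1D(1)[OF p, folded u_def]
  have l: "l2 u" using w by (auto simp: weak_grad3_def)
  note [measurable] = l[THEN l2_measurable]
  have wpos: "0 \<le> weight s r * sq (u r)" for r using weight_bounds(1)[OF s, of r] by simp
  have iw: "integrable lborel (\<lambda>r. weight s r * sq (u r))"
    using False wpos unfolding u_def[symmetric] by (intro integrableI_bounded) (auto simp: less_top)
  have "weighted u"
    unfolding weighted_def
  proof (intro conjI)
    show "integrable lborel (\<lambda>r. (1 + 1 / r2 r + sq r) * sq (u r))"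
    proof (rule Bochner_Integration.integrable_bound)
      show "integrable lborel (\<lambda>r. sq (u r) + 3 * (weight s r * sq (u r)))"
        using l2_integrable[OF l] iw by simp
      have "(1 + 1 / r2 r + sq r) * sq (u r) \<le> sq (u r) + 3 * (weight s r * sq (u r))" for r
      proof -
        have s2: "s\<^sup>2 \<le> 1" using power_mono[of s 1 2] s by auto
        have "3 * (3 / (8 * r2 r)) \<le> 3 * ((4 - s\<^sup>2) / (8 * r2 r))"
          using s2 by (intro mult_left_mono divide_right_mono) auto
        \<comment> \<open>The factor 3 suffices because 4 - s^2 >= 3 and 3 * 3/8 >= 1; for
          \<open>r2 r = 0\<close> both sides are 0.\<close>
        moreover have "1 / r2 r \<le> 3 * (3 / (8 * r2 r))" by (cases "r2 r = 0") (auto simp: field_simps less_le)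
        moreover have "3 * weight s r = 3 / 2 * sq r + 3 * ((4 - s\<^sup>2) / (8 * r2 r))"
          by (simp add: weight_def distrib_left)
        moreover have "0 \<le> sq r" by simp
        ultimately have "1 / r2 r + sq r \<le> 3 * weight s r" by linarith
        from mult_right_mono[OF this, of "sq (u r)"] show ?thesis by (simp add: algebra_simps)
      qed
      then show "AE r in lborel. norm ((1 + 1 / r2 r + sq r) * sq (u r)) \<le> norm (sq (u r) + 3 * (weight s r * sq (u r)))"
        using wpos by (intro AE_I2) (simp add: abs_mult)
    qed measurable
  qed measurable
  note gs = ground_state_inequality[OF w this s]
  let ?K = "\<lambda>r. kinetic (\<lambda>x. s *\<^sub>R flux x) (u r) (?g r) r"
  have Kpos: "0 \<le> ?K r" for r by (simp add: kinetic_def)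
  have "5 \<le> (LBINT r. ?K r) + 2 * (LBINT r. weight s r * sq (u r))"
    using gs(3) gs(1) iw pure_state_1D(2)[OF p, folded u_def] by (simp add: mult.assoc)
  then have "5/2 \<le> (LBINT r. 1/2 * ?K r) + (LBINT r. weight s r * sq (u r))"
    using gs(1) by simp
  have "ennreal (5/2) \<le> ennreal (LBINT r. 1/2 * ?K r) + ennreal (LBINT r. weight s r * sq (u r))"
  proof -
    have "0 \<le> (LBINT r. 1/2 * ?K r)" "0 \<le> (LBINT r. weight s r * sq (u r))"
      using Kpos wpos by (auto intro!: integral_nonneg_AE)
    with ennreal_leI[OF \<open>5/2 \<le> _\<close>] show ?thesis by (simp only: ennreal_plus)
  qed
  also have "ennreal (LBINT r. 1/2 * ?K r) = pure_energy 1 (\<lambda>x. s *\<^sub>R flux x) \<psi>"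
    unfolding pure_energy_1[OF p, of "\<lambda>x. s *\<^sub>R flux x", simplified] u_def[symmetric]
    using gs(1) Kpos by (subst nn_integral_eq_integral) auto
  also have "ennreal (LBINT r. weight s r * sq (u r)) = (\<integral>\<^sup>+r. ennreal (weight s r * sq (u r)) \<partial>lborel)"
    using iw wpos by (subst nn_integral_eq_integral) auto
  finally show ?thesis unfolding u_def .
qed simp

text \<open>The pure bounds are averaged with the weights. The potential energy of a mixture depends
  on its density alone, so for prescribed density this becomes a lower bound on the kinetic
  energy.\<close>

lemma mixed_energy_lower_bound:
  assumes m: "mixed_state 1 \<Gamma>" and d: "has_density 1 \<Gamma> \<rho>" and s: "0 \<le> s" "s \<le> 1"
  shows "ennreal (5/2) \<le> energy 1 (\<lambda>x. s *\<^sub>R flux x) \<Gamma> + (\<integral>\<^sup>+r. ennreal (weight s r * \<rho> r) \<partial>lborel)"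
proof -
  obtain w \<psi> where G: "\<Gamma> = (w, \<psi>)" by (cases \<Gamma>)
  have w: "0 \<le> w k" and p: "pure_state 1 (\<psi> k)" for k using m by (auto simp: G mixed_state_def)
  have w1: "w sums 1" using m by (simp add: G mixed_state_def)
  have wsum: "(\<Sum>k. ennreal (w k)) = 1"
    using suminf_ennreal_eq[OF w w1] by simp
  define u where "u k r = \<psi> k (conf r)" for k r
  have l: "l2 (u k)" for k using pure_state_1D(1)[OF p[of k]] by (auto simp: weak_grad3_def u_def[abs_def])
  have [measurable]: "u k \<in> borel_measurable borel" for k using l2_measurable[OF l[of k]] .
  \<comment> \<open>The density is prescribed through a real series, whose sum carries no
    information where it diverges. The total mass 1 makes it converge almost everywhere.\<close>
  have "(\<integral>\<^sup>+r. (\<Sum>k. ennreal (w k * sq (u k r))) \<partial>lborel) = (\<Sum>k. \<integral>\<^sup>+r. ennreal (w k * sq (u k r)) \<partial>lborel)"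
    by (rule nn_integral_suminf) measurable
  also have "\<dots> = (\<Sum>k. ennreal (w k))"
  proof (intro suminf_cong)
    fix k
    have "(\<integral>\<^sup>+r. ennreal (w k * sq (u k r)) \<partial>lborel) = ennreal (LBINT r. w k * sq (u k r))"
      using w[of k] l2_integrable[OF l[of k]] by (intro nn_integral_eq_integral) auto
    then show "(\<integral>\<^sup>+r. ennreal (w k * sq (u k r)) \<partial>lborel) = ennreal (w k)"
      using pure_state_1D(2)[OF p[of k]] by (simp add: u_def)
  qed
  finally have "(\<integral>\<^sup>+r. (\<Sum>k. ennreal (w k * sq (u k r))) \<partial>lborel) \<noteq> \<infinity>" by (simp add: wsum)
  then have fin: "AE r in lborel. (\<Sum>k. ennreal (w k * sq (u k r))) \<noteq> \<infinity>"
    by (intro nn_integral_PInf_AE) measurable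
  have dens: "AE r in lborel. (\<Sum>k. ennreal (w k * sq (u k r))) = ennreal (\<rho> r)"
    using fin d unfolding has_density_def G prod.case density_1 u_def[symmetric]
  proof eventually_elim
    fix r assume f: "(\<Sum>k. ennreal (w k * sq (u k r))) \<noteq> \<infinity>" and e: "(\<Sum>k. w k * sq (u k r)) = \<rho> r"
    have "summable (\<lambda>k. w k * sq (u k r))"
      using f w by (intro summable_suminf_not_top) auto
    then show "(\<Sum>k. ennreal (w k * sq (u k r))) = ennreal (\<rho> r)"
      using w e by (subst suminf_ennreal2) auto
  qed
  let ?E = "\<lambda>k. pure_energy 1 (\<lambda>x. s *\<^sub>R flux x) (\<psi> k)" and ?W = "\<lambda>k. \<integral>\<^sup>+r. ennreal (weight s r * sq (u k r)) \<partial>lborel"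
  have "(\<Sum>k. ennreal (w k) * ?W k) = (\<Sum>k. \<integral>\<^sup>+r. ennreal (weight s r) * ennreal (w k * sq (u k r)) \<partial>lborel)"
  proof (intro suminf_cong)
    fix k
    have "ennreal (w k) * ?W k = (\<integral>\<^sup>+r. ennreal (w k) * ennreal (weight s r * sq (u k r)) \<partial>lborel)"
      by (rule nn_integral_cmult[symmetric]) measurable
    also have "\<dots> = (\<integral>\<^sup>+r. ennreal (weight s r) * ennreal (w k * sq (u k r)) \<partial>lborel)"
      using w[of k] weight_bounds(1)[OF s] by (intro nn_integral_cong) (simp add: ennreal_mult[symmetric] mult_ac)
    finally show "ennreal (w k) * ?W k = (\<integral>\<^sup>+r. ennreal (weight s r) * ennreal (w k * sq (u k r)) \<partial>lborel)" .
  qed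
  also have "\<dots> = (\<integral>\<^sup>+r. (\<Sum>k. ennreal (weight s r) * ennreal (w k * sq (u k r))) \<partial>lborel)"
    by (rule nn_integral_suminf[symmetric]) measurable
  also have "\<dots> = (\<integral>\<^sup>+r. ennreal (weight s r * \<rho> r) \<partial>lborel)"
    using dens
    by (intro nn_integral_cong_AE) (auto simp: ennreal_suminf_cmult ennreal_mult' weight_bounds(1)[OF s] elim!: eventually_mono)
  finally have W: "(\<Sum>k. ennreal (w k) * ?W k) = (\<integral>\<^sup>+r. ennreal (weight s r * \<rho> r) \<partial>lborel)" .
  have "ennreal (5/2) = (\<Sum>k. ennreal (w k) * ennreal (5/2))"
    by (simp only: ennreal_suminf_multc wsum mult_1)
  also have "\<dots> \<le> (\<Sum>k. ennreal (w k) * (?E k + ?W k))"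
    unfolding u_def by (intro suminf_le mult_left_mono pure_energy_lower_bound p s) auto
  also have "\<dots> = (\<Sum>k. ennreal (w k) * ?E k) + (\<Sum>k. ennreal (w k) * ?W k)"
    by (simp only: distrib_left suminf_add[symmetric] summableI)
  finally show ?thesis unfolding W by (simp add: energy_def G)
qed

text \<open>Every entry of a mixture has to be a pure state, so the one state is repeated, with
  weight 0 after the first entry.\<close>

definition pure_mixture :: "(config \<Rightarrow> complex) \<Rightarrow> mixture" where
  "pure_mixture \<psi> = ((\<lambda>k. if k = 0 then 1 else 0), (\<lambda>_. \<psi>))"

lemma pure_mixture:
  assumes p: "pure_state N \<psi>"
  shows "mixed_state N (pure_mixture \<psi>)"
    and "has_density N (pure_mixture \<psi>) \<rho> \<longleftrightarrow> (AE r in lborel. density N \<psi> r = \<rho> r)"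
    and "has_para_current N (pure_mixture \<psi>) jp \<longleftrightarrow> (AE r in lborel. para_current N \<psi> r = jp r)"
    and "energy N A (pure_mixture \<psi>) = pure_energy N A \<psi>"
proof -
  have "(\<lambda>k::nat. if k = 0 then 1 else 0 :: real) sums 1"
    using sums_single[of 0 "\<lambda>_. 1 :: real"] by simp
  with p show "mixed_state N (pure_mixture \<psi>)" by (simp add: mixed_state_def pure_mixture_def)
  have "(\<Sum>k::nat. (if k = 0 then 1 else 0) * c) = c" for c :: real
    using suminf_finite[of "{0::nat}" "\<lambda>k. (if k = 0 then 1 else 0) * c"] by simp
  then show "has_density N (pure_mixture \<psi>) \<rho> \<longleftrightarrow> (AE r in lborel. density N \<psi> r = \<rho> r)"
    by (simp add: has_density_def pure_mixture_def)
  have "(\<Sum>k::nat. (if k = 0 then 1 else 0 :: real) *\<^sub>R c) = c" for c :: "real^3"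
    using suminf_finite[of "{0::nat}" "\<lambda>k. (if k = 0 then 1 else 0 :: real) *\<^sub>R c"] by simp
  then show "has_para_current N (pure_mixture \<psi>) jp \<longleftrightarrow> (AE r in lborel. para_current N \<psi> r = jp r)"
    by (simp add: has_para_current_def pure_mixture_def)
  have "(\<Sum>k::nat. ennreal (if k = 0 then 1 else 0) * c) = c" for c :: ennreal
  proof -
    have "(\<Sum>k::nat. ennreal (if k = 0 then 1 else 0) * c) = (\<Sum>k\<in>{0::nat}. ennreal (if k = 0 then 1 else 0) * c)"
      by (rule suminf_finite) auto
    also have "\<dots> = c" by simp
    finally show ?thesis .
  qed
  then show "energy N A (pure_mixture \<psi>) = pure_energy N A \<psi>"
    by (simp add: energy_def pure_mixture_def)
qed

section \<open>The density and its two ground states\<close>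

lemma gaussian_integrable: "integrable lborel (\<lambda>x::real^3. exp (- sq x / 2))"
proof -
  let ?h = "\<lambda>t::real. ennreal (exp (- t)) * indicator {0..} t"
  have h: "(\<integral>\<^sup>+t. ?h t \<partial>lborel) = ennreal (0 - - exp (- 0))"
  proof (rule nn_integral_FTC_atLeast)
    show "((\<lambda>t. - exp (- t)) \<longlongrightarrow> (0::real)) at_top"
      using tendsto_minus[OF filterlim_compose[OF exp_at_bot filterlim_uminus_at_bot_at_top]] by simp
    show "((\<lambda>t. - exp (- t)) has_real_derivative exp (- x)) (at x)" for x :: real
      by (auto intro!: derivative_eq_intros)
  qed auto
  have h': "(\<integral>\<^sup>+t. ?h (- t) \<partial>lborel) = (\<integral>\<^sup>+t. ?h t \<partial>lborel)"
  proof -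
    have "(\<integral>\<^sup>+t. ?h t \<partial>lborel) = (\<integral>\<^sup>+t. ?h t \<partial>distr lborel borel uminus)"
      by (simp only: lborel_distr_uminus)
    also have "\<dots> = (\<integral>\<^sup>+t. ?h (- t) \<partial>lborel)" by (rule nn_integral_distr) measurable
    finally show ?thesis by simp
  qed
  \<comment> \<open>From (|t| - 1)^2 >= 0.\<close>
  have pt: "exp (- t\<^sup>2 / 2) \<le> exp (1/2) * exp (- \<bar>t\<bar>)" for t :: real
  proof -
    have "\<bar>t\<bar> \<le> 1/2 + t\<^sup>2 / 2"
      using zero_le_power2[of "\<bar>t\<bar> - 1"] by (simp add: power2_diff)
    then show ?thesis by (simp add: exp_add[symmetric])
  qed
  have one: "(\<integral>\<^sup>+t. ennreal (exp (- (t::real)\<^sup>2 / 2)) \<partial>lborel) < \<infinity>"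
  proof -
    have "(\<integral>\<^sup>+t. ennreal (exp (- (t::real)\<^sup>2 / 2)) \<partial>lborel) \<le> (\<integral>\<^sup>+t. ennreal (exp (1/2)) * (?h t + ?h (- t)) \<partial>lborel)"
    proof (rule nn_integral_mono)
      fix t :: real
      have "ennreal (exp (- t\<^sup>2 / 2)) \<le> ennreal (exp (1/2)) * ennreal (exp (- \<bar>t\<bar>))"
        using pt[of t] by (simp add: ennreal_mult[symmetric] ennreal_leI)
      also have "\<dots> \<le> ennreal (exp (1/2)) * (?h t + ?h (- t))"
        by (intro mult_left_mono) (auto simp: indicator_def)
      finally show "ennreal (exp (- t\<^sup>2 / 2)) \<le> ennreal (exp (1/2)) * (?h t + ?h (- t))" .
    qed
    also have "\<dots> = ennreal (exp (1/2)) * ((\<integral>\<^sup>+t. ?h t \<partial>lborel) + (\<integral>\<^sup>+t. ?h (- t) \<partial>lborel))"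
      by (subst nn_integral_cmult, measurable, subst nn_integral_add) measurable
    also have "\<dots> < \<infinity>" unfolding h' h by (simp add: ennreal_mult_less_top)
    finally show ?thesis .
  qed
  have "exp (- sq x / 2) = (\<Prod>b\<in>Basis. exp (- (x \<bullet> b)\<^sup>2 / 2))" for x :: "real^3"
  proof -
    have "- sq x / 2 = (\<Sum>b\<in>Basis. - (x \<bullet> b)\<^sup>2 / 2)"
      unfolding power2_norm_eq_inner euclidean_inner[of x x]
      by (simp add: sum_negf sum_divide_distrib power2_eq_square)
    then show ?thesis by (simp add: exp_sum)
  qed
  then have "(\<integral>\<^sup>+x. ennreal (exp (- sq (x::real^3) / 2)) \<partial>lborel)
    = (\<integral>\<^sup>+x. (\<Prod>b\<in>Basis. ennreal (exp (- ((x::real^3) \<bullet> b)\<^sup>2 / 2))) \<partial>lborel)"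
    by (simp add: prod_ennreal)
  also have "\<dots> = (\<Prod>b\<in>(Basis :: (real^3) set). \<integral>\<^sup>+t. ennreal (exp (- (t::real)\<^sup>2 / 2)) \<partial>lborel)"
    by (rule nn_integral_lborel_prod) auto
  also have "\<dots> < \<infinity>"
    using one by (simp add: power_less_top_ennreal)
  finally show ?thesis by (intro integrableI_bounded) auto
qed

section \<open>The density: normalization and weighted integrability\<close>

definition profile :: "real^3 \<Rightarrow> real" where
  "profile x = r2 x * exp (- sq x)"

lemma profile_measurable [measurable]: "profile \<in> borel_measurable borel"
  unfolding profile_def[abs_def] by measurable

lemma profile_pos: "r2 x \<noteq> 0 \<Longrightarrow> 0 < profile x"
  using r2_nonneg[of x] by (simp add: profile_def less_le)

lemma weighted_profile_integrable:
  "integrable lborel (\<lambda>x. (1 + 1 / r2 x + sq x) * profile x)"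
proof (rule Bochner_Integration.integrable_bound)
  show "integrable lborel (\<lambda>x::real^3. 8 * exp (- sq x / 2))"
    using gaussian_integrable by simp
  \<comment> \<open>Half of the Gaussian decay pays for the polynomial: 8 (1 + t/2 + t^2/8)
    dominates 1 + t + t^2 and is at most 8 exp(t/2).\<close>
  have "(1 + 1 / r2 x + sq x) * profile x \<le> 8 * exp (- sq x / 2)" for x
  proof -
    define t where "t = sq x"
    have t: "0 \<le> t" "r2 x \<le> t" by (auto simp: t_def norm_square_vec3 r2_def)
    have "(1 + 1 / r2 x + t) * r2 x \<le> (1 + t) * r2 x + 1"
      by (cases "r2 x = 0") (auto simp: distrib_right)
    also have "\<dots> \<le> (1 + t) * t + 1" using t by (intro add_mono mult_left_mono) auto
    also have "\<dots> \<le> 8 * (1 + t/2 + (t/2)\<^sup>2 / 2)"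
      using t by (simp add: power2_eq_square algebra_simps)
    also have "\<dots> \<le> 8 * exp (t/2)"
      using exp_lower_Taylor_quadratic[of "t/2"] t by simp
    finally have "(1 + 1 / r2 x + t) * r2 x * exp (- t) \<le> 8 * exp (t/2) * exp (- t)"
      by (rule mult_right_mono) simp
    also have "\<dots> = 8 * exp (- t / 2)" by (simp add: exp_add[symmetric] mult.assoc)
    finally show ?thesis by (simp add: profile_def t_def mult.assoc)
  qed
  then show "AE x in lborel. norm ((1 + 1 / r2 x + sq x) * profile x) \<le> norm (8 * exp (- sq (x::real^3) / 2))"
    by (intro AE_I2) (simp add: profile_def abs_mult)
qed measurable

lemma profile_integrable: "integrable lborel profile"
proof (rule Bochner_Integration.integrable_bound[OF weighted_profile_integrable])
  have "profile x \<le> (1 + 1 / r2 x + sq x) * profile x" for x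
    by (simp add: distrib_right profile_def)
  then show "AE x in lborel. norm (profile x) \<le> norm ((1 + 1 / r2 x + sq x) * profile x)"
    by (intro AE_I2) (simp add: profile_def abs_mult)
qed measurable

lemma integral_AE_pos:
  fixes f :: "real^3 \<Rightarrow> real"
  assumes f: "integrable lborel f" and pos: "\<And>x. 0 \<le> f x" "\<And>x. r2 x \<noteq> 0 \<Longrightarrow> 0 < f x"
  shows "0 < (LBINT x. f x)"
proof (rule ccontr)
  assume "\<not> 0 < (LBINT x. f x)"
  moreover have "0 \<le> (LBINT x. f x)" using pos by (intro integral_nonneg_AE) auto
  ultimately have "(LBINT x. f x) = 0" by linarith
  then have "AE x in lborel. f x = 0" using f pos by (subst (asm) integral_nonneg_eq_0_iff_AE) auto
  with AE_r2_nonzero have "AE x::real^3 in lborel. False"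
    by eventually_elim (use pos(2) in fastforce)
  then have "emeasure lborel (UNIV :: (real^3) set) = 0"
    by (simp add: AE_iff_measurable[of UNIV])
  then show False by simp
qed

definition profile_mass :: real where "profile_mass = (LBINT x. profile x)"

lemma profile_mass_pos: "0 < profile_mass"
  unfolding profile_mass_def by (rule integral_AE_pos[OF profile_integrable _ profile_pos]) (simp add: profile_def)

definition rho :: "real^3 \<Rightarrow> real" where "rho x = profile x / profile_mass"

lemma rho_measurable [measurable]: "rho \<in> borel_measurable borel"
  unfolding rho_def[abs_def] by measurable

lemma rho_nonneg [simp]: "0 \<le> rho x"
  using profile_mass_pos by (simp add: rho_def profile_def)

lemma rho_pos: "r2 x \<noteq> 0 \<Longrightarrow> 0 < rho x"
  using profile_mass_pos profile_pos by (simp add: rho_def)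

lemma weighted_rho_integrable: "integrable lborel (\<lambda>x. (1 + 1 / r2 x + sq x) * rho x)"
  using weighted_profile_integrable by (simp add: rho_def)

lemma rho_integrable: "integrable lborel rho" and integral_rho: "(LBINT x. rho x) = 1"
  using profile_integrable profile_mass_pos by (simp_all add: rho_def[abs_def] profile_mass_def)

text \<open>The state sqrt(rho) exp(i phi) in Cartesian form, which shows that it is smooth across
  the axis.\<close>

definition psi1 :: "real^3 \<Rightarrow> complex" where
  "psi1 x = (exp (- sq x / 2) / sqrt profile_mass) *\<^sub>R (x$1 *\<^sub>R 1 + x$2 *\<^sub>R \<i>)"

definition grad1 :: "real^3 \<Rightarrow> complex^3" where
  "grad1 x = (\<chi> a. (exp (- sq x / 2) / sqrt profile_mass) *\<^sub>R
     ((if a = 1 then 1 else if a = 2 then \<i> else 0) - x$a *\<^sub>R (x$1 *\<^sub>R 1 + x$2 *\<^sub>R \<i>)))"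

definition psi0 :: "real^3 \<Rightarrow> complex" where "psi0 x = of_real (sqrt (rho x))"

text \<open>Off the axis \<open>drift\<close> is the logarithmic gradient of sqrt(rho). On the axis
  \<open>psi0\<close> has a conical kink, so there this is only a representative of the weak
  gradient.\<close>

definition grad0 :: "real^3 \<Rightarrow> complex^3" where "grad0 x = (\<chi> a. (drift x $ a) *\<^sub>R psi0 x)"

lemma norm_psi1: "sq (psi1 x) = rho x"
proof -
  have "(exp (- sq x / 2))\<^sup>2 = exp (- sq x)"
    by (simp add: power2_eq_square exp_add[symmetric])
  then show ?thesis
    using profile_mass_pos by (simp add: psi1_def power_mult_distrib power_divide cmod_power2 rho_def profile_def r2_def)
qed

lemma norm_psi0: "sq (psi0 x) = rho x"
  by (simp add: psi0_def)

lemma psi1_C1: "C1_gradient psi1 grad1"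
  unfolding C1_gradient_def
proof (intro conjI allI)
  show "continuous_on UNIV grad1"
    unfolding grad1_def
  proof (intro continuous_on_vec_lambda)
    fix a :: 3
    show "continuous_on UNIV (\<lambda>x. (exp (- sq x / 2) / sqrt profile_mass) *\<^sub>R
     ((if a = 1 then 1 else if a = 2 then \<i> else 0) - x$a *\<^sub>R (x$1 *\<^sub>R 1 + x$2 *\<^sub>R \<i>)))"
      using profile_mass_pos by (intro continuous_intros) auto
  qed
  fix x :: "real^3"
  have c: "((\<lambda>x::real^3. x$i) has_derivative (\<lambda>v. v$i)) (at x)" for i
    by (rule bounded_linear_imp_has_derivative[OF bounded_linear_vec_nth])
  have n: "((\<lambda>x. - sq x / 2) has_derivative (\<lambda>v. - (x$1 * v$1 + x$2 * v$2 + x$3 * v$3))) (at x)"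
    unfolding norm_square_vec3
    by (rule has_derivative_eq_rhs, (rule derivative_intros c)+) (simp_all add: fun_eq_iff)
  have E: "((\<lambda>x. exp (- sq x / 2) / sqrt profile_mass) has_derivative
    (\<lambda>v. (- (x$1 * v$1 + x$2 * v$2 + x$3 * v$3)) * exp (- sq x / 2) / sqrt profile_mass)) (at x)"
    using bounded_linear.has_derivative[OF bounded_linear_divide has_derivative_exp[OF n], of "sqrt profile_mass"]
    by (simp add: mult.commute)
  have L: "((\<lambda>x::real^3. x$1 *\<^sub>R (1::complex) + x$2 *\<^sub>R \<i>) has_derivative (\<lambda>v. v$1 *\<^sub>R 1 + v$2 *\<^sub>R \<i>)) (at x)"
    by (intro has_derivative_add has_derivative_scaleR_left c)
  show "(psi1 has_derivative (\<lambda>v. \<Sum>a\<in>UNIV. v$a *\<^sub>R grad1 x$a)) (at x)"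
    unfolding psi1_def[abs_def]
    by (rule has_derivative_eq_rhs[OF has_derivative_scaleR[OF E L]])
       (simp add: fun_eq_iff sum_3 grad1_def complex_eq_iff add_divide_distrib diff_divide_distrib algebra_simps)
qed

text \<open>The logarithmic gradient of sqrt(rho) exp(i phi) is drift + i grad phi, and grad phi =
  -2 \<open>flux\<close>.\<close>

lemma grad1_eq:
  assumes r: "r2 x \<noteq> 0"
  shows "grad1 x $ a = Complex (drift x $ a) (- 2 * flux x $ a) * psi1 x"
proof -
  define E where "E = exp (- sq x / 2) / sqrt profile_mass"
  have rr: "x$1 * (x$1 * E) / r2 x + x$2 * (x$2 * E) / r2 x = E"
  proof -
    have "x$1 * (x$1 * E) + x$2 * (x$2 * E) = r2 x * E" by (simp add: r2_def power2_eq_square algebra_simps)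
    then show ?thesis using r by (simp add: add_divide_distrib[symmetric])
  qed
  have "a = 1 \<or> a = 2 \<or> a = 3" using exhaust_3 by blast
  then show ?thesis
    unfolding grad1_def psi1_def E_def[symmetric]
    using rr by (elim disjE) (simp_all add: complex_eq_iff algebra_simps)
qed

lemma psi1_products:
  assumes r: "r2 x \<noteq> 0"
  shows "Re (cnj (psi1 x) * grad1 x $ a) = drift x $ a * rho x"
    and "Im (cnj (psi1 x) * grad1 x $ a) = - 2 * flux x $ a * rho x"
proof -
  have "cnj (psi1 x) * grad1 x $ a = Complex (drift x $ a) (- 2 * flux x $ a) * (psi1 x * cnj (psi1 x))"
    unfolding grad1_eq[OF r] by (simp add: ac_simps)
  also have "psi1 x * cnj (psi1 x) = of_real (rho x)"
    by (simp add: complex_norm_square[symmetric] norm_psi1[symmetric])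
  finally have e: "cnj (psi1 x) * grad1 x $ a = Complex (drift x $ a) (- 2 * flux x $ a) * of_real (rho x)" .
  show "Re (cnj (psi1 x) * grad1 x $ a) = drift x $ a * rho x"
    and "Im (cnj (psi1 x) * grad1 x $ a) = - 2 * flux x $ a * rho x"
    unfolding e by simp_all
qed

lemma norm_grad1:
  assumes r: "r2 x \<noteq> 0"
  shows "sq (grad1 x) = (sq (drift x) + 1 / r2 x) * rho x"
proof -
  have "sq (grad1 x $ a) = ((drift x $ a)\<^sup>2 + 4 * (flux x $ a)\<^sup>2) * rho x" for a
    unfolding grad1_eq[OF r] norm_mult power_mult_distrib norm_psi1 by (simp add: cmod_power2 power_mult_distrib)
  then have "sq (grad1 x) = (sq (drift x) + 4 * sq (flux x)) * rho x"
    unfolding norm_square_cvec3 norm_square_vec3[of "drift x"] norm_square_vec3[of "flux x"]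
    by (simp only:) (simp only: algebra_simps)
  then show ?thesis using norm_flux[OF r] by simp
qed

lemma norm_grad0: "sq (grad0 x) = sq (drift x) * rho x"
  unfolding norm_square_cvec3 norm_square_vec3 grad0_def vec_lambda_beta norm_scaleR power_mult_distrib norm_psi0 power2_abs
  by (simp add: algebra_simps)

lemma psi1_measurable [measurable]: "psi1 \<in> borel_measurable borel" "grad1 \<in> borel_measurable borel"
proof -
  have "continuous_on UNIV psi1"
    using psi1_C1 by (auto simp: C1_gradient_def intro!: continuous_at_imp_continuous_on has_derivative_continuous)
  then show "psi1 \<in> borel_measurable borel" by (rule borel_measurable_continuous_onI)
  show "grad1 \<in> borel_measurable borel"
    using psi1_C1 by (auto simp: C1_gradient_def intro: borel_measurable_continuous_onI)
qed

lemma psi0_measurable [measurable]: "psi0 \<in> borel_measurable borel" "grad0 \<in> borel_measurable borel"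
proof -
  show [measurable]: "psi0 \<in> borel_measurable borel" unfolding psi0_def[abs_def] by measurable
  show "grad0 \<in> borel_measurable borel" by (rule vec_lambda_measurable) (simp add: grad0_def)
qed

lemma weighted_psi: "weighted psi1" "weighted psi0"
  using weighted_rho_integrable by (simp_all add: weighted_def norm_psi1 norm_psi0)

lemma drift_rho_bound:
  assumes r: "r2 x \<noteq> 0" shows "(sq (drift x) + 1 / r2 x) * rho x \<le> 2 * ((1 + 1 / r2 x + sq x) * rho x)"
proof -
  have "0 \<le> sq x" by simp
  then have "sq (drift x) + 1 / r2 x \<le> 2 * (1 + 1 / r2 x + sq x)" unfolding norm_drift[OF r] by argo
  from mult_right_mono[OF this, of "rho x"] show ?thesis by (simp only: mult.assoc rho_nonneg)
qed

lemma l2_grad: "l2 grad1" "l2 grad0"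
proof -
  have i: "integrable lborel (\<lambda>x. 2 * ((1 + 1 / r2 x + sq x) * rho x))" using weighted_rho_integrable by simp
  have "AE x in lborel. norm (sq (grad1 x)) \<le> norm (2 * ((1 + 1 / r2 x + sq x) * rho x))"
    using AE_r2_nonzero
  proof eventually_elim
    fix x assume r: "r2 x \<noteq> 0"
    show "norm (sq (grad1 x)) \<le> norm (2 * ((1 + 1 / r2 x + sq x) * rho x))"
      using drift_rho_bound[OF r] unfolding norm_grad1[OF r, symmetric] by (auto intro: order_trans[OF _ abs_ge_self])
  qed
  then have "integrable lborel (\<lambda>x. sq (grad1 x))" by (intro Bochner_Integration.integrable_bound[OF i]) measurable
  then show "l2 grad1" by (simp add: l2_def)
  have "AE x in lborel. norm (sq (grad0 x)) \<le> norm (2 * ((1 + 1 / r2 x + sq x) * rho x))"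
    using AE_r2_nonzero
  proof eventually_elim
    fix x assume r: "r2 x \<noteq> 0"
    have "sq (drift x) * rho x \<le> (sq (drift x) + 1 / r2 x) * rho x" by (intro mult_right_mono) auto
    from order_trans[OF this drift_rho_bound[OF r]]
    show "norm (sq (grad0 x)) \<le> norm (2 * ((1 + 1 / r2 x + sq x) * rho x))"
      unfolding norm_grad0[symmetric] by (auto intro: order_trans[OF _ abs_ge_self])
  qed
  then have "integrable lborel (\<lambda>x. sq (grad0 x))" by (intro Bochner_Integration.integrable_bound[OF i]) measurable
  then show "l2 grad0" by (simp add: l2_def)
qed

lemma l2_test_function:
  fixes \<phi> :: "real^3 \<Rightarrow> real"
  assumes c: "continuous_on UNIV \<phi>" and R: "\<And>x. R < norm x \<Longrightarrow> \<phi> x = 0" shows "l2 (\<lambda>x. complex_of_real (\<phi> x))"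
proof -
  have "compact (\<phi> ` cball 0 R)"
    by (intro compact_continuous_image continuous_on_subset[OF c]) auto
  then obtain C where C: "\<And>x. x \<in> cball 0 R \<Longrightarrow> norm (\<phi> x) \<le> C"
    by (meson bounded_iff compact_imp_bounded imageI)
  have [measurable]: "\<phi> \<in> borel_measurable borel" by (rule borel_measurable_continuous_onI[OF c])
  show ?thesis
  proof (rule l2_bounded_support[where C="max C 0" and x=0 and r=R])
    show "norm (complex_of_real (\<phi> y)) \<le> max C 0" for y
      using C[of y] R[of y] by (cases "y \<in> cball 0 R") auto
    show "complex_of_real (\<phi> y) = 0" if "y \<notin> cball 0 R" for y using R[of y] that by auto
  qed measurable
qed

text \<open>A product with a test function is differentiable off the axis and integrable together
  with its derivative, so that derivative has integral 0. This admits functions with a kink on the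
  axis.\<close>

lemma weak_grad3I:
  assumes l: "l2 \<psi>" "l2 g" and c: "continuous_on {x. r2 x \<noteq> 0} \<psi>" "\<And>a. continuous_on {x. r2 x \<noteq> 0} (\<lambda>x. g x $ a)"
    and d: "\<And>x a. r2 x \<noteq> 0 \<Longrightarrow> ((\<lambda>t. \<psi> (x + t *\<^sub>R axis a 1)) has_vector_derivative g x $ a) (at 0)"
  shows "weak_grad3 \<psi> g"
  unfolding weak_grad3_def
proof (intro conjI allI impI l)
  fix a \<phi> D assume t: "test3 \<phi> D"
  obtain R where R: "\<And>x. R < norm x \<Longrightarrow> \<phi> x = 0" using t by (auto simp: test3_def)
  have cp: "continuous_on UNIV \<phi>" "continuous_on UNIV (D a)" using t by (auto simp: test3_def)
  have dp: "((\<lambda>t. \<phi> (x + t *\<^sub>R axis a 1)) has_real_derivative D a x) (at 0)" for x using t by (auto simp: test3_def)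
  \<comment> \<open>Where the test function vanishes on an open set its derivative vanishes too, so
    the derivative inherits the bounded support.\<close>
  have RD: "D a x = 0" if x: "R < norm x" for x
  proof -
    have "eventually (\<lambda>t::real. R < norm (x + t *\<^sub>R axis a 1)) (nhds 0)"
    proof -
      have "open {t::real. R < norm (x + t *\<^sub>R axis a 1)}"
        by (intro open_Collect_less continuous_intros)
      with x show ?thesis
        by (auto simp: eventually_nhds intro!: exI[of _ "{t::real. R < norm (x + t *\<^sub>R axis a 1)}"])
    qed
    then have "eventually (\<lambda>t::real. \<phi> (x + t *\<^sub>R axis a 1) = 0) (nhds 0)"
      by eventually_elim (rule R)
    then have "((\<lambda>t. \<phi> (x + t *\<^sub>R axis a 1)) has_real_derivative 0) (at 0)"
      by (subst DERIV_cong_ev[OF refl _ refl, where g="\<lambda>_. 0"]) auto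
    from DERIV_unique[OF dp this] show ?thesis .
  qed
  have lp: "l2 (\<lambda>x. complex_of_real (\<phi> x))" "l2 (\<lambda>x. complex_of_real (D a x))"
    by (rule l2_test_function[OF cp(1) R], assumption) (rule l2_test_function[OF cp(2) RD], assumption)
  let ?h = "\<lambda>x. \<psi> x * of_real (\<phi> x)"
  let ?D = "\<lambda>x. \<psi> x * of_real (D a x) + g x $ a * of_real (\<phi> x)"
  have i: "integrable lborel ?h" "integrable lborel (\<lambda>x. \<psi> x * of_real (D a x))" "integrable lborel (\<lambda>x. g x $ a * of_real (\<phi> x))"
    by (intro l2_mult_integrable l lp l2_component)+
  have "(LBINT x. ?D x) = 0"
  proof (rule integral_partial_derivative_zero[of ?h ?D a])
    show "continuous_on {y. r2 y \<noteq> 0} ?D"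
      by (intro continuous_intros c continuous_on_subset[OF cp(1)] continuous_on_subset[OF cp(2)]) auto
    fix y assume r: "r2 y \<noteq> 0"
    have "((\<lambda>t. \<psi> (y + t *\<^sub>R axis a 1) * of_real (\<phi> (y + t *\<^sub>R axis a 1))) has_vector_derivative
       \<psi> (y + 0 *\<^sub>R axis a 1) * of_real (D a y) + g y $ a * of_real (\<phi> (y + 0 *\<^sub>R axis a 1))) (at 0)"
      by (intro has_vector_derivative_mult d r has_vector_derivative_of_real dp)
    then show "((\<lambda>t. ?h (y + t *\<^sub>R axis a 1)) has_vector_derivative ?D y) (at 0)" by simp
  qed (use i in auto)
  then show "(LBINT x. \<psi> x * of_real (D a x)) = - (LBINT x. (g x $ a) * of_real (\<phi> x))"
    using i by (simp add: eq_neg_iff_add_eq_0)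
qed

lemma psi1_partial: "((\<lambda>t. psi1 (x + t *\<^sub>R axis a 1)) has_vector_derivative grad1 x $ a) (at 0)"
  using psi1_C1 by (intro C1_gradient_partial) (auto simp: C1_gradient_def)

lemma weak_grad_psi1: "weak_grad3 psi1 grad1"
proof (rule weak_grad3I)
  have g: "continuous_on UNIV grad1" using psi1_C1 by (simp add: C1_gradient_def)
  have "continuous_on UNIV psi1"
    using psi1_C1 by (auto simp: C1_gradient_def intro!: continuous_at_imp_continuous_on has_derivative_continuous)
  then show "continuous_on {x. r2 x \<noteq> 0} psi1" by (rule continuous_on_subset) auto
  show "continuous_on {x. r2 x \<noteq> 0} (\<lambda>x. grad1 x $ a)" for a
    by (intro continuous_intros continuous_on_subset[OF g]) auto
qed (use l2_grad weighted_l2[OF weighted_psi(1)] psi1_partial in auto)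

lemma weak_grad_psi0: "weak_grad3 psi0 grad0"
proof (rule weak_grad3I)
  have rc: "continuous_on S rho" for S
    unfolding rho_def profile_def using profile_mass_pos by (intro continuous_intros) auto
  then show c0: "continuous_on {x. r2 x \<noteq> 0} psi0"
    unfolding psi0_def[abs_def] by (intro continuous_intros)
  fix a :: 3
  have "continuous_on {x. r2 x \<noteq> 0} (\<lambda>x. drift x $ a)"
  proof -
    have "a = 1 \<or> a = 2 \<or> a = 3" using exhaust_3 by blast
    then show ?thesis by (elim disjE; simp; auto intro!: continuous_intros)
  qed
  with c0 show "continuous_on {x. r2 x \<noteq> 0} (\<lambda>x. grad0 x $ a)"
    unfolding grad0_def vec_lambda_beta by (intro continuous_on_scaleR)
  fix x :: "real^3" assume r: "r2 x \<noteq> 0"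
  \<comment> \<open>The derivative of rho is read off from rho = |psi1|^2, and sqrt(rho) is then
    differentiated by the chain rule.\<close>
  have "((\<lambda>t. rho (x + t *\<^sub>R axis a 1)) has_real_derivative 2 * (drift x $ a * rho x)) (at 0)"
    using norm_square_has_derivative[OF psi1_partial, of x a]
    unfolding norm_psi1 has_real_derivative_iff_has_vector_derivative scaleR_zero_left add_0_right psi1_products(1)[OF r] .
  from DERIV_chain2[OF DERIV_real_sqrt this, of]
  have "((\<lambda>t. sqrt (rho (x + t *\<^sub>R axis a 1))) has_real_derivative
     inverse (sqrt (rho x)) / 2 * (2 * (drift x $ a * rho x))) (at 0)"
    using rho_pos[OF r] by simp
  also have "inverse (sqrt (rho x)) / 2 * (2 * (drift x $ a * rho x)) = drift x $ a * sqrt (rho x)"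
    using rho_pos[OF r] by (simp add: field_simps)
  finally show "((\<lambda>t. psi0 (x + t *\<^sub>R axis a 1)) has_vector_derivative grad0 x $ a) (at 0)"
    unfolding psi0_def grad0_def vec_lambda_beta by (auto dest!: has_vector_derivative_of_real simp: scaleR_conv_of_real)
qed (use l2_grad weighted_l2[OF weighted_psi(2)] in auto)

section \<open>Energies of the two trial states\<close>

definition centrifugal :: "real^3 \<Rightarrow> real" where "centrifugal x = rho x / r2 x"

lemma centrifugal_measurable [measurable]: "centrifugal \<in> borel_measurable borel"
  unfolding centrifugal_def[abs_def] by measurable

lemma centrifugal_nonneg [simp]: "0 \<le> centrifugal x" by (simp add: centrifugal_def)

text \<open>The mean of 1/r^2 in the density. Energies and penalties below are affine in this
  number, and the contradiction rests on its positivity.\<close>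

definition inertia :: real where "inertia = (LBINT x. centrifugal x)"

lemma rho_r2_integrable: "integrable lborel (\<lambda>x. centrifugal x)"
proof (rule Bochner_Integration.integrable_bound[OF weighted_rho_integrable])
  have "centrifugal x \<le> (1 + 1 / r2 x + sq x) * rho x" for x
    by (simp add: distrib_right centrifugal_def)
  then show "AE x in lborel. norm (centrifugal x) \<le> norm ((1 + 1 / r2 x + sq x) * rho x)"
    by (intro AE_I2) (simp add: abs_mult)
qed measurable

lemma inertia_pos: "0 < inertia"
  unfolding inertia_def
proof (rule integral_AE_pos[OF rho_r2_integrable])
  show "r2 x \<noteq> 0 \<Longrightarrow> 0 < centrifugal x" for x
    using rho_pos[of x] r2_nonneg[of x] by (simp add: less_le centrifugal_def)
qed simp

text \<open>Since grad rho = 2 rho drift, the derivative of rho along \<open>drift\<close> is 2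
  |drift|^2 rho; its integral is 3 by \<open>integral_dflow\<close>, applied to the smooth state
  \<open>psi1\<close>.\<close>

lemma drift_rho:
  "integrable lborel (\<lambda>x. sq (drift x) * rho x)" "(LBINT x. sq (drift x) * rho x) = 3/2"
proof -
  show i: "integrable lborel (\<lambda>x. sq (drift x) * rho x)"
    using l2_integrable[OF l2_grad(2)] by (simp add: norm_grad0)
  have "3 = (LBINT x. dflow (psi1 x) (grad1 x) x)"
    using integral_dflow(2)[OF psi1_C1 weighted_psi(1) l2_grad(1)] by (simp add: norm_psi1 integral_rho)
  also have "\<dots> = (LBINT x. 2 * (sq (drift x) * rho x))"
  proof (rule integral_cong_AE)
    show "AE x in lborel. dflow (psi1 x) (grad1 x) x = 2 * (sq (drift x) * rho x)"
      using AE_r2_nonzero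
    proof eventually_elim
      fix x assume r: "r2 x \<noteq> 0"
      show "dflow (psi1 x) (grad1 x) x = 2 * (sq (drift x) * rho x)"
        unfolding dflow_def sum_3 psi1_products(1)[OF r] norm_square_vec3 by (simp only: power2_eq_square algebra_simps)
    qed
    show "(\<lambda>x. dflow (psi1 x) (grad1 x) x) \<in> borel_measurable lborel"
      using integral_dflow(1)[OF psi1_C1 weighted_psi(1) l2_grad(1)] by (rule borel_measurable_integrable)
    show "(\<lambda>x. 2 * (sq (drift x) * rho x)) \<in> borel_measurable lborel"
      using borel_measurable_integrable[OF i] by measurable
  qed
  also have "\<dots> = 2 * (LBINT x. sq (drift x) * rho x)" by simp
  finally show "(LBINT x. sq (drift x) * rho x) = 3/2" by simp
qed

text \<open>Off the axis \<open>weight s\<close> = |drift|^2/2 + 1 - s^2/(8 r2), and the constant is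
  7/4 = (3/2)/2 + 1.\<close>

lemma nn_integral_weight_rho:
  assumes s: "0 \<le> s" "s \<le> 1"
  shows "(\<integral>\<^sup>+x. ennreal (weight s x * rho x) \<partial>lborel) = ennreal (7/4 - s\<^sup>2 * inertia / 8)"
    and "0 \<le> 7/4 - s\<^sup>2 * inertia / 8"
proof -
  let ?f = "\<lambda>x. 1/2 * (sq (drift x) * rho x) - s\<^sup>2 / 8 * centrifugal x + rho x"
  have i: "integrable lborel ?f" using drift_rho(1) rho_r2_integrable rho_integrable by auto
  have ae: "AE x in lborel. weight s x * rho x = ?f x"
    using AE_r2_nonzero
  proof eventually_elim
    fix x assume r: "r2 x \<noteq> 0"
    show "weight s x * rho x = ?f x"
      unfolding norm_drift[OF r] weight_def centrifugal_def using r by (simp add: field_simps)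
  qed
  have I: "(LBINT x. ?f x) = 7/4 - s\<^sup>2 * inertia / 8"
    using drift_rho rho_r2_integrable rho_integrable by (simp add: integral_rho inertia_def)
  have "0 \<le> (LBINT x. weight s x * rho x)"
    using weight_bounds(1)[OF s] by (intro integral_nonneg_AE) auto
  also have e: "(LBINT x. weight s x * rho x) = (LBINT x. ?f x)"
    using borel_measurable_integrable[OF i] by (intro integral_cong_AE ae) auto
  finally show "0 \<le> 7/4 - s\<^sup>2 * inertia / 8" unfolding I .
  have "integrable lborel (\<lambda>x. weight s x * rho x)"
    using ae by (intro integrable_cong_AE_imp[OF i]) (auto elim!: eventually_mono)
  then show "(\<integral>\<^sup>+x. ennreal (weight s x * rho x) \<partial>lborel) = ennreal (7/4 - s\<^sup>2 * inertia / 8)"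
    using weight_bounds(1)[OF s] e I by (subst nn_integral_eq_integral) auto
qed

text \<open>The potential energy is the same for all mixtures of density \<open>rho\<close>;
  subtracting it from 5/2 leaves 5/2 - 7/4 = 3/4.\<close>

lemma energy_ge:
  assumes "mixed_state 1 \<Gamma>" "has_density 1 \<Gamma> rho" and s: "0 \<le> s" "s \<le> 1"
  shows "ennreal (3/4 + s\<^sup>2 * inertia / 8) \<le> energy 1 (\<lambda>x. s *\<^sub>R flux x) \<Gamma>"
proof -
  note w = nn_integral_weight_rho[OF s]
  have "ennreal (5/2) \<le> energy 1 (\<lambda>x. s *\<^sub>R flux x) \<Gamma> + ennreal (7/4 - s\<^sup>2 * inertia / 8)"
    using mixed_energy_lower_bound[OF assms] by (simp only: w)
  then show ?thesis
    using w(2) inertia_pos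
    by (cases "energy 1 (\<lambda>x. s *\<^sub>R flux x) \<Gamma>") (auto simp: ennreal_plus[symmetric] mult.commute[of _ "s\<^sup>2"] simp del: ennreal_plus)
qed

abbreviation "\<Gamma>0 \<equiv> pure_mixture (\<lambda>x. psi0 (x 0))"
abbreviation "\<Gamma>1 \<equiv> pure_mixture (\<lambda>x. psi1 (x 0))"

lemma scaled_flux_measurable: "(\<lambda>x. (s *\<^sub>R flux x) $ a) \<in> borel_measurable borel" by simp

text \<open>The energy equals the lower bound in \<open>energy_ge\<close>, so \<open>psi0\<close> is
  optimal for every s in [0, 1].\<close>

lemma trial_psi0:
  "mixed_state 1 \<Gamma>0" "has_density 1 \<Gamma>0 rho" "has_para_current 1 \<Gamma>0 (\<lambda>_. 0)"
  "energy 1 (\<lambda>x. s *\<^sub>R flux x) \<Gamma>0 = ennreal (3/4 + s\<^sup>2 * inertia / 8)"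
proof -
  have n: "(LBINT x. sq (psi0 x)) = 1" by (simp add: norm_psi0 integral_rho)
  note p = trial_state(1)[OF weak_grad_psi0 n] and g = trial_state(2)[OF weak_grad_psi0 n]
  note M = pure_mixture[OF p]
  show "mixed_state 1 \<Gamma>0" by (rule M)
  show "has_density 1 \<Gamma>0 rho" unfolding M density_1 by (simp add: norm_psi0)
  have im: "Im (cnj (psi0 x) * grad0 x $ a) = 0" for x a by (simp add: psi0_def grad0_def)
  show "has_para_current 1 \<Gamma>0 (\<lambda>_. 0)"
    unfolding M para_current_1 using g
  proof eventually_elim
    fix r assume "wgrad 1 (\<lambda>x. psi0 (x 0)) 0 (conf r) = grad0 r"
    then show "(\<chi> a. Im (cnj (psi0 (conf r 0)) * wgrad 1 (\<lambda>x. psi0 (x 0)) 0 (conf r) $ a)) = 0"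
      by (simp only: conf_0 im) (simp add: vec_eq_iff)
  qed
  let ?f = "\<lambda>r. 1/2 * (sq (drift r) * rho r) + s\<^sup>2 / 8 * centrifugal r"
  have "energy 1 (\<lambda>x. s *\<^sub>R flux x) \<Gamma>0 = (\<integral>\<^sup>+r. ennreal (?f r) \<partial>lborel)"
    unfolding M pure_energy_1[OF p scaled_flux_measurable] conf_0
  proof (rule nn_integral_cong_AE)
    show "AE r in lborel. ennreal (1/2 * kinetic (\<lambda>x. s *\<^sub>R flux x) (psi0 r) (wgrad 1 (\<lambda>x. psi0 (x 0)) 0 (conf r)) r) = ennreal (?f r)"
      using g AE_r2_nonzero
    proof eventually_elim
      fix r assume e: "wgrad 1 (\<lambda>x. psi0 (x 0)) 0 (conf r) = grad0 r" and r: "r2 r \<noteq> 0"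
      have "sq (s *\<^sub>R flux r) = s\<^sup>2 * (1 / (4 * r2 r))" by (simp add: power_mult_distrib norm_flux[OF r])
      then have "1/2 * kinetic (\<lambda>x. s *\<^sub>R flux x) (psi0 r) (grad0 r) r = ?f r"
        unfolding kinetic_expand im norm_grad0 norm_psi0 centrifugal_def by simp
      then show "ennreal (1/2 * kinetic (\<lambda>x. s *\<^sub>R flux x) (psi0 r) (wgrad 1 (\<lambda>x. psi0 (x 0)) 0 (conf r)) r) = ennreal (?f r)"
        by (simp only: e)
    qed
  qed
  also have "\<dots> = ennreal (LBINT r. ?f r)"
    using drift_rho rho_r2_integrable by (intro nn_integral_eq_integral) auto
  also have "(LBINT r. ?f r) = 3/4 + s\<^sup>2 * inertia / 8"
    using drift_rho rho_r2_integrable by (simp add: inertia_def)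
  finally show "energy 1 (\<lambda>x. s *\<^sub>R flux x) \<Gamma>0 = ennreal (3/4 + s\<^sup>2 * inertia / 8)" .
qed

text \<open>The current rho grad phi of a unit winding about the axis.\<close>

definition j1 :: field where "j1 x = (- 2 * rho x) *\<^sub>R flux x"

text \<open>Without a field the winding costs \<open>inertia / 2\<close>. The coupling of
  \<open>j1\<close> to \<open>flux\<close> is -2 int rho |flux|^2 = -\<open>inertia / 2\<close>,
  which returns exactly this amount: the degeneracy at half flux.\<close>

lemma trial_psi1:
  "mixed_state 1 \<Gamma>1" "has_density 1 \<Gamma>1 rho" "has_para_current 1 \<Gamma>1 j1"
  "energy 1 (\<lambda>_. 0) \<Gamma>1 = ennreal (3/4 + inertia / 2)"
proof -
  have n: "(LBINT x. sq (psi1 x)) = 1" by (simp add: norm_psi1 integral_rho)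
  note p = trial_state(1)[OF weak_grad_psi1 n] and g = trial_state(2)[OF weak_grad_psi1 n]
  note M = pure_mixture[OF p]
  show "mixed_state 1 \<Gamma>1" by (rule M)
  show "has_density 1 \<Gamma>1 rho" unfolding M density_1 by (simp add: norm_psi1)
  show "has_para_current 1 \<Gamma>1 j1"
    unfolding M para_current_1 using g AE_r2_nonzero
  proof eventually_elim
    fix r assume e: "wgrad 1 (\<lambda>x. psi1 (x 0)) 0 (conf r) = grad1 r" and r: "r2 r \<noteq> 0"
    show "(\<chi> a. Im (cnj (psi1 (conf r 0)) * wgrad 1 (\<lambda>x. psi1 (x 0)) 0 (conf r) $ a)) = j1 r"
      unfolding e conf_0 psi1_products(2)[OF r] by (simp add: vec_eq_iff j1_def)
  qed
  let ?f = "\<lambda>r. 1/2 * (sq (drift r) * rho r) + 1/2 * centrifugal r"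
  have m0: "(\<lambda>x. (0 :: real^3) $ a) \<in> borel_measurable borel" for a by simp
  have "energy 1 (\<lambda>_. 0) \<Gamma>1 = (\<integral>\<^sup>+r. ennreal (?f r) \<partial>lborel)"
    unfolding M pure_energy_1[OF p m0] conf_0
  proof (rule nn_integral_cong_AE)
    show "AE r in lborel. ennreal (1/2 * kinetic (\<lambda>_. 0) (psi1 r) (wgrad 1 (\<lambda>x. psi1 (x 0)) 0 (conf r)) r) = ennreal (?f r)"
      using g AE_r2_nonzero
    proof eventually_elim
      fix r assume e: "wgrad 1 (\<lambda>x. psi1 (x 0)) 0 (conf r) = grad1 r" and r: "r2 r \<noteq> 0"
      have "1/2 * kinetic (\<lambda>_. 0) (psi1 r) (grad1 r) r = ?f r"
        unfolding kinetic_expand norm_grad1[OF r] centrifugal_def by (simp add: distrib_right)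
      then show "ennreal (1/2 * kinetic (\<lambda>_. 0) (psi1 r) (wgrad 1 (\<lambda>x. psi1 (x 0)) 0 (conf r)) r) = ennreal (?f r)"
        by (simp only: e)
    qed
  qed
  also have "\<dots> = ennreal (LBINT r. ?f r)"
    using drift_rho rho_r2_integrable by (intro nn_integral_eq_integral) auto
  also have "(LBINT r. ?f r) = 3/4 + inertia / 2"
    using drift_rho rho_r2_integrable by (simp add: inertia_def)
  finally show "energy 1 (\<lambda>_. 0) \<Gamma>1 = ennreal (3/4 + inertia / 2)" .
qed

text \<open>The case s = 0 of the energy bounds: \<open>psi0\<close> already minimizes the
  field-free energy among all states of density \<open>rho\<close>, and its current is 0.\<close>

lemma F_VR_0: "F_VR 1 rho (\<lambda>_. 0) = ennreal (3/4)"
proof (rule antisym)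
  show "F_VR 1 rho (\<lambda>_. 0) \<le> ennreal (3/4)"
    unfolding F_VR_def using trial_psi0(1-3) trial_psi0(4)[of 0] by (intro INF_lower2[of \<Gamma>0]) auto
  show "ennreal (3/4) \<le> F_VR 1 rho (\<lambda>_. 0)"
    unfolding F_VR_def using energy_ge[of _ 0] by (intro INF_greatest) auto
qed

lemma F_VR_j1: "F_VR 1 rho j1 \<le> ennreal (3/4 + inertia / 2)"
  unfolding F_VR_def using trial_psi1 by (intro INF_lower2[of \<Gamma>1]) auto

lemma grayce_harris_flux: "grayce_harris 1 rho flux = ennreal (3/4 + inertia / 8)"
proof (rule antisym)
  show "grayce_harris 1 rho flux \<le> ennreal (3/4 + inertia / 8)"
    unfolding grayce_harris_def using trial_psi0(1,2) trial_psi0(4)[of 1] by (intro INF_lower2[of \<Gamma>0]) auto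
  show "ennreal (3/4 + inertia / 8) \<le> grayce_harris 1 rho flux"
    unfolding grayce_harris_def using energy_ge[of _ 1] by (intro INF_greatest) auto
qed

lemma F_VR_cong_AE:
  assumes "AE r in lborel. jp r = jp' r" shows "F_VR N \<rho> jp = F_VR N \<rho> jp'"
proof -
  have "has_para_current N \<Gamma> jp \<longleftrightarrow> has_para_current N \<Gamma> jp'" for \<Gamma>
    using assms by (auto simp: has_para_current_def split_beta elim!: eventually_elim2)
  then show ?thesis by (simp add: F_VR_def)
qed

lemma AE_rho_pos: "AE r in lborel. 0 < rho r"
  using AE_r2_nonzero by eventually_elim (rule rho_pos)

lemma flux_rho:
  "integrable lborel (\<lambda>r. rho r * sq (flux r))" "(LBINT r. rho r * sq (flux r)) = inertia / 4"
proof -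
  have [measurable]: "(\<lambda>r. norm (flux r)) \<in> borel_measurable borel"
  proof -
    have "(\<lambda>r. norm (flux r)) = (\<lambda>r. sqrt ((flux r $ 1)\<^sup>2 + (flux r $ 2)\<^sup>2 + (flux r $ 3)\<^sup>2))"
      by (simp only: norm_square_vec3[symmetric] real_sqrt_abs abs_norm_cancel)
    then show ?thesis by simp
  qed
  have ae: "AE r in lborel. rho r * sq (flux r) = 1/4 * centrifugal r"
    using AE_r2_nonzero by eventually_elim (simp add: norm_flux centrifugal_def)
  have i: "integrable lborel (\<lambda>r. 1/4 * centrifugal r)" using rho_r2_integrable by simp
  show "integrable lborel (\<lambda>r. rho r * sq (flux r))"
    using ae by (intro integrable_cong_AE_imp[OF i]) (auto elim!: eventually_mono)
  have "(LBINT r. rho r * sq (flux r)) = (LBINT r. 1/4 * centrifugal r)"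
    by (intro integral_cong_AE ae) measurable
  then show "(LBINT r. rho r * sq (flux r)) = inertia / 4" by (simp add: inertia_def)
qed

lemma flux_borel: "flux \<in> borel_measurable borel"
  by (subst borel_measurable_euclidean_space) (auto simp: Basis_vec_def inner_axis)

section \<open>Diener's functional\<close>

lemma flux_kinetic_integral: "(LBINT r. 1/2 * rho r * sq (flux r)) = inertia / 8"
proof -
  have "(LBINT r. 1/2 * rho r * sq (flux r)) = (LBINT r. 1/2 * (rho r * sq (flux r)))"
    by (simp only: mult.assoc)
  also have "\<dots> = inertia / 8" using flux_rho by simp
  finally show ?thesis .
qed

lemma attains_GH_0: "attains_GH 1 rho flux (\<lambda>_. 0)"
  unfolding attains_GH_def flux_kinetic_integral F_VR_0 grayce_harris_flux
  using inertia_pos by (simp del: ennreal_plus)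

text \<open>The field energy \<open>inertia / 8\<close> appears on both sides of the attainment
  equation and cancels, which also shows that the functional is finite at \<open>jp\<close>.\<close>

lemma attains_GH_flux:
  assumes "attains_GH 1 rho flux jp"
  shows "jp \<in> borel_measurable borel" and "enn2ereal (F_VR 1 rho jp) = ereal (3/4 - (LBINT r. jp r \<bullet> flux r))"
proof -
  show "jp \<in> borel_measurable borel" using assms by (simp add: attains_GH_def)
  have "ereal (inertia / 8) + (enn2ereal (F_VR 1 rho jp) + ereal (LBINT r. jp r \<bullet> flux r)) = ereal (3/4 + inertia / 8)"
    using assms inertia_pos unfolding attains_GH_def flux_kinetic_integral grayce_harris_flux by (simp del: ennreal_plus)
  then show "enn2ereal (F_VR 1 rho jp) = ereal (3/4 - (LBINT r. jp r \<bullet> flux r))"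
    by (cases "enn2ereal (F_VR 1 rho jp)") auto
qed

definition penalty :: "field \<Rightarrow> ennreal" where
  "penalty d = (\<integral>\<^sup>+r. ennreal (sq (d r)) / ennreal (2 * rho r) \<partial>lborel)"

lemma penalty_cong: "AE r in lborel. norm (d r) = norm (d' r) \<Longrightarrow> penalty d = penalty d'"
  unfolding penalty_def by (intro nn_integral_cong_AE) (auto elim!: eventually_mono)

lemma penalty_alt: "penalty d = (\<integral>\<^sup>+r. ennreal (sq (d r) / (2 * rho r)) \<partial>lborel)"
  unfolding penalty_def using AE_rho_pos
  by (intro nn_integral_cong_AE) (auto simp: divide_ennreal elim!: eventually_mono)

text \<open>Used with c = 1 for the reconstructing minimizer and with c = 3 for the competitor
  \<open>j1\<close>.\<close>

lemma penalty_flux: "penalty (\<lambda>r. (c * rho r) *\<^sub>R flux r) = ennreal (c\<^sup>2 * inertia / 8)"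
proof -
  have "penalty (\<lambda>r. (c * rho r) *\<^sub>R flux r) = (\<integral>\<^sup>+r. ennreal (c\<^sup>2 / 2 * (rho r * sq (flux r))) \<partial>lborel)"
    unfolding penalty_alt
  proof (rule nn_integral_cong_AE)
    show "AE r in lborel. ennreal (sq ((c * rho r) *\<^sub>R flux r) / (2 * rho r)) = ennreal (c\<^sup>2 / 2 * (rho r * sq (flux r)))"
      using AE_rho_pos
    proof eventually_elim
      fix r assume "0 < rho r"
      then have "sq ((c * rho r) *\<^sub>R flux r) / (2 * rho r) = c\<^sup>2 / 2 * (rho r * sq (flux r))"
        by (simp add: power_mult_distrib power2_eq_square field_simps)
      then show "ennreal (sq ((c * rho r) *\<^sub>R flux r) / (2 * rho r)) = ennreal (c\<^sup>2 / 2 * (rho r * sq (flux r)))"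
        by simp
    qed
  qed
  also have "\<dots> = ennreal (LBINT r. c\<^sup>2 / 2 * (rho r * sq (flux r)))"
    using flux_rho by (intro nn_integral_eq_integral) auto
  also have "(LBINT r. c\<^sup>2 / 2 * (rho r * sq (flux r))) = c\<^sup>2 * inertia / 8"
    using flux_rho by simp
  finally show ?thesis .
qed

text \<open>A minimizer in \<open>F_D\<close> that reproduces the vector potential equals \<open>jp0\<close>; comparing it with the
  current of the state \<open>psi0\<close> forces \<open>jp0 = 0\<close>, and then the current of \<open>psi1\<close> does better.\<close>

lemma reconstruction_fails:
  assumes att: "attains_GH 1 rho flux jp0" and dm: "diener_minimizer 1 rho (total_current rho flux jp0) jm"
    and rec: "AE r in lborel. rho r \<noteq> 0 \<longrightarrow> (1 / rho r) *\<^sub>R (total_current rho flux jp0 r - jm r) = flux r"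
  shows False
proof -
  note jp0 [measurable] = attains_GH_flux(1)[OF att]
  note [measurable] = flux_borel
  define K where "K = (LBINT r. jp0 r \<bullet> flux r)"
  have F0: "enn2ereal (F_VR 1 rho jp0) = ereal (3/4 - K)" using attains_GH_flux(2)[OF att] by (simp add: K_def)
  let ?j = "total_current rho flux jp0"
  have eq: "AE r in lborel. jm r = jp0 r"
    using rec AE_rho_pos
  proof eventually_elim
    fix r assume h: "rho r \<noteq> 0 \<longrightarrow> (1 / rho r) *\<^sub>R (?j r - jm r) = flux r" and p: "0 < rho r"
    then have "rho r *\<^sub>R ((1 / rho r) *\<^sub>R (?j r - jm r)) = rho r *\<^sub>R flux r" by simp
    with p show "jm r = jp0 r" by (simp add: total_current_def algebra_simps)
  qed
  have obj: "diener_objective 1 rho ?j jp = enn2ereal (F_VR 1 rho jp) - enn2ereal (penalty (\<lambda>r. jp r - ?j r))" for jp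
    by (simp add: diener_objective_def penalty_def)
  have "penalty (\<lambda>r. jm r - ?j r) = penalty (\<lambda>r. (1 * rho r) *\<^sub>R flux r)"
    using eq by (intro penalty_cong) (auto simp: total_current_def elim!: eventually_mono)
  then have objm: "diener_objective 1 rho ?j jm = ereal (3/4 - K - inertia / 8)"
    unfolding obj penalty_flux F_VR_cong_AE[OF eq] F0 using inertia_pos by simp
  have le: "ereal (3/4 - K - inertia / 8) \<le> enn2ereal (F_VR 1 rho jp) - enn2ereal (penalty (\<lambda>r. jp r - ?j r))"
    if [measurable]: "jp \<in> borel_measurable borel" for jp
  proof -
    have "ereal (3/4 - K - inertia / 8) = F_D 1 rho ?j" using dm objm by (simp add: diener_minimizer_def)
    also have "\<dots> \<le> diener_objective 1 rho ?j jp" unfolding F_D_def by (intro INF_lower) simp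
    finally show ?thesis unfolding obj .
  qed
  define y where "y r = sq (?j r) / (2 * rho r)" for r
  define z where "z r = sq (jp0 r) / (2 * rho r)" for r
  have [measurable]: "?j \<in> borel_measurable borel" unfolding total_current_def[abs_def] by measurable
  have [measurable]: "y \<in> borel_measurable borel" "z \<in> borel_measurable borel"
    unfolding y_def[abs_def] z_def[abs_def] by measurable
  have y0: "0 \<le> y r" and z0: "0 \<le> z r" for r by (simp_all add: y_def z_def)
  have pen: "penalty (\<lambda>r. 0 - ?j r) = (\<integral>\<^sup>+r. ennreal (y r) \<partial>lborel)"
    unfolding penalty_alt y_def by simp
  have le0: "ereal (3/4 - K - inertia / 8) \<le> ereal (3/4) - enn2ereal (\<integral>\<^sup>+r. ennreal (y r) \<partial>lborel)"
    using le[of "\<lambda>_. 0"] unfolding F_VR_0 pen by simp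
  \<comment> \<open>\<open>K\<close> is a Bochner integral and would be 0 by convention if its
    integrand were not integrable. Finiteness of the penalty of the competitor 0 excludes this: it
    makes \<open>y\<close> integrable, then \<open>z\<close>, and so the product of
    \<open>jp0\<close> with \<open>flux\<close>.\<close>
  have fin: "(\<integral>\<^sup>+r. ennreal (y r) \<partial>lborel) \<noteq> \<infinity>"
    using le0 by auto
  have iy: "integrable lborel y"
    using fin y0 by (intro integrableI_bounded) (auto simp: less_top)
  have y_eq: "(\<integral>\<^sup>+r. ennreal (y r) \<partial>lborel) = ennreal (LBINT r. y r)"
    using iy y0 by (intro nn_integral_eq_integral) auto
  have "0 \<le> (LBINT r. y r)" using y0 by (intro integral_nonneg_AE) auto
  with le0 have ybound: "(LBINT r. y r) \<le> K + inertia / 8" unfolding y_eq by simp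
  \<comment> \<open>Integrated, this says that int y = int z + K + inertia/8, so
    \<open>ybound\<close> leaves int z <= 0.\<close>
  have expand: "y r = z r + jp0 r \<bullet> flux r + 1/2 * (rho r * sq (flux r))" if "0 < rho r" for r
  proof -
    have "sq (?j r) = sq (jp0 r) + 2 * rho r * (jp0 r \<bullet> flux r) + (rho r)\<^sup>2 * sq (flux r)"
      unfolding total_current_def power2_norm_eq_inner
      by (simp add: inner_add inner_commute power2_eq_square algebra_simps)
    with that show ?thesis by (simp add: y_def z_def field_simps power2_eq_square)
  qed
  \<comment> \<open>Bounds \<open>z\<close> without the cross term of \<open>expand\<close>, whose
    integrability is still open at this point.\<close>
  have zle: "z r \<le> 2 * y r + (rho r * sq (flux r))" if p: "0 < rho r" for r
  proof -
    have "sq (jp0 r) \<le> 2 * sq (?j r) + 2 * sq (- (rho r *\<^sub>R flux r))"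
      using norm_add_square_le[of "?j r" "- (rho r *\<^sub>R flux r)"] by (simp add: total_current_def)
    then have "sq (jp0 r) / (2 * rho r) \<le> (2 * sq (?j r) + 2 * ((rho r)\<^sup>2 * sq (flux r))) / (2 * rho r)"
      using p by (intro divide_right_mono) (auto simp: power_mult_distrib)
    also have "\<dots> = 2 * y r + rho r * sq (flux r)"
      using p by (simp add: y_def field_simps power2_eq_square)
    finally show ?thesis by (simp add: z_def)
  qed
  have iz: "integrable lborel z"
  proof (rule Bochner_Integration.integrable_bound)
    show "integrable lborel (\<lambda>r. 2 * y r + rho r * sq (flux r))" using iy flux_rho by simp
    show "AE r in lborel. norm (z r) \<le> norm (2 * y r + rho r * sq (flux r))"
      using AE_rho_pos by eventually_elim (use zle z0 y0 in auto)
  qed measurable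
  let ?f = "\<lambda>r. y r - z r - 1/2 * (rho r * sq (flux r))"
  have "K = (LBINT r. ?f r)"
    unfolding K_def
  proof (rule integral_cong_AE)
    show "AE r in lborel. jp0 r \<bullet> flux r = ?f r"
      using AE_rho_pos by eventually_elim (simp add: expand)
  qed measurable
  also have "\<dots> = (LBINT r. y r) - (LBINT r. z r) - inertia / 8"
    using iy iz flux_rho by simp
  finally have "(LBINT r. z r) \<le> 0" using ybound by simp
  moreover have "0 \<le> (LBINT r. z r)" using z0 by (intro integral_nonneg_AE) auto
  ultimately have "(LBINT r. z r) = 0" by linarith
  then have "AE r in lborel. z r = 0"
    using iz z0 by (subst (asm) integral_nonneg_eq_0_iff_AE) auto
  then have jp0_zero: "AE r in lborel. jp0 r = 0"
    using AE_rho_pos by eventually_elim (auto simp: z_def)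
  have "K = (\<integral>r. 0 \<partial>(lborel :: (real^3) measure))"
    unfolding K_def using jp0_zero by (intro integral_cong_AE) (auto elim!: eventually_mono)
  then have K: "K = 0" by simp
  \<comment> \<open>Here j1 - j = -2 rho A - rho A. The penalty grows from inertia/8 to 9 inertia/8,
    while F_VR grows by at most inertia/2.\<close>
  have "penalty (\<lambda>r. j1 r - ?j r) = penalty (\<lambda>r. (3 * rho r) *\<^sub>R flux r)"
  proof (rule penalty_cong)
    show "AE r in lborel. norm (j1 r - ?j r) = norm ((3 * rho r) *\<^sub>R flux r)"
      using jp0_zero
    proof eventually_elim
      fix r assume "jp0 r = 0"
      then have "j1 r - ?j r = - ((3 * rho r) *\<^sub>R flux r)"
        by (simp add: j1_def total_current_def vec_eq_iff)
      then show "norm (j1 r - ?j r) = norm ((3 * rho r) *\<^sub>R flux r)" by (simp only: norm_minus_cancel)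
    qed
  qed
  then have pen1: "penalty (\<lambda>r. j1 r - ?j r) = ennreal (9 * inertia / 8)" unfolding penalty_flux by simp
  have "j1 \<in> borel_measurable borel" unfolding j1_def[abs_def] by measurable
  from le[OF this] have "ereal (3/4 - inertia / 8) \<le> enn2ereal (F_VR 1 rho j1) - ereal (9 * inertia / 8)"
    unfolding pen1 using K inertia_pos by simp
  also have "\<dots> \<le> ereal (3/4 + inertia / 2) - ereal (9 * inertia / 8)"
  proof (rule ereal_minus_mono)
    show "enn2ereal (F_VR 1 rho j1) \<le> ereal (3/4 + inertia / 2)"
      using F_VR_j1 inertia_pos by (simp add: less_eq_ennreal.rep_eq del: ennreal_plus)
  qed simp
  \<comment> \<open>The chain reads 3/4 - inertia/8 <= 3/4 - 5 inertia/8.\<close>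
  finally show False using inertia_pos by simp
qed

theorem proposition3:
  shows "\<exists>(N::nat) (\<rho> :: real^3 \<Rightarrow> real) (A :: real^3 \<Rightarrow> real^3).
    N \<ge> 1 \<and> electron_density N \<rho> \<and>
    A \<in> borel_measurable lborel \<and>
    (\<integral>\<^sup>+r. ennreal (\<rho> r * (norm (A r))\<^sup>2) \<partial>lborel) < \<infinity> \<and>
    grayce_harris N \<rho> A < \<infinity> \<and>
    (\<exists>jp0. attains_GH N \<rho> A jp0) \<and>
    (\<forall>jp0 jm. attains_GH N \<rho> A jp0 \<longrightarrow>
       diener_minimizer N \<rho> (total_current \<rho> A jp0) jm \<longrightarrow>
       \<not> (AE r in lborel. \<rho> r \<noteq> 0 \<longrightarrow>
            (1 / \<rho> r) *\<^sub>R (total_current \<rho> A jp0 r - jm r) = A r))"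
proof (rule exI[of _ 1], rule exI[of _ rho], rule exI[of _ flux], intro conjI allI impI notI)
  show "electron_density 1 rho"
    using nn_integral_eq_integral[OF rho_integrable] by (simp add: electron_density_def integral_rho)
  show "flux \<in> borel_measurable lborel" using flux_borel by simp
  show "(\<integral>\<^sup>+r. ennreal (rho r * sq (flux r)) \<partial>lborel) < \<infinity>"
    using nn_integral_eq_integral[OF flux_rho(1)] by simp
  show "grayce_harris 1 rho flux < \<infinity>" by (simp add: grayce_harris_flux)
  show "\<exists>jp0. attains_GH 1 rho flux jp0" using attains_GH_0 by blast
qed (use reconstruction_fails in auto)

end
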